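(* Let $X$ be a curve over $\mathbf{F}_{q^\ell}$ ($\ell\ge 1$), let $P_1,\dots,P_n$ be distinct $\mathbf{F}_{q^\ell}$-rational points of $X$, set $D:=P_1+\cdots+P_n$, and let $G$ be a divisor on $X$ whose support avoids $P_1,\dots,P_n$. Let $G^+,G^-$ be the two positive divisors with disjoint supports such that $G=G^+-G^-$. Assume that $G^-$ is reduced and that $G^+$, $G^-$ and $D$ have pairwise disjoint supports. Let $s_{G^-}$ be the number of places supporting $G^-$. Then $$\dim_{\mathbf{F}_q}Car_q(D,G)\ \ge\ n-1+s_{G^-}-\ell\deg(G^+)-h^1(G).$$
   Context: Let $p$ be a prime, $q$ a power of $p$, and $\ell\ge 1$ an integer. A curve is smooth, projective and geometrically irreducible. For a curve $X$ over $\mathbf{F}_{q^\ell}$, $F$ is its function field and $\Omega_{F/\mathbf{F}_{q^\ell}}$ its space of rational differential forms. For a divisor $A$ on $X$, $\Omega(A):=H^0(X,\Omega_X\otimes\mathcal{O}_X(-A))=\{\omega\in\Omega_{F/\mathbf{F}_{q^\ell}} : v_P(\omega)\ge v_P(A)\text{ for all places }P\}$ (with $v_P(0)=+\infty$), and $h^1(A):=\dim_{\mathbf{F}_{q^\ell}}\Omega(A)$. "Positive divisor" means effective divisor ($\ge 0$); a positive divisor is reduced if all places of its support (of any degree) have coefficient $1$. Cartier operator: let $x$ be a separating element of $F/\mathbf{F}_{q^\ell}$. Each $\omega\in\Omega_{F/\mathbf{F}_{q^\ell}}$ can be written $\omega=(f_0^p+f_1^px+\cdots+f_{p-1}^px^{p-1})\,dx$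 with $f_i\in F$, and $\mathcal{C}(\omega):=f_{p-1}\,dx$ (independent of the choice of $x$). If $q=p^m$, then $\mathcal{C}_q:=\mathcal{C}^m$ (the $m$-fold iterate), an $\mathbf{F}_q$-linear map satisfying $\mathrm{res}_P(\mathcal{C}_q(\omega))=\mathrm{res}_P(\omega)^{1/q}$. Let $\Omega(G-D)^{\mathcal{C}_q}:=\{\omega\in\Omega(G-D):\mathcal{C}_q(\omega)=\omega\}$. The Cartier code is the $\mathbf{F}_q$-linear code $$Car_q(D,G):=\{(\mathrm{res}_{P_1}(\omega),\dots,\mathrm{res}_{P_n}(\omega)) : \omega\in\Omega(G-D)^{\mathcal{C}_q}\}\subseteq\mathbf{F}_q^n.$$ *)

theory Defs
  imports "HOL-Analysis.Analysis" "HOL-Library.Poly_Mapping"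
    "HOL-Computational_Algebra.Polynomial" "HOL-Computational_Algebra.Primes"
begin

section \<open>Fields, function fields and curves\<close>

text \<open>A field extension is given by two field types and an embedding between them.\<close>

definition field_embedding :: "('a::field \<Rightarrow> 'b::field) \<Rightarrow> bool" where
  "field_embedding h \<longleftrightarrow> h 0 = 0 \<and> h 1 = 1 \<and>
     (\<forall>a b. h (a + b) = h a + h b) \<and> (\<forall>a b. h (a * b) = h a * h b)"

definition algebraic_over :: "('k::field \<Rightarrow> 'f::field) \<Rightarrow> 'f \<Rightarrow> bool" where
  "algebraic_over \<iota> x \<longleftrightarrow> (\<exists>r :: 'k poly. r \<noteq> 0 \<and> poly (map_poly \<iota> r) x = 0)"

definition simple_extension :: "('k::field \<Rightarrow> 'f::field) \<Rightarrow> 'f \<Rightarrow> 'f set" where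
  "simple_extension \<iota> x =
     {poly (map_poly \<iota> r) x / poly (map_poly \<iota> s) x | r s. poly (map_poly \<iota> s) x \<noteq> 0}"

definition separable_over :: "'f::field set \<Rightarrow> 'f \<Rightarrow> bool" where
  "separable_over L y \<longleftrightarrow>
     (\<exists>r. r \<noteq> 0 \<and> (\<forall>i. coeff r i \<in> L) \<and> poly r y = 0 \<and> coprime r (pderiv r))"

definition separating_element :: "('k::field \<Rightarrow> 'f::field) \<Rightarrow> 'f \<Rightarrow> bool" where
  "separating_element \<iota> x \<longleftrightarrow>
     \<not> algebraic_over \<iota> x \<and> (\<forall>y. separable_over (simple_extension \<iota> x) y)"

text \<open>
  Smooth projective geometrically irreducible curves over a perfect field \<open>K\<close> correspond to
  finitely generated extensions \<open>F\<close> of transcendence degree one in which \<open>K\<close> is algebraically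
  closed. The curve enters only through its function field: its closed points are the places of
  \<open>F\<close> over \<open>K\<close>. In the definition below, the third condition says that the field of constants is
  exactly \<open>K\<close>; as \<open>K\<close> is perfect, this is geometric irreducibility.
\<close>

definition curve_function_field :: "('k::field \<Rightarrow> 'f::field) \<Rightarrow> bool" where
  "curve_function_field \<iota> \<longleftrightarrow>
     field_embedding \<iota> \<and>
     (\<exists>x. \<not> algebraic_over \<iota> x \<and>
        (\<exists>B. finite B \<and>
           (\<forall>y. \<exists>c. (\<forall>b\<in>B. c b \<in> simple_extension \<iota> x) \<and> y = (\<Sum>b\<in>B. c b * b)))) \<and>
     (\<forall>y. algebraic_over \<iota> y \<longrightarrow> y \<in> range \<iota>)"


section \<open>Places and divisors\<close>

text \<open>
  A place is identified with its normalized discrete valuation. The value at \<open>0\<close>, which should be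
  \<open>\<infinity>\<close>, is set to \<open>0\<close> so that each place has a unique representing function. Hence
  the valuation ring is \<open>{f. 0 \<le> v f}\<close>, but the maximal ideal is \<open>{f. f = 0 \<or> 0 < v f}\<close>.
\<close>

type_synonym 'f place = "'f \<Rightarrow> int"

definition is_place :: "('k::field \<Rightarrow> 'f::field) \<Rightarrow> 'f place \<Rightarrow> bool" where
  "is_place \<iota> v \<longleftrightarrow> v 0 = 0 \<and>
     (\<forall>x y. x \<noteq> 0 \<longrightarrow> y \<noteq> 0 \<longrightarrow> v (x * y) = v x + v y) \<and>
     (\<forall>x y. x \<noteq> 0 \<longrightarrow> y \<noteq> 0 \<longrightarrow> x + y \<noteq> 0 \<longrightarrow> min (v x) (v y) \<le> v (x + y)) \<and>
     (\<forall>a. v (\<iota> a) = 0) \<and> surj v"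

definition valuation_ring :: "'f::field place \<Rightarrow> 'f set" where
  "valuation_ring v = {f. f = 0 \<or> 0 \<le> v f}"

definition maximal_ideal :: "'f::field place \<Rightarrow> 'f set" where
  "maximal_ideal v = {f. f = 0 \<or> 0 < v f}"

text \<open>The dimension over \<open>K\<close> of the residue field: \<open>B\<close> represents a basis of it.\<close>

definition place_degree :: "('k::field \<Rightarrow> 'f::field) \<Rightarrow> 'f place \<Rightarrow> nat" where
  "place_degree \<iota> v =
     (THE n. \<exists>B. finite B \<and> card B = n \<and> B \<subseteq> valuation_ring v \<and>
        (\<forall>c. (\<Sum>b\<in>B. \<iota> (c b) * b) \<in> maximal_ideal v \<longrightarrow> (\<forall>b\<in>B. c b = 0)) \<and>
        (\<forall>f\<in>valuation_ring v. \<exists>c. f - (\<Sum>b\<in>B. \<iota> (c b) * b) \<in> maximal_ideal v))"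

definition rational_place :: "('k::field \<Rightarrow> 'f::field) \<Rightarrow> 'f place \<Rightarrow> bool" where
  "rational_place \<iota> v \<longleftrightarrow> is_place \<iota> v \<and> place_degree \<iota> v = 1"

text \<open>
  The coefficient of a divisor \<open>A\<close> at \<open>v\<close> is \<^term>\<open>Poly_Mapping.lookup A v\<close>, its support is
  \<^term>\<open>Poly_Mapping.keys A\<close>.
\<close>

type_synonym 'f divisor = "'f place \<Rightarrow>\<^sub>0 int"

definition is_divisor :: "('k::field \<Rightarrow> 'f::field) \<Rightarrow> 'f divisor \<Rightarrow> bool" where
  "is_divisor \<iota> A \<longleftrightarrow> (\<forall>v\<in>Poly_Mapping.keys A. is_place \<iota> v)"

definition positive_divisor :: "('k::field \<Rightarrow> 'f::field) \<Rightarrow> 'f divisor \<Rightarrow> bool" where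
  "positive_divisor \<iota> A \<longleftrightarrow> is_divisor \<iota> A \<and> (\<forall>v. 0 \<le> Poly_Mapping.lookup A v)"

definition reduced_divisor :: "'f::field divisor \<Rightarrow> bool" where
  "reduced_divisor A \<longleftrightarrow> (\<forall>v\<in>Poly_Mapping.keys A. Poly_Mapping.lookup A v = 1)"

definition divisor_degree :: "('k::field \<Rightarrow> 'f::field) \<Rightarrow> 'f divisor \<Rightarrow> int" where
  "divisor_degree \<iota> A =
     (\<Sum>v\<in>Poly_Mapping.keys A. Poly_Mapping.lookup A v * int (place_degree \<iota> v))"


section \<open>Rational differential forms\<close>

text \<open>
  The module of Kaehler differentials of \<open>F\<close> over \<open>K\<close> is the \<open>F\<close>-vector space generated by
  symbols \<open>d g\<close> with \<open>g \<in> F\<close>, subject to additivity, the Leibniz rule and \<open>d a = 0\<close> for constants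
  \<open>a\<close>. The free module on the symbols is \<^typ>\<open>'f \<Rightarrow>\<^sub>0 'f\<close>; \<open>(\<Omega>, d)\<close> is a module of Kaehler
  differentials if the canonical map from this free module onto \<open>\<Omega>\<close> is surjective and its kernel
  is spanned by the relations. Here \<open>\<Omega>\<close> is the whole type \<open>'w\<close>, with scalar multiplication
  \<open>smul\<close>.
\<close>

definition kaehler_relations :: "('k::field \<Rightarrow> 'f::field) \<Rightarrow> ('f \<Rightarrow>\<^sub>0 'f) set" where
  "kaehler_relations \<iota> =
     {Poly_Mapping.single (g + h) 1 - Poly_Mapping.single g 1 - Poly_Mapping.single h 1 | g h. True} \<union>
     {Poly_Mapping.single (g * h) 1 - Poly_Mapping.single h g - Poly_Mapping.single g h | g h. True} \<union>
     {Poly_Mapping.single (\<iota> a) 1 | a. True}"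

definition kaehler_differentials ::
    "('k::field \<Rightarrow> 'f::field) \<Rightarrow> ('f \<Rightarrow> 'w::ab_group_add \<Rightarrow> 'w) \<Rightarrow> ('f \<Rightarrow> 'w) \<Rightarrow> bool" where
  "kaehler_differentials \<iota> smul d \<longleftrightarrow>
     vector_space smul \<and>
     (let ev = (\<lambda>s :: 'f \<Rightarrow>\<^sub>0 'f. \<Sum>g\<in>Poly_Mapping.keys s. smul (Poly_Mapping.lookup s g) (d g))
      in surj ev \<and>
         {s. ev s = 0} = module.span (\<lambda>c. Poly_Mapping.map ((*) c)) (kaehler_relations \<iota>))"

text \<open>
  If \<open>t\<close> is a local parameter at \<open>v\<close>, then \<open>d t\<close> generates the stalk of the canonical sheaf there,
  so \<open>\<omega> = f d t\<close> has order \<open>v f\<close>. The order does not depend on \<open>t\<close>. It is only used for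
  \<open>\<omega> \<noteq> 0\<close>.
\<close>

definition form_order ::
    "('f::field \<Rightarrow> 'w::ab_group_add \<Rightarrow> 'w) \<Rightarrow> ('f \<Rightarrow> 'w) \<Rightarrow> 'f place \<Rightarrow> 'w \<Rightarrow> int" where
  "form_order smul d v \<omega> =
     (THE n. \<exists>t f. v t = 1 \<and> f \<noteq> 0 \<and> \<omega> = smul f (d t) \<and> n = v f)"

definition form_space ::
    "('k::field \<Rightarrow> 'f::field) \<Rightarrow> ('f \<Rightarrow> 'w::ab_group_add \<Rightarrow> 'w) \<Rightarrow> ('f \<Rightarrow> 'w) \<Rightarrow> 'f divisor \<Rightarrow> 'w set" where
  "form_space \<iota> smul d A =
     {\<omega>. \<omega> = 0 \<or> (\<forall>v. is_place \<iota> v \<longrightarrow> Poly_Mapping.lookup A v \<le> form_order smul d v \<omega>)}"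

definition h1 ::
    "('k::field \<Rightarrow> 'f::field) \<Rightarrow> ('f \<Rightarrow> 'w::ab_group_add \<Rightarrow> 'w) \<Rightarrow> ('f \<Rightarrow> 'w) \<Rightarrow> 'f divisor \<Rightarrow> nat" where
  "h1 \<iota> smul d A = vector_space.dim (\<lambda>a. smul (\<iota> a)) (form_space \<iota> smul d A)"

text \<open>
  The residue at a rational place: the coefficient of \<open>1 / t\<close> in the expansion of \<open>f\<close> in powers of
  a local parameter \<open>t\<close>, where \<open>\<omega> = f d t\<close>. The coefficient of \<open>1 / t ^ Suc i\<close> is \<open>c i\<close>; only the
  principal part of the expansion is needed. The residue does not depend on \<open>t\<close>.
\<close>

definition form_residue ::
    "('k::field \<Rightarrow> 'f::field) \<Rightarrow> ('f \<Rightarrow> 'w::ab_group_add \<Rightarrow> 'w) \<Rightarrow> ('f \<Rightarrow> 'w) \<Rightarrow> 'f place \<Rightarrow> 'w \<Rightarrow> 'k" where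
  "form_residue \<iota> smul d v \<omega> =
     (THE a. \<exists>t f N c. v t = 1 \<and> \<omega> = smul f (d t) \<and>
        f - (\<Sum>i\<le>(N::nat). \<iota> (c i) / t ^ Suc i) \<in> valuation_ring v \<and> a = c 0)"


section \<open>The Cartier operator and Cartier codes\<close>

text \<open>\<open>cartier p\<close> is the Cartier operator in characteristic \<open>p\<close>.\<close>

definition cartier ::
    "nat \<Rightarrow> ('k::field \<Rightarrow> 'f::field) \<Rightarrow> ('f \<Rightarrow> 'w::ab_group_add \<Rightarrow> 'w) \<Rightarrow> ('f \<Rightarrow> 'w) \<Rightarrow> 'w \<Rightarrow> 'w" where
  "cartier p \<iota> smul d \<omega> =
     (THE \<eta>. \<exists>x f. separating_element \<iota> x \<and>
        \<omega> = smul (\<Sum>i<p. f i ^ p * x ^ i) (d x) \<and> \<eta> = smul (f (p - 1)) (d x))"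

text \<open>The forms in \<open>\<Omega>(A)\<close> fixed by the \<open>m\<close>-th iterate of the Cartier operator.\<close>

definition cartier_fixed_forms ::
    "nat \<Rightarrow> nat \<Rightarrow> ('k::field \<Rightarrow> 'f::field) \<Rightarrow> ('f \<Rightarrow> 'w::ab_group_add \<Rightarrow> 'w) \<Rightarrow> ('f \<Rightarrow> 'w) \<Rightarrow>
     'f divisor \<Rightarrow> 'w set" where
  "cartier_fixed_forms p m \<iota> smul d A =
     {\<omega> \<in> form_space \<iota> smul d A. (cartier p \<iota> smul d ^^ m) \<omega> = \<omega>}"

definition point_divisor :: "('n::finite \<Rightarrow> 'f::field place) \<Rightarrow> 'f divisor" where
  "point_divisor P = (\<Sum>i\<in>UNIV. Poly_Mapping.single (P i) 1)"

text \<open>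
  The Cartier code for \<open>q = p ^ m\<close> and \<open>D = P\<^sub>1 + \<dots> + P\<^sub>n\<close>. Its words have coordinates in \<open>K\<close>, lying
  in the subfield with \<open>q\<close> elements.
\<close>

definition cartier_code ::
    "nat \<Rightarrow> nat \<Rightarrow> ('k::field \<Rightarrow> 'f::field) \<Rightarrow> ('f \<Rightarrow> 'w::ab_group_add \<Rightarrow> 'w) \<Rightarrow> ('f \<Rightarrow> 'w) \<Rightarrow>
     ('n::finite \<Rightarrow> 'f place) \<Rightarrow> 'f divisor \<Rightarrow> ('k ^ 'n) set" where
  "cartier_code p m \<iota> smul d P G =
     (\<lambda>\<omega>. \<chi> i. form_residue \<iota> smul d (P i) \<omega>) `
       cartier_fixed_forms p m \<iota> smul d (G - point_divisor P)"

text \<open>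
  The scalar multiplications to which the library's dimension and span are applied satisfy the
  axioms of vector spaces and modules.
\<close>

lemma vector_space_restrict_scalars:
  assumes "field_embedding \<iota>" "vector_space smul"
  shows "vector_space (\<lambda>a. smul (\<iota> a))"
  using assms unfolding field_embedding_def vector_space_def by simp

lemma vector_space_code:
  assumes "field_embedding (j :: 'e::field \<Rightarrow> 'k::field)"
  shows "vector_space (\<lambda>a (w :: 'k ^ 'n). j a *s w)"
  using assms vec.vector_space_axioms vector_space_restrict_scalars by blast

lemma module_free: "module (\<lambda>(c::'f::field) (s :: 'f \<Rightarrow>\<^sub>0 'f). Poly_Mapping.map ((*) c) s)"
proof -
  have lookup_scaled: "Poly_Mapping.lookup (Poly_Mapping.map ((*) c) s) k = c * Poly_Mapping.lookup s k"
    for c :: 'f and s :: "'f \<Rightarrow>\<^sub>0 'f" and k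
    by (simp add: Poly_Mapping.map.rep_eq when_def)
  show ?thesis
    by standard (auto intro!: poly_mapping_eqI simp: lookup_scaled lookup_add algebra_simps)
qed

end

theory Submission
  imports Defs
begin

text \<open>
  Fixed forms are produced from units instead of from the Riemann-Roch theorem. Let \<open>S\<close> consist of
  \<open>P\<^sub>1, \<dots>, P\<^sub>n\<close> and of the places in the support of \<open>G\<^sup>-\<close>. Riemann's inequality and the finiteness of
  the number of effective divisors of given degree show that the group of functions with divisor
  supported on \<open>S\<close> has rank \<open>card S - 1\<close> modulo constants; hence there are \<open>card S - 1\<close> of them whose
  logarithmic differentials \<open>df / f\<close> are independent over the prime field. As the Cartier operator is
  \<open>p\<close>-inverse linear and fixes \<open>df / f\<close>, these forms are even independent over \<open>K\<close>, and their
  \<open>F\<^sub>q\<close>-span \<open>W\<close> is fixed by \<open>C\<^sub>q\<close>; its elements have at most simple poles, all of them in \<open>S\<close>. Vanishing along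
  \<open>G\<^sup>+\<close> imposes at most \<open>l deg G\<^sup>+\<close> conditions over \<open>F\<^sub>q\<close>. The forms in \<open>W\<close> that satisfy them and
  have no residue at any \<open>P\<^sub>i\<close> lie in \<open>\<Omega>(G)\<close>, and fixed forms independent over \<open>F\<^sub>q\<close> are independent
  over \<open>K\<close>, so these forms contribute at most \<open>h\<^sup>1(G)\<close>. As \<open>K\<close> is finite, dimensions are compared by
  counting elements. That \<open>\<Omega>(G)\<close> is finite has to be proved, since the library's dimension of an
  infinite-dimensional space is \<open>0\<close>.
\<close>

section \<open>Linear algebra over integral domains\<close>

text \<open>Forms are handled in one coordinate. For a local parameter \<open>t\<close> at one of
  the points, \<open>1, t, ..., t ^ (p - 1)\<close> is a basis of \<open>F\<close> over
  \<open>F ^ p\<close>; this makes the derivation \<open>pder t\<close> and the Cartier operator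
  \<open>Cop t\<close> explicit and takes the place of power series in computing orders and
  residues. The form \<open>g dt\<close> has order \<open>v g - kappa t v\<close>, so
  \<open>\<Omega>(A)\<close> is a Riemann-Roch space once \<open>kappa t\<close> vanishes at almost
  all places; that is the real obstacle to finiteness and needs an argument on ramification. Places
  are bare valuations, so their existence, the degree \<open>0\<close> of principal divisors and
  Riemann's inequality are all derived from the finiteness of \<open>F\<close> over
  \<open>K(y)\<close> for nonconstant \<open>y\<close>. The term \<open>n - 1 + s\<close> of the
  bound is \<open>card S - 1\<close>; the factor \<open>l\<close> arises because a condition over
  \<open>K\<close> divides the number of forms by at most \<open>card K = q ^ l\<close>.\<close>

lemma homogeneous_system_nontrivial:
  fixes a :: "'i \<Rightarrow> 'j \<Rightarrow> 'a::idom"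
  assumes "finite J" "finite I" "card J < card I"
  shows "\<exists>c. (\<exists>i\<in>I. c i \<noteq> 0) \<and> (\<forall>j\<in>J. (\<Sum>i\<in>I. c i * a i j) = 0)"
  using assms
proof (induction J arbitrary: I a rule: finite_induct)
  case empty
  then obtain i where "i \<in> I" by fastforce
  then show ?case by (intro exI[of _ "\<lambda>_. 1"]) auto
next
  case (insert j J)
  show ?case
  proof (cases "\<exists>i0\<in>I. a i0 j \<noteq> 0")
    case False
    have "card J < card I" using insert by simp
    with insert.IH[OF insert.prems(1) this, of a] False show ?thesis by force
  next
    case True
    then obtain i0 where i0: "i0 \<in> I" "a i0 j \<noteq> 0" by blast
    define I' where "I' = I - {i0}"
    have I': "finite I'" "card J < card I'" "i0 \<notin> I'" "I = insert i0 I'"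
      using insert i0 by (auto simp: I'_def)
    obtain c where c: "\<exists>i\<in>I'. c i \<noteq> 0"
      "\<forall>l\<in>J. (\<Sum>i\<in>I'. c i * (a i0 j * a i l - a i j * a i0 l)) = 0"
      using insert.IH[OF I'(1,2), of "\<lambda>i l. a i0 j * a i l - a i j * a i0 l"] by blast
    \<comment> \<open>Elimination without division, as the scalars only form a domain: the unknown
      \<open>i0\<close> is solved from equation \<open>j\<close>, and the solution of the reduced
      system is multiplied by the pivot \<open>a i0 j\<close> instead.\<close>
    define c' where "c' = (\<lambda>i. if i = i0 then - (\<Sum>i\<in>I'. c i * a i j) else a i0 j * c i)"
    have c'_sum: "(\<Sum>i\<in>I. c' i * a i l) =
        - (\<Sum>i\<in>I'. c i * a i j) * a i0 l + (\<Sum>i\<in>I'. a i0 j * c i * a i l)" for l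
      using I' by (auto simp: c'_def intro!: sum.cong)
    have "\<exists>i\<in>I. c' i \<noteq> 0" using c(1) I'(3,4) i0 by (auto simp: c'_def)
    moreover have "(\<Sum>i\<in>I. c' i * a i l) = 0" if "l \<in> insert j J" for l
    proof (cases "l = j")
      case True
      then show ?thesis unfolding c'_sum True
        by (simp add: sum_distrib_left sum_distrib_right sum_negf algebra_simps)
    next
      case False
      with that c(2) have "(\<Sum>i\<in>I'. c i * (a i0 j * a i l - a i j * a i0 l)) = 0" by blast
      moreover have "(\<Sum>i\<in>I'. c i * (a i0 j * a i l - a i j * a i0 l)) =
          (\<Sum>i\<in>I'. a i0 j * c i * a i l) - (\<Sum>i\<in>I'. c i * a i j) * a i0 l"
        unfolding sum_distrib_right sum_subtractf[symmetric]
        by (intro sum.cong refl) (simp add: algebra_simps)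
      ultimately show ?thesis unfolding c'_sum by simp
    qed
    ultimately show ?thesis by blast
  qed
qed

section \<open>Linear dependence over a domain inside a field, with denominators cleared\<close>

definition domain_embedding :: "('a::idom \<Rightarrow> 'f::field) \<Rightarrow> bool" where
  "domain_embedding e \<longleftrightarrow> e 1 = 1 \<and> (\<forall>a b. e (a + b) = e a + e b) \<and>
     (\<forall>a b. e (a * b) = e a * e b) \<and> (\<forall>a. e a = 0 \<longleftrightarrow> a = 0)"

lemma domain_embeddingD:
  assumes "domain_embedding e"
  shows "e 1 = 1" "e 0 = 0" "e (a + b) = e a + e b" "e (a * b) = e a * e b" "e a = 0 \<longleftrightarrow> a = 0"
    "e (- a) = - e a" "e (\<Sum>i\<in>I. u i) = (\<Sum>i\<in>I. e (u i))"
proof -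
  show *: "e 1 = 1" "e 0 = 0" "e (a + b) = e a + e b" "e (a * b) = e a * e b" "e a = 0 \<longleftrightarrow> a = 0" for a b
    using assms unfolding domain_embedding_def by auto
  show "e (- a) = - e a" using *(3)[of a "- a"] *(2) by (simp add: eq_neg_iff_add_eq_0 add.commute)
  show "e (\<Sum>i\<in>I. u i) = (\<Sum>i\<in>I. e (u i))"
    by (induction I rule: infinite_finite_induct) (auto simp: *)
qed

definition lin_indep :: "('a::idom \<Rightarrow> 'f::field) \<Rightarrow> 'i set \<Rightarrow> ('i \<Rightarrow> 'f) \<Rightarrow> bool" where
  "lin_indep e I u \<longleftrightarrow> (\<forall>a. (\<Sum>i\<in>I. e (a i) * u i) = 0 \<longrightarrow> (\<forall>i\<in>I. a i = 0))"

lemma lin_indepD: "lin_indep e I u \<Longrightarrow> (\<Sum>i\<in>I. e (a i) * u i) = 0 \<Longrightarrow> i \<in> I \<Longrightarrow> a i = 0"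
  by (simp add: lin_indep_def)

text \<open>Membership in the span of \<open>b\<close> over the fraction field of the image of
  \<open>e\<close>, with the denominator \<open>g\<close> moved to the other side. The scalars in
  use are \<open>peval y r\<close> and \<open>peval x r ^ p\<close>.\<close>

definition in_frac_span :: "('a::idom \<Rightarrow> 'f::field) \<Rightarrow> 'j set \<Rightarrow> ('j \<Rightarrow> 'f) \<Rightarrow> 'f \<Rightarrow> bool" where
  "in_frac_span e J b f \<longleftrightarrow> (\<exists>g a. g \<noteq> 0 \<and> e g * f = (\<Sum>j\<in>J. e (a j) * b j))"

lemma in_frac_spanI:
  "g \<noteq> 0 \<Longrightarrow> e g * f = (\<Sum>j\<in>J. e (a j) * b j) \<Longrightarrow> in_frac_span e J b f"
  unfolding in_frac_span_def by (intro exI[of _ g] exI[of _ a]) simp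

text \<open>With denominators cleared, more \<open>u\<close> than \<open>b\<close> leave a
  homogeneous system with more unknowns than equations. A solution \<open>c\<close> gives the
  relation with coefficients \<open>c i * g i\<close>, nontrivial because the \<open>g i\<close> are
  nonzero.\<close>

lemma card_lin_indep_le:
  assumes e: "domain_embedding e" and fin: "finite J" "finite I"
    and span: "\<And>i. i \<in> I \<Longrightarrow> in_frac_span e J b (u i)" and ind: "lin_indep e I u"
  shows "card I \<le> card J"
proof (rule ccontr)
  note [simp] = domain_embeddingD[OF e]
  assume "\<not> card I \<le> card J"
  moreover have "\<forall>i\<in>I. \<exists>g a. g \<noteq> 0 \<and> e g * u i = (\<Sum>j\<in>J. e (a j) * b j)"
    using span unfolding in_frac_span_def by blast
  then obtain g a where ga: "\<And>i. i \<in> I \<Longrightarrow> g i \<noteq> 0"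
    "\<And>i. i \<in> I \<Longrightarrow> e (g i) * u i = (\<Sum>j\<in>J. e (a i j) * b j)" by metis
  ultimately obtain c where c: "\<exists>i\<in>I. c i \<noteq> 0" "\<forall>j\<in>J. (\<Sum>i\<in>I. c i * a i j) = 0"
    using homogeneous_system_nontrivial[OF fin, of a] by force
  have "(\<Sum>i\<in>I. e (c i * g i) * u i) = (\<Sum>i\<in>I. e (c i) * (\<Sum>j\<in>J. e (a i j) * b j))"
    using ga by (intro sum.cong) (auto simp: mult.assoc)
  also have "\<dots> = (\<Sum>j\<in>J. \<Sum>i\<in>I. e (c i) * e (a i j) * b j)"
    by (subst sum.swap) (simp add: sum_distrib_left mult_ac)
  also have "\<dots> = (\<Sum>j\<in>J. e (\<Sum>i\<in>I. c i * a i j) * b j)"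
    by (simp add: sum_distrib_right)
  also have "\<dots> = 0" using c(2) by simp
  finally have "\<forall>i\<in>I. c i * g i = 0" using ind unfolding lin_indep_def by (elim allE[of _ "\<lambda>i. c i * g i"]) auto
  with c(1) ga(1) show False by auto
qed

text \<open>A finite independent set of largest cardinality spans: adding any \<open>f\<close> makes
  it dependent, and \<open>f\<close> must occur in the dependence.\<close>

lemma frac_basis_exists:
  fixes e :: "'a::idom \<Rightarrow> 'f::field"
  assumes e: "domain_embedding e"
    and bound: "\<And>I :: 'f set. finite I \<Longrightarrow> lin_indep e I (\<lambda>x. x) \<Longrightarrow> card I \<le> M"
  obtains B where "finite B" "lin_indep e B (\<lambda>x. x)" "\<And>f. in_frac_span e B (\<lambda>x. x) f"
proof -
  note [simp] = domain_embeddingD[OF e]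
  let ?P = "\<lambda>B. finite B \<and> lin_indep e B (\<lambda>x. x)"
  have "?P {}" by (simp add: lin_indep_def)
  then obtain B where B: "?P B" and max: "\<And>B'. ?P B' \<Longrightarrow> card B' \<le> card B"
    using ex_has_greatest_nat[of ?P "{}" card "Suc M"] bound by (auto simp: less_Suc_eq_le)
  have "in_frac_span e B (\<lambda>x. x) f" for f
  proof (cases "f \<in> B")
    case True
    have "e 1 * f = (\<Sum>j\<in>B. e (if j = f then 1 else 0) * j)"
      using B True by (simp add: if_distrib[of e] if_distrib[of "\<lambda>x. x * _"] sum.delta cong: if_cong)
    then show ?thesis by (intro in_frac_spanI[of 1]) simp
  next
    case False
    then have "\<not> ?P (insert f B)" using max[of "insert f B"] B by auto
    then obtain a where a: "(\<Sum>i\<in>insert f B. e (a i) * i) = 0" "\<exists>i\<in>insert f B. a i \<noteq> 0"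
      using B unfolding lin_indep_def by auto
    have s: "e (a f) * f = (\<Sum>i\<in>B. e (- a i) * i)"
      using a(1) B False by (simp add: sum_negf eq_neg_iff_add_eq_0)
    have "a f \<noteq> 0"
    proof
      assume 0: "a f = 0"
      then have "(\<Sum>i\<in>B. e (a i) * i) = 0" using a(1) B False by simp
      then have "\<forall>i\<in>B. a i = 0" using lin_indepD[OF conjunct2[OF B], of a] by simp
      with 0 a(2) show False by auto
    qed
    then show ?thesis using s by (rule in_frac_spanI)
  qed
  with B show thesis by (intro that[of B]) auto
qed

lemma in_frac_span_base:
  assumes e: "domain_embedding e" and "finite J" "j \<in> J"
  shows "in_frac_span e J b (b j)"
proof -
  have "e 1 * b j = (\<Sum>i\<in>J. e (if i = j then 1 else 0) * b i)"
    using assms by (simp add: domain_embeddingD[OF e] if_distrib[of e] if_distrib[of "\<lambda>x. x * _"] cong: if_cong)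
  then show ?thesis by (intro in_frac_spanI[of 1]) simp
qed

lemma in_frac_span_add:
  assumes e: "domain_embedding e" and "in_frac_span e J b f" "in_frac_span e J b f'"
  shows "in_frac_span e J b (f + f')"
proof -
  note [simp] = domain_embeddingD[OF e]
  obtain g a g' a' where *: "g \<noteq> 0" "e g * f = (\<Sum>j\<in>J. e (a j) * b j)"
      "g' \<noteq> 0" "e g' * f' = (\<Sum>j\<in>J. e (a' j) * b j)"
    using assms unfolding in_frac_span_def by metis
  have "e (g * g') * (f + f') = e g' * (e g * f) + e g * (e g' * f')" by (simp add: algebra_simps)
  also have "\<dots> = (\<Sum>j\<in>J. e (g' * a j + g * a' j) * b j)"
    unfolding * by (simp add: sum_distrib_left sum.distrib algebra_simps)
  finally show ?thesis by (rule in_frac_spanI[rotated]) (use *(1,3) in simp)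
qed

lemma in_frac_span_scale:
  assumes e: "domain_embedding e" and "in_frac_span e J b f"
  shows "in_frac_span e J b (e c * f)"
proof -
  note [simp] = domain_embeddingD[OF e]
  obtain g a where *: "g \<noteq> 0" "e g * f = (\<Sum>j\<in>J. e (a j) * b j)"
    using assms unfolding in_frac_span_def by metis
  have "e g * (e c * f) = e c * (e g * f)" by (simp add: algebra_simps)
  also have "\<dots> = (\<Sum>j\<in>J. e (c * a j) * b j)"
    unfolding * by (simp add: sum_distrib_left algebra_simps)
  finally show ?thesis by (rule in_frac_spanI[OF *(1)])
qed

lemma in_frac_span_sum:
  assumes e: "domain_embedding e" and "\<And>i. i \<in> I \<Longrightarrow> in_frac_span e J b (f i)"
  shows "in_frac_span e J b (\<Sum>i\<in>I. f i)"
proof -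
  have z: "in_frac_span e J b 0"
    by (rule in_frac_spanI[where g = 1 and a = "\<lambda>_. 0"]) (simp_all add: domain_embeddingD[OF e])
  show ?thesis using assms(2)
    by (induction I rule: infinite_finite_induct) (auto intro!: in_frac_span_add[OF e] simp: z)
qed

lemma in_frac_span_cancel:
  assumes e: "domain_embedding e" and "in_frac_span e J b (e c * f)" "c \<noteq> 0"
  shows "in_frac_span e J b f"
proof -
  note [simp] = domain_embeddingD[OF e]
  obtain g a where *: "g \<noteq> 0" "e g * (e c * f) = (\<Sum>j\<in>J. e (a j) * b j)"
    using assms unfolding in_frac_span_def by metis
  then show ?thesis using assms(3) by (intro in_frac_spanI[of "g * c"]) (auto simp: mult.assoc)
qed

lemma in_frac_span_mult:
  assumes "in_frac_span e J b f" "c \<in> C" "finite C" "finite J" and e: "domain_embedding e"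
  shows "in_frac_span e (J \<times> C) (\<lambda>(j, x). b j * x) (f * c)"
proof -
  note [simp] = domain_embeddingD[OF e]
  obtain g a where *: "g \<noteq> 0" "e g * f = (\<Sum>j\<in>J. e (a j) * b j)"
    using assms unfolding in_frac_span_def by metis
  have "e g * (f * c) = (\<Sum>j\<in>J. e (a j) * b j) * c" by (simp add: *(2)[symmetric])
  also have "\<dots> = (\<Sum>j\<in>J. \<Sum>x\<in>C. e (if x = c then a j else 0) * (b j * x))"
    using assms by (simp add: sum_distrib_right if_distrib[of e] if_distrib[of "\<lambda>x. x * _"] mult.assoc cong: if_cong)
  also have "\<dots> = (\<Sum>z\<in>J \<times> C. e (case z of (j, x) \<Rightarrow> if x = c then a j else 0) * (case z of (j, x) \<Rightarrow> b j * x))"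
    by (simp add: sum.cartesian_product case_prod_unfold)
  finally show ?thesis by (rule in_frac_spanI[OF *(1)])
qed

section \<open>Subrings\<close>

definition subring_of :: "'f::field set \<Rightarrow> bool" where
  "subring_of S \<longleftrightarrow> 0 \<in> S \<and> 1 \<in> S \<and> (\<forall>a\<in>S. \<forall>b\<in>S. a - b \<in> S) \<and> (\<forall>a\<in>S. \<forall>b\<in>S. a * b \<in> S)"

lemma subring_ofD:
  assumes "subring_of S"
  shows "0 \<in> S" "1 \<in> S" "a \<in> S \<Longrightarrow> b \<in> S \<Longrightarrow> a - b \<in> S" "a \<in> S \<Longrightarrow> b \<in> S \<Longrightarrow> a * b \<in> S"
    "a \<in> S \<Longrightarrow> - a \<in> S" "a \<in> S \<Longrightarrow> b \<in> S \<Longrightarrow> a + b \<in> S" "a \<in> S \<Longrightarrow> a ^ n \<in> S"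
    "(\<And>i. i \<in> I \<Longrightarrow> u i \<in> S) \<Longrightarrow> (\<Sum>i\<in>I. u i) \<in> S"
proof -
  show *: "0 \<in> S" "1 \<in> S" "a \<in> S \<Longrightarrow> b \<in> S \<Longrightarrow> a - b \<in> S" "a \<in> S \<Longrightarrow> b \<in> S \<Longrightarrow> a * b \<in> S" for a b
    using assms unfolding subring_of_def by auto
  show m: "a \<in> S \<Longrightarrow> - a \<in> S" for a using *(3)[OF *(1), of a] by simp
  show p: "a \<in> S \<Longrightarrow> b \<in> S \<Longrightarrow> a + b \<in> S" for a b using *(3)[OF _ m, of a b] by simp
  show "a \<in> S \<Longrightarrow> a ^ n \<in> S" by (induction n) (auto simp: *)
  show "(\<And>i. i \<in> I \<Longrightarrow> u i \<in> S) \<Longrightarrow> (\<Sum>i\<in>I. u i) \<in> S"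
    by (induction I rule: infinite_finite_induct) (auto simp: * p)
qed

definition adjoin :: "'f::field set \<Rightarrow> 'f \<Rightarrow> 'f set" where
  "adjoin S z = {poly r z | r. \<forall>i. coeff r i \<in> S}"

lemma adjoinI: "(\<And>i. coeff r i \<in> S) \<Longrightarrow> poly r z \<in> adjoin S z"
  by (auto simp: adjoin_def)

lemma subset_adjoin: "subring_of S \<Longrightarrow> a \<in> S \<Longrightarrow> a \<in> adjoin S z"
  using adjoinI[of "[:a:]" S z] by (auto simp: coeff_pCons subring_ofD split: nat.splits)

lemma mem_adjoin: "subring_of S \<Longrightarrow> z \<in> adjoin S z"
  using adjoinI[of "[:0,1:]" S z] by (auto simp: coeff_pCons subring_ofD split: nat.splits)

lemma subring_adjoin:
  assumes S: "subring_of S"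
  shows "subring_of (adjoin S z)"
proof -
  have "a - b \<in> adjoin S z \<and> a * b \<in> adjoin S z" if "a \<in> adjoin S z" "b \<in> adjoin S z" for a b
  proof -
    from that obtain r s where rs: "a = poly r z" "b = poly s z"
      "\<And>i. coeff r i \<in> S" "\<And>i. coeff s i \<in> S" unfolding adjoin_def by blast
    have "poly (r - s) z \<in> adjoin S z" "poly (r * s) z \<in> adjoin S z"
      by (rule adjoinI, use rs in \<open>simp add: subring_ofD(3)[OF S]\<close>)
        (rule adjoinI, use rs in \<open>simp add: coeff_mult subring_ofD(4,8)[OF S]\<close>)
    then show ?thesis using rs by simp
  qed
  then show ?thesis using subset_adjoin[OF S] subring_ofD(1,2)[OF S] unfolding subring_of_def by blast
qed

lemma adjoin_subset:
  assumes T: "subring_of T" and "S \<subseteq> T" "z \<in> T"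
  shows "adjoin S z \<subseteq> T"
proof
  fix f assume "f \<in> adjoin S z"
  then obtain r where r: "f = poly r z" "\<And>i. coeff r i \<in> S" unfolding adjoin_def by blast
  show "f \<in> T" unfolding r(1) poly_altdef using r(2) assms by (auto intro!: subring_ofD[OF T])
qed

section \<open>Counting\<close>

text \<open>Subtracting a chosen representative of the fibre embeds \<open>X\<close> into the
  product of the kernel and \<open>R\<close>. Finiteness of \<open>X\<close> is part of the
  conclusion.\<close>

lemma card_le_card_kernel_mult:
  fixes \<psi> :: "'a::ab_group_add \<Rightarrow> 'b::ab_group_add"
  assumes sub: "\<And>x y. x \<in> X \<Longrightarrow> y \<in> X \<Longrightarrow> x - y \<in> X"
    and hom: "\<And>x y. x \<in> X \<Longrightarrow> y \<in> X \<Longrightarrow> \<psi> (x - y) = \<psi> x - \<psi> y"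
    and ker: "finite {x \<in> X. \<psi> x = 0}" and img: "\<psi> ` X \<subseteq> R" "finite R"
  shows "finite X \<and> card X \<le> card {x \<in> X. \<psi> x = 0} * card R"
proof -
  define s where "s = (\<lambda>r. SOME x. x \<in> X \<and> \<psi> x = r)"
  have s: "s (\<psi> x) \<in> X" "\<psi> (s (\<psi> x)) = \<psi> x" if "x \<in> X" for x
    using someI[of "\<lambda>y. y \<in> X \<and> \<psi> y = \<psi> x" x] that unfolding s_def by auto
  define h where "h = (\<lambda>x. (x - s (\<psi> x), \<psi> x))"
  have sub: "h ` X \<subseteq> {x \<in> X. \<psi> x = 0} \<times> R"
    using s img sub hom by (auto simp: h_def)
  have inj: "inj_on h X" by (auto simp: inj_on_def h_def)
  have fin: "finite ({x \<in> X. \<psi> x = 0} \<times> R)" using ker img by simp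
  have "finite X" using finite_imageD[OF finite_subset[OF sub fin] inj] .
  moreover have "card X \<le> card ({x \<in> X. \<psi> x = 0} \<times> R)" using card_inj_on_le[OF inj sub fin] .
  ultimately show ?thesis by (simp add: card_cartesian_product)
qed

text \<open>Multiplication by \<open>x\<close> permutes the nonzero elements and so leaves their
  product unchanged.\<close>

lemma power_card_field:
  fixes x :: "'a::field"
  assumes fin: "finite (UNIV :: 'a set)"
  shows "x ^ CARD('a) = x"
proof (cases "x = 0")
  case False
  have "(\<Prod>y\<in>-{0}. y) = (\<Prod>y\<in>-{0}. x * y)"
    by (rule prod.reindex_bij_witness[of _ "\<lambda>y. x * y" "\<lambda>y. y / x"]) (use False in auto)
  also have "\<dots> = x ^ card (-{0::'a}) * (\<Prod>y\<in>-{0}. y)" by (simp add: prod.distrib)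
  finally have "x ^ card (-{0::'a}) = 1" using fin by (simp add: finite_subset[OF subset_UNIV])
  moreover have "CARD('a) = Suc (card (-{0::'a}))"
    using fin card_gt_0_iff[of "UNIV :: 'a set"] by (simp add: Compl_eq_Diff_UNIV)
  ultimately show ?thesis by simp
qed (use fin in \<open>auto simp: card_gt_0_iff\<close>)

lemma of_nat_card_field:
  assumes fin: "finite (UNIV :: 'a::field set)"
  shows "of_nat CARD('a) = (0::'a)"
proof -
  have "(\<Sum>x\<in>UNIV. x) = (\<Sum>x\<in>UNIV. x + (1::'a))"
    by (rule sum.reindex_bij_witness[of _ "\<lambda>x. x + 1" "\<lambda>x. x - 1"]) auto
  then show ?thesis by (simp add: sum.distrib)
qed

lemma diff_power_prime_char:
  fixes a b :: "'a::comm_ring_1"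
  assumes p: "prime p" "CHAR('a) = p"
  shows "(a - b) ^ p ^ n = a ^ p ^ n - b ^ p ^ n"
  using freshmans_dream'[of "p ^ n" n "a - b" b] p by (simp add: eq_diff_eq)

text \<open>\<open>X ^ Q - X\<close> has at most \<open>Q\<close> roots, so the \<open>Q\<close>
  known ones in \<open>A\<close> are all. This recognizes the subfield with \<open>q\<close>
  elements and the prime field inside \<open>K\<close>.\<close>

lemma card_fixed_powers:
  fixes A :: "'a::field set"
  assumes Q: "1 < Q" and A: "finite A" "card A = Q" "\<And>a. a \<in> A \<Longrightarrow> a ^ Q = a" and b: "b ^ Q = b"
  shows "b \<in> A"
proof -
  define r where "r = monom 1 Q - monom (1 :: 'a) 1"
  have "coeff r Q = 1" using Q by (simp add: r_def coeff_diff)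
  then have r0: "r \<noteq> 0" by auto
  have deg: "degree r \<le> Q" by (rule degree_le) (use Q in \<open>simp add: r_def coeff_diff\<close>)
  have roots: "{x. poly r x = 0} = {x. x ^ Q = x}" by (simp add: r_def poly_monom)
  have fin: "finite {x :: 'a. x ^ Q = x}" using poly_roots_finite[OF r0] roots by simp
  have "card {x :: 'a. x ^ Q = x} \<le> Q"
    using card_poly_roots_bound[OF r0] deg roots by simp
  then have "A = {x. x ^ Q = x}" using A fin by (intro card_seteq) auto
  with b show ?thesis by blast
qed

text \<open>Each element of \<open>S\<close> is determined by its coordinates in a basis, so
  counting \<open>S\<close> bounds the dimension from below. \<open>S\<close> need not be a
  subspace.\<close>

lemma card_le_power_dim:
  fixes scale :: "'e::field \<Rightarrow> 'b::ab_group_add \<Rightarrow> 'b"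
  assumes vs: "vector_space scale" and fin: "finite (UNIV :: 'e set)" "finite S"
  shows "card S \<le> CARD('e) ^ vector_space.dim scale S"
proof -
  interpret vector_space scale by (rule vs)
  obtain B where B: "B \<subseteq> S" "independent B" "S \<subseteq> span B" "card B = dim S"
    using basis_exists by blast
  have finB: "finite B" using B(1) fin(2) finite_subset by blast
  define \<Phi> where "\<Phi> = (\<lambda>u. \<Sum>b\<in>B. scale (u b) b)"
  have "S \<subseteq> \<Phi> ` (B \<rightarrow>\<^sub>E UNIV)"
  proof
    fix x assume "x \<in> S"
    then obtain u where "x = (\<Sum>b\<in>B. scale (u b) b)" using B(3) span_finite[OF finB] by auto
    then have "x = \<Phi> (restrict u B)" by (simp add: \<Phi>_def)
    then show "x \<in> \<Phi> ` (B \<rightarrow>\<^sub>E UNIV)" by auto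
  qed
  moreover have finE: "finite (B \<rightarrow>\<^sub>E (UNIV :: 'e set))" using finB fin(1) by (intro finite_PiE) auto
  ultimately have "card S \<le> card (B \<rightarrow>\<^sub>E (UNIV :: 'e set))" by (rule surj_card_le[rotated])
  then show ?thesis using B(4) by (simp add: card_PiE finB)
qed

lemma dim_mono_independent:
  fixes scale :: "'e::field \<Rightarrow> 'b::ab_group_add \<Rightarrow> 'b"
  assumes vs: "vector_space scale" and S: "finite S" "B \<subseteq> S" and B: "\<not> module.dependent scale B"
  shows "card B \<le> vector_space.dim scale S"
proof -
  interpret vector_space scale by (rule vs)
  obtain C where C: "B \<subseteq> C" "C \<subseteq> S" "independent C" "S \<subseteq> span C"
    using maximal_independent_subset_extend[OF S(2) B] by blast
  have "dim S = card C" using basis_card_eq_dim[OF C(2,4,3)] by simp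
  moreover have "card B \<le> card C" using C(1,2) S(1) finite_subset by (intro card_mono) blast+
  ultimately show ?thesis by simp
qed

section \<open>Function fields\<close>

lemma field_embedding_simps:
  assumes "field_embedding h"
  shows "h 0 = 0" "h 1 = 1" "h (a + b) = h a + h b" "h (a * b) = h a * h b"
    "h (- a) = - h a" "h (a - b) = h a - h b" "h a = 0 \<longleftrightarrow> a = 0" "h a = h b \<longleftrightarrow> a = b"
    "h (a ^ n) = h a ^ n" "h (inverse a) = inverse (h a)" "h (of_nat n) = of_nat n"
proof -
  show *: "h 0 = 0" "h 1 = 1" "h (a + b) = h a + h b" "h (a * b) = h a * h b" for a b
    using assms unfolding field_embedding_def by auto
  show "h (- a) = - h a" using *(3)[of a "- a"] *(1) by (simp add: eq_neg_iff_add_eq_0 add.commute)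
  show diff: "h (a - b) = h a - h b" for a b using *(3)[of "a - b" b] by simp
  have inv: "h a * h (inverse a) = 1" if "a \<noteq> 0" for a
    using *(4)[of a "inverse a"] *(2) that by simp
  show zero: "h a = 0 \<longleftrightarrow> a = 0" for a by (cases "a = 0") (use inv[of a] *(1) in auto)
  show "h a = h b \<longleftrightarrow> a = b" using zero[of "a - b"] diff[of a b] by simp
  show "h (a ^ n) = h a ^ n" by (induction n) (simp_all add: *)
  show "h (inverse a) = inverse (h a)"
    using inv[of a] *(1) inverse_unique[of "h a" "h (inverse a)"] by (cases "a = 0") auto
  show "h (of_nat n) = of_nat n" by (induction n) (simp_all add: *)
qed

locale function_field =
  fixes p :: nat and \<iota> :: "'k::field \<Rightarrow> 'f::field"
  assumes prime_p: "prime p" and finite_const: "finite (UNIV :: 'k set)"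
    and char_const: "of_nat p = (0 :: 'k)" and curve: "curve_function_field \<iota>"
begin

lemma embedding: "field_embedding \<iota>"
  using curve unfolding curve_function_field_def by blast

lemmas emb [simp] = field_embedding_simps(1-4)[OF embedding]
  and emb_minus [simp] = field_embedding_simps(5)[OF embedding]
  and emb_diff [simp] = field_embedding_simps(6)[OF embedding]
  and emb_eq_0_iff [simp] = field_embedding_simps(7)[OF embedding]
  and emb_eq_iff [simp] = field_embedding_simps(8)[OF embedding]
  and emb_power [simp] = field_embedding_simps(9)[OF embedding]
  and emb_inverse [simp] = field_embedding_simps(10)[OF embedding]
  and emb_of_nat [simp] = field_embedding_simps(11)[OF embedding]

lemma inj_emb: "inj \<iota>"
  by (auto simp: inj_def)

lemma emb_sum [simp]: "\<iota> (\<Sum>i\<in>I. u i) = (\<Sum>i\<in>I. \<iota> (u i))"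
  by (induction I rule: infinite_finite_induct) auto

lemma finite_range_emb: "finite (range \<iota>)" "card (range \<iota>) = CARD('k)"
  using finite_const card_image[OF inj_emb] by auto

lemma char_field: "CHAR('k) = p" "CHAR('f) = p"
proof -
  have "CHAR('a) = p" if "of_nat p = (0 :: 'a)" for x :: "'a::field"
  proof -
    have "CHAR('a) dvd p" using that by (simp add: of_nat_eq_0_iff_char_dvd)
    moreover have "CHAR('a) \<noteq> 1" by simp
    ultimately show ?thesis using prime_p by (metis prime_nat_iff)
  qed
  moreover have "of_nat p = (0 :: 'f)" using emb_of_nat[of p] char_const by simp
  ultimately show "CHAR('k) = p" "CHAR('f) = p" using char_const by blast+
qed

lemma of_nat_p [simp]: "of_nat p = (0 :: 'f)"
  using of_nat_CHAR[where ?'a = 'f] char_field by simp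

lemma of_nat_neq_0: "0 < n \<Longrightarrow> n < p \<Longrightarrow> of_nat n \<noteq> (0 :: 'f)"
  using char_field(2) by (auto simp: of_nat_eq_0_iff_char_dvd dest: dvd_imp_le)

lemma p_pos: "0 < p" "1 < p"
  using prime_gt_1_nat[OF prime_p] by auto

lemma add_pow: "(a + b :: 'f) ^ p ^ n = a ^ p ^ n + b ^ p ^ n"
  using freshmans_dream'[where ?'a = 'f] char_field prime_p by metis

lemma sum_pow: "(\<Sum>i\<in>I. u i :: 'f) ^ p ^ n = (\<Sum>i\<in>I. u i ^ p ^ n)"
  using freshmans_dream_sum'[where ?'a = 'f] char_field prime_p by metis

lemma diff_pow: "(a - b :: 'f) ^ p ^ n = a ^ p ^ n - b ^ p ^ n"
  using diff_power_prime_char[OF prime_p char_field(2)] .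

lemma minus_pow: "(- b :: 'f) ^ p ^ n = - (b ^ p ^ n)"
  using diff_pow[of 0 b n] p_pos by simp

lemmas add_p = add_pow[of _ _ 1, simplified]
  and sum_p = sum_pow[of _ _ 1, simplified]
  and diff_p = diff_pow[of _ _ 1, simplified]
  and minus_p = minus_pow[of _ 1, simplified]

lemma p_power_inject: "(a :: 'f) ^ p ^ n = b ^ p ^ n \<longleftrightarrow> a = b"
  using diff_pow[of a b n] p_pos by auto

text \<open>Frobenius is injective on a finite field, hence surjective. This puts \<open>K\<close>
  inside \<open>F ^ p\<close> for all later expansions over \<open>F ^ p\<close>.\<close>

lemma const_p_power: "\<exists>b :: 'k. b ^ p ^ n = a"
proof -
  have "inj (\<lambda>b :: 'k. b ^ p ^ n)"
  proof (rule injI)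
    fix a b :: 'k assume "a ^ p ^ n = b ^ p ^ n"
    then show "a = b" using diff_power_prime_char[OF prime_p char_field(1), of a b n] p_pos by auto
  qed
  then have "surj (\<lambda>b :: 'k. b ^ p ^ n)" using finite_const finite_UNIV_inj_surj by blast
  then show ?thesis by (metis surjD)
qed

section \<open>Polynomial expressions in one function, and transcendence degree one\<close>

definition peval :: "'f \<Rightarrow> 'k poly \<Rightarrow> 'f" where
  "peval y r = poly (map_poly \<iota> r) y"

lemma map_poly_emb_add: "map_poly \<iota> (r + s) = map_poly \<iota> r + map_poly \<iota> s"
  by (intro poly_eqI) (simp add: coeff_map_poly)

lemma map_poly_emb_mult: "map_poly \<iota> (r * s) = map_poly \<iota> r * map_poly \<iota> s"
  by (intro poly_eqI) (simp add: coeff_map_poly coeff_mult)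

lemma peval_simps [simp]:
  "peval y 0 = 0" "peval y 1 = 1" "peval y (r + s) = peval y r + peval y s"
  "peval y (r * s) = peval y r * peval y s" "peval y (pCons a r) = \<iota> a + y * peval y r"
  by (simp_all add: peval_def map_poly_emb_add map_poly_emb_mult map_poly_pCons)

lemma peval_monom [simp]: "peval y (monom a n) = \<iota> a * y ^ n"
  by (simp add: peval_def map_poly_monom poly_monom)

lemma peval_minus [simp]: "peval y (- r) = - peval y r"
  using peval_simps(3)[of y r "- r"] by (simp add: eq_neg_iff_add_eq_0 add.commute)

lemma peval_diff [simp]: "peval y (r - s) = peval y r - peval y s"
  using peval_simps(3)[of y r "- s"] by simp

lemma peval_sum [simp]: "peval y (\<Sum>i\<in>I. u i) = (\<Sum>i\<in>I. peval y (u i))"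
  by (induction I rule: infinite_finite_induct) auto

lemma peval_prod [simp]: "peval y (\<Prod>i\<in>I. u i) = (\<Prod>i\<in>I. peval y (u i))"
  by (induction I rule: infinite_finite_induct) auto

lemma peval_power [simp]: "peval y (r ^ n) = peval y r ^ n"
  by (induction n) auto

lemma peval_eq_sum:
  assumes "degree r \<le> d"
  shows "peval y r = (\<Sum>i\<le>d. \<iota> (coeff r i) * y ^ i)"
proof -
  have "r = (\<Sum>i\<le>d. monom (coeff r i) i)" using poly_as_sum_of_monoms'[OF assms] by simp
  then have "peval y r = peval y (\<Sum>i\<le>d. monom (coeff r i) i)" by simp
  then show ?thesis by simp
qed

lemma const_imp_algebraic: "algebraic_over \<iota> (\<iota> a)"
  unfolding algebraic_over_def
  by (rule exI[of _ "[:- a, 1:]"]) (simp add: map_poly_pCons)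

text \<open>The constants are algebraically closed in \<open>F\<close>, so a nonconstant
  \<open>y\<close> is transcendental and \<open>K[y]\<close> is a polynomial ring.\<close>

lemma peval_eq_0_iff:
  assumes "y \<notin> range \<iota>"
  shows "peval y r = 0 \<longleftrightarrow> r = 0"
  using assms curve unfolding curve_function_field_def algebraic_over_def peval_def by auto

lemma domain_embedding_peval:
  assumes "y \<notin> range \<iota>"
  shows "domain_embedding (peval y)"
  unfolding domain_embedding_def using peval_eq_0_iff[OF assms] by simp

lemma inverse_nonconst: "y \<notin> range \<iota> \<Longrightarrow> inverse y \<notin> range \<iota>"
proof
  assume "y \<notin> range \<iota>" "inverse y \<in> range \<iota>"
  then obtain a where "inverse y = \<iota> a" by auto
  then have "y = \<iota> (inverse a)" by (metis emb_inverse inverse_inverse_eq)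
  with \<open>y \<notin> range \<iota>\<close> show False by blast
qed

lemma generators:
  obtains x B where "x \<notin> range \<iota>" "finite B" "\<And>f. in_frac_span (peval x) B (\<lambda>b. b) f"
proof -
  obtain x B where x: "\<not> algebraic_over \<iota> x" and B: "finite B"
    "\<And>y. \<exists>c. (\<forall>b\<in>B. c b \<in> simple_extension \<iota> x) \<and> y = (\<Sum>b\<in>B. c b * b)"
    using curve unfolding curve_function_field_def by blast
  have xr: "x \<notin> range \<iota>" using x const_imp_algebraic by auto
  have "in_frac_span (peval x) B (\<lambda>b. b) f" for f
  proof -
    obtain c where c: "\<forall>b\<in>B. c b \<in> simple_extension \<iota> x" "f = (\<Sum>b\<in>B. c b * b)" using B by blast
    then have "\<forall>b\<in>B. \<exists>r s. c b = peval x r / peval x s \<and> s \<noteq> 0"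
      unfolding simple_extension_def peval_def[symmetric] by fastforce
    then obtain r s where rs: "\<And>b. b \<in> B \<Longrightarrow> c b = peval x (r b) / peval x (s b)" "\<And>b. b \<in> B \<Longrightarrow> s b \<noteq> 0"
      by metis
    have "peval x (\<Prod>b\<in>B. s b) * f = (\<Sum>b\<in>B. peval x (r b * (\<Prod>i\<in>B - {b}. s i)) * b)"
      unfolding c(2) sum_distrib_left
    proof (rule sum.cong)
      fix b assume b: "b \<in> B"
      have "peval x (\<Prod>b\<in>B. s b) = peval x (s b) * peval x (\<Prod>i\<in>B - {b}. s i)"
        using b B(1) by (simp add: prod.remove)
      then show "peval x (prod s B) * (c b * b) = peval x (r b * prod s (B - {b})) * b"
        using rs[OF b] peval_eq_0_iff[OF xr] by (simp add: field_simps)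
    qed simp
    moreover have "(\<Prod>b\<in>B. s b) \<noteq> 0" using rs B by simp
    ultimately show ?thesis by (rule in_frac_spanI[rotated])
  qed
  then show thesis using that xr B by blast
qed

text \<open>From \<open>x ^ n\<close> on, powers are reduced by the relation shifted by
  \<open>x ^ (m - n)\<close>; its leading coefficient may be divided by, as fractions are
  allowed.\<close>

lemma power_in_frac_span:
  assumes e: "domain_embedding e" and rel: "(\<Sum>i\<le>n. e (s i) * x ^ i) = 0" "s n \<noteq> 0"
  shows "in_frac_span e {..<n} (\<lambda>i. x ^ i) (x ^ m)"
proof (induction m rule: less_induct)
  case (less m)
  note [simp] = domain_embeddingD[OF e]
  show ?case
  proof (cases "m < n")
    case True
    then show ?thesis using in_frac_span_base[OF e, of "{..<n}" m "\<lambda>i. x ^ i"] by simp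
  next
    case False
    then have m: "x ^ m = x ^ (m - n) * x ^ n" by (simp flip: power_add)
    have "e (s n) * x ^ n = (\<Sum>i<n. e (- s i) * x ^ i)"
      using rel(1) by (simp add: lessThan_Suc_atMost[symmetric] sum_negf add_eq_0_iff2)
    then have "x ^ (m - n) * (e (s n) * x ^ n) = x ^ (m - n) * (\<Sum>i<n. e (- s i) * x ^ i)"
      by simp
    then have "e (s n) * x ^ m = (\<Sum>i<n. e (- s i) * x ^ (m - n + i))"
      unfolding m by (simp only: sum_distrib_left power_add mult_ac)
    moreover have "in_frac_span e {..<n} (\<lambda>i. x ^ i) (\<Sum>i<n. e (- s i) * x ^ (m - n + i))"
      using False by (intro in_frac_span_sum[OF e] in_frac_span_scale[OF e] less.IH) auto
    ultimately show ?thesis using in_frac_span_cancel[OF e _ rel(2)] by metis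
  qed
qed

text \<open>Since \<open>F\<close> is finite over \<open>K(x)\<close>, sufficiently many powers of
  \<open>y\<close> are dependent over \<open>K[x]\<close>. Sorting the same relation by powers of
  \<open>x\<close> instead of \<open>y\<close> shows that \<open>x\<close> is algebraic over
  \<open>K(y)\<close>.\<close>

lemma exchange_relation:
  assumes x: "x \<notin> range \<iota>" "finite B" "\<And>f. in_frac_span (peval x) B (\<lambda>b. b) f" and y: "y \<notin> range \<iota>"
  obtains n s where "(\<Sum>i\<le>n. peval y (s i) * x ^ i) = 0" "s n \<noteq> 0"
proof -
  define M where "M = card B"
  have "\<not> lin_indep (peval x) {..M} (\<lambda>j. y ^ j)"
    using card_lin_indep_le[OF domain_embedding_peval[OF x(1)] x(2), of "{..M}" "\<lambda>b. b" "\<lambda>j. y ^ j"] x(3)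
    by (auto simp: M_def)
  then obtain r j0 where r: "(\<Sum>j\<le>M. peval x (r j) * y ^ j) = 0" "j0 \<le> M" "r j0 \<noteq> 0"
    unfolding lin_indep_def by auto
  define d where "d = Max ((\<lambda>j. degree (r j)) ` {..M})"
  have d: "degree (r j) \<le> d" if "j \<le> M" for j using that by (auto simp: d_def)
  define s where "s = (\<lambda>i. \<Sum>j\<le>M. monom (coeff (r j) i) j)"
  have "(\<Sum>i\<le>d. peval y (s i) * x ^ i) = (\<Sum>i\<le>d. \<Sum>j\<le>M. \<iota> (coeff (r j) i) * x ^ i * y ^ j)"
    by (simp add: s_def sum_distrib_left sum_distrib_right mult_ac)
  also have "\<dots> = (\<Sum>j\<le>M. peval x (r j) * y ^ j)"
    by (subst sum.swap) (simp add: peval_eq_sum[OF d] sum_distrib_right)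
  finally have rel: "(\<Sum>i\<le>d. peval y (s i) * x ^ i) = 0" using r by simp
  define i0 where "i0 = degree (r j0)"
  have "coeff (s i0) j0 = coeff (r j0) i0"
    using r(2) by (simp add: s_def coeff_sum coeff_monom)
  then have s0: "s i0 \<noteq> 0" "i0 \<le> d" using r d by (auto simp: i0_def)
  \<comment> \<open>Truncation at the last nonzero coefficient, because
    \<open>power_in_frac_span\<close> divides by the top one.\<close>
  define n where "n = Max {i. i \<le> d \<and> s i \<noteq> 0}"
  have "n \<in> {i. i \<le> d \<and> s i \<noteq> 0}" unfolding n_def using s0 by (intro Max_in) auto
  then have n: "s n \<noteq> 0" "n \<le> d" "\<And>i. i \<le> d \<Longrightarrow> s i \<noteq> 0 \<Longrightarrow> i \<le> n"
    by (auto simp: n_def)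
  have "(\<Sum>i\<le>n. peval y (s i) * x ^ i) = (\<Sum>i\<le>d. peval y (s i) * x ^ i)"
    using n by (intro sum.mono_neutral_left) fastforce+
  with rel n that show thesis by metis
qed

text \<open>Finiteness over \<open>K(x)\<close> for one \<open>x\<close> is transferred to every
  nonconstant \<open>y\<close>: \<open>x\<close> satisfies a relation of degree \<open>n\<close>
  over \<open>K(y)\<close>, so the \<open>n * card B\<close> products \<open>x ^ i * b\<close> bound
  the size of independent sets.\<close>

lemma function_field_basis:
  assumes y: "y \<notin> range \<iota>"
  obtains B where "finite B" "lin_indep (peval y) B (\<lambda>b. b)" "\<And>f. in_frac_span (peval y) B (\<lambda>b. b) f"
proof -
  obtain x B where x: "x \<notin> range \<iota>" and B: "finite B" "\<And>f. in_frac_span (peval x) B (\<lambda>b. b) f"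
    using generators by blast
  obtain n s where rel: "(\<Sum>i\<le>n. peval y (s i) * x ^ i) = 0" "s n \<noteq> 0"
    by (rule exchange_relation[OF x B y])
  note e = domain_embedding_peval[OF y]
  have bound: "card I \<le> card ({..<n} \<times> B)" if I: "finite I" "lin_indep (peval y) I (\<lambda>f. f)" for I :: "'f set"
  proof -
    have "\<forall>f. \<exists>g a. g \<noteq> 0 \<and> peval x g * f = (\<Sum>b\<in>B. peval x (a b) * b)"
      using B(2) by (simp add: in_frac_span_def)
    then obtain g a where ga: "\<And>f. g f \<noteq> 0" "\<And>f. peval x (g f) * f = (\<Sum>b\<in>B. peval x (a f b) * b)"
      by metis
    \<comment> \<open>Elements of \<open>I\<close> have denominators in \<open>K[x]\<close>.
      Multiplying all of them by a common denominator keeps them independent and makes each a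
      combination of \<open>B\<close> over \<open>K[x]\<close>.\<close>
    define z where "z = peval x (\<Prod>f\<in>I. g f)"
    have z: "z \<noteq> 0" unfolding z_def using peval_eq_0_iff[OF x] ga I by auto
    have pow: "in_frac_span (peval y) ({..<n} \<times> B) (\<lambda>(i, b). x ^ i * b) (peval x r * b)" if "b \<in> B" for r b
    proof (rule in_frac_span_mult[OF _ that B(1) _ e])
      have eq: "peval x r = (\<Sum>i\<le>degree r. peval y [:coeff r i:] * x ^ i)"
        by (simp add: peval_eq_sum[of r "degree r"])
      show "in_frac_span (peval y) {..<n} (\<lambda>i. x ^ i) (peval x r)"
        unfolding eq by (intro in_frac_span_sum[OF e] in_frac_span_scale[OF e] power_in_frac_span[OF e rel])
    qed simp
    have sp: "in_frac_span (peval y) ({..<n} \<times> B) (\<lambda>(i, b). x ^ i * b) (z * f)" if f: "f \<in> I" for f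
    proof -
      have "z * f = peval x (\<Prod>f\<in>I - {f}. g f) * (peval x (g f) * f)"
        using f I unfolding z_def by (simp add: prod.remove mult_ac)
      also have "\<dots> = (\<Sum>b\<in>B. peval x ((\<Prod>f\<in>I - {f}. g f) * a f b) * b)"
        unfolding ga by (simp add: sum_distrib_left sum_distrib_right mult_ac)
      finally have eq: "z * f = (\<Sum>b\<in>B. peval x ((\<Prod>f\<in>I - {f}. g f) * a f b) * b)" .
      show ?thesis unfolding eq by (intro in_frac_span_sum[OF e] pow)
    qed
    have li: "lin_indep (peval y) I (\<lambda>f. z * f)"
      unfolding lin_indep_def
    proof (intro allI impI)
      fix c assume "(\<Sum>f\<in>I. peval y (c f) * (z * f)) = 0"
      then have "z * (\<Sum>f\<in>I. peval y (c f) * f) = 0" by (simp add: sum_distrib_left mult_ac)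
      then show "\<forall>f\<in>I. c f = 0" using z lin_indepD[OF I(2), of c] by simp
    qed
    show ?thesis by (rule card_lin_indep_le[OF e _ I(1) sp li]) (use B in simp)
  qed
  show thesis by (rule frac_basis_exists[OF e bound]) (use that in auto)
qed

text \<open>In a relation over \<open>K[y]\<close> the constant terms of the coefficients vanish by
  hypothesis; the rest can be divided by \<open>y\<close>, and descent on the degree finishes. This
  is how local data at places are bounded by the degree of \<open>F\<close> over
  \<open>K(y)\<close>.\<close>

lemma lin_indep_modulo:
  assumes R: "subring_of R" "range \<iota> \<subseteq> R" "y \<in> R" "y \<noteq> 0" and u: "finite I" "\<And>i. i \<in> I \<Longrightarrow> u i \<in> R"
    and ind: "\<And>c w. w \<in> R \<Longrightarrow> (\<Sum>i\<in>I. \<iota> (c i) * u i) = y * w \<Longrightarrow> \<forall>i\<in>I. c i = 0"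
  shows "lin_indep (peval y) I u"
proof -
  have pR: "peval y r \<in> R" for r
    by (induction r) (use R in \<open>auto intro!: subring_ofD[OF R(1)]\<close>)
  have "\<forall>i\<in>I. a i = 0" if "\<forall>i\<in>I. a i = 0 \<or> degree (a i) < n" "(\<Sum>i\<in>I. peval y (a i) * u i) = 0" for a n
    using that
  proof (induction n arbitrary: a)
    case (Suc n)
    have "\<forall>i. \<exists>c b. a i = pCons c b" by (meson pCons_cases)
    then obtain c b where cb: "\<And>i. a i = pCons (c i) (b i)" by metis
    have "(\<Sum>i\<in>I. \<iota> (c i) * u i) + y * (\<Sum>i\<in>I. peval y (b i) * u i) = 0"
      using Suc.prems(2) by (simp add: cb sum_distrib_left algebra_simps sum.distrib)
    then have "(\<Sum>i\<in>I. \<iota> (c i) * u i) = y * (- (\<Sum>i\<in>I. peval y (b i) * u i))"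
      by (simp add: eq_neg_iff_add_eq_0)
    moreover have "- (\<Sum>i\<in>I. peval y (b i) * u i) \<in> R"
      using u pR by (auto intro!: subring_ofD[OF R(1)])
    ultimately have c: "\<forall>i\<in>I. c i = 0" using ind by blast
    then have "y * (\<Sum>i\<in>I. peval y (b i) * u i) = 0"
      using \<open>_ + y * _ = 0\<close> by simp
    then have "(\<Sum>i\<in>I. peval y (b i) * u i) = 0" using R(4) by simp
    moreover have "\<forall>i\<in>I. b i = 0 \<or> degree (b i) < n"
      using Suc.prems(1) c cb by (auto split: if_splits)
    ultimately have "\<forall>i\<in>I. b i = 0" using Suc.IH by blast
    with c cb show ?case by simp
  qed auto
  note * = this
  show ?thesis unfolding lin_indep_def
  proof (intro allI impI)
    fix a assume s: "(\<Sum>i\<in>I. peval y (a i) * u i) = 0"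
    have "degree (a i) < Suc (\<Sum>i\<in>I. degree (a i))" if "i \<in> I" for i
      using member_le_sum[of i I "\<lambda>i. degree (a i)"] that u(1) by simp
    then show "\<forall>i\<in>I. a i = 0" using *[of a, OF _ s] by blast
  qed
qed

section \<open>Existence of places\<close>

text \<open>Zorn's lemma, started at \<open>K[y]\<close>, which misses \<open>inverse y\<close>
  because \<open>X r - 1\<close> has constant coefficient \<open>-1\<close>. The maximal ring will
  be the valuation ring of a zero of \<open>y\<close>.\<close>

lemma maximal_subring:
  assumes y: "y \<notin> range \<iota>"
  obtains V where "subring_of V" "range \<iota> \<subseteq> V" "y \<in> V" "inverse y \<notin> V"
    "\<And>R. subring_of R \<Longrightarrow> V \<subseteq> R \<Longrightarrow> inverse y \<notin> R \<Longrightarrow> R = V"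
proof -
  define A where "A = {R. subring_of R \<and> range \<iota> \<subseteq> R \<and> y \<in> R \<and> inverse y \<notin> R}"
  have y0: "y \<noteq> 0" using y rangeI[of \<iota> 0] by auto
  have "inverse y \<noteq> peval y r" for r
  proof
    assume "inverse y = peval y r"
    then have "peval y (pCons 0 r - 1) = 0" using y0 by (simp flip: \<open>inverse y = _\<close>)
    then have "pCons 0 r - 1 = 0" using peval_eq_0_iff[OF y] by blast
    then have "coeff (pCons 0 r - 1) 0 = 0" by simp
    then show False by simp
  qed
  moreover have "subring_of (range (peval y))"
    unfolding subring_of_def
  proof (intro conjI ballI)
    show "0 \<in> range (peval y)" "1 \<in> range (peval y)"
      by (rule range_eqI[of _ _ 0], simp) (rule range_eqI[of _ _ 1], simp)
    fix a b assume "a \<in> range (peval y)" "b \<in> range (peval y)"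
    then obtain r s where "a = peval y r" "b = peval y s" by blast
    then show "a - b \<in> range (peval y)" "a * b \<in> range (peval y)"
      by (auto intro: range_eqI[of _ _ "r - s"] range_eqI[of _ _ "r * s"])
  qed
  moreover have "range \<iota> \<subseteq> range (peval y)"
    using peval_monom[of y _ 0] by (metis image_subsetI mult.right_neutral power_0 rangeI)
  moreover have "y \<in> range (peval y)"
    using peval_monom[of y 1 1] by (metis emb(2) mult.left_neutral power_one_right rangeI)
  ultimately have "range (peval y) \<in> A" unfolding A_def by auto
  moreover have "\<Union>C \<in> A" if C: "C \<noteq> {}" "subset.chain A C" for C
  proof -
    have CA: "\<And>R. R \<in> C \<Longrightarrow> R \<in> A" and ch: "\<And>R S. R \<in> C \<Longrightarrow> S \<in> C \<Longrightarrow> R \<subseteq> S \<or> S \<subseteq> R"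
      using C(2) unfolding subset.chain_def by auto
    have "a - b \<in> \<Union>C \<and> a * b \<in> \<Union>C" if ab: "a \<in> \<Union>C" "b \<in> \<Union>C" for a b
    proof -
      obtain R S where RS: "R \<in> C" "a \<in> R" "S \<in> C" "b \<in> S" using ab by blast
      then obtain T where T: "T \<in> C" "a \<in> T" "b \<in> T" using ch[OF RS(1,3)] by blast
      then have "subring_of T" using CA by (auto simp: A_def)
      with T show ?thesis using subring_ofD(3,4)[of T a b] by blast
    qed
    moreover obtain R where R: "R \<in> C" using C(1) by blast
    ultimately show ?thesis using CA[OF R] CA unfolding A_def subring_of_def by blast
  qed
  ultimately obtain M where M: "M \<in> A" "\<And>X. X \<in> A \<Longrightarrow> M \<subseteq> X \<Longrightarrow> X = M"
    using subset_Zorn_nonempty[of A] by blast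
  show thesis
  proof (rule that[of M])
    fix R assume "subring_of R" "M \<subseteq> R" "inverse y \<notin> R"
    with M(1) have "R \<in> A" unfolding A_def by auto
    then show "R = M" using M(2) \<open>M \<subseteq> R\<close> by blast
  qed (use M(1) in \<open>auto simp: A_def\<close>)
qed

text \<open>Inverting \<open>u = 1 - y * b\<close> cannot produce \<open>inverse y\<close>, since
  all powers of \<open>u\<close> are \<open>1\<close> modulo \<open>y V\<close>; so by maximality
  \<open>u\<close> is a unit already. In other words, \<open>y\<close> lies in every maximal ideal
  of \<open>V\<close>.\<close>

lemma maximal_subring_inverse:
  assumes V: "subring_of V" "y \<in> V" "inverse y \<notin> V" "y \<noteq> 0"
    and max: "\<And>R. subring_of R \<Longrightarrow> V \<subseteq> R \<Longrightarrow> inverse y \<notin> R \<Longrightarrow> R = V" and b: "b \<in> V"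
  shows "inverse (1 - y * b) \<in> V"
proof -
  note OD = subring_ofD[OF V(1)]
  define u where "u = 1 - y * b"
  have uO: "u \<in> V" unfolding u_def by (intro OD b V(2))
  have u0: "u \<noteq> 0"
  proof
    assume "u = 0"
    then have "inverse y = b" using V(4) by (simp add: u_def field_simps)
    with b V(3) show False by simp
  qed
  define R where "R = {a / u ^ n | a n. a \<in> V}"
  have "subring_of R" unfolding subring_of_def
  proof (intro conjI ballI)
    have "0 / u ^ 0 \<in> R" "1 / u ^ 0 \<in> R" unfolding R_def using OD(1,2) by blast+
    then show "0 \<in> R" "1 \<in> R" by simp_all
    fix c d assume "c \<in> R" "d \<in> R"
    then obtain a a' n n' where *: "c = a / u ^ n" "d = a' / u ^ n'" "a \<in> V" "a' \<in> V"
      unfolding R_def by blast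
    have "c - d = (a * u ^ n' - a' * u ^ n) / u ^ (n + n')" "c * d = (a * a') / u ^ (n + n')"
      unfolding *(1,2) using u0 by (simp_all add: field_simps power_add)
    moreover have "a * u ^ n' - a' * u ^ n \<in> V" "a * a' \<in> V" using * uO by (auto intro!: OD(3,4,7))
    ultimately show "c - d \<in> R" "c * d \<in> R" unfolding R_def by blast+
  qed
  moreover have "V \<subseteq> R" unfolding R_def by (auto intro!: exI[of _ "0::nat"] simp: exI)
  moreover have "inverse y \<notin> R"
  proof
    assume "inverse y \<in> R"
    then obtain a n where an: "inverse y = a / u ^ n" "a \<in> V" unfolding R_def by blast
    have "\<exists>b'\<in>V. u ^ n = 1 - y * b'"
    proof (induction n)
      case 0
      show ?case using OD(1) by (intro bexI[of _ 0]) auto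
    next
      case (Suc n)
      then obtain b' where b': "b' \<in> V" "u ^ n = 1 - y * b'" by blast
      have "u ^ Suc n = 1 - y * (b + b' - y * b * b')" by (simp add: b'(2)) (simp add: u_def algebra_simps)
      moreover have "b + b' - y * b * b' \<in> V" using b b' V by (auto intro!: OD)
      ultimately show ?case by blast
    qed
    then obtain b' where b': "b' \<in> V" "u ^ n = 1 - y * b'" by blast
    have "u ^ n = y * a" using an(1) u0 V(4) by (simp add: field_simps)
    then have "inverse y = a + b'" using b'(2) V(4) by (simp add: field_simps)
    then show False using OD(6)[OF an(2) b'(1)] V(3) by simp
  qed
  ultimately have "R = V" by (rule max)
  moreover have "1 / u ^ 1 \<in> R" unfolding R_def using OD(2) by blast
  ultimately show ?thesis by (simp add: u_def divide_inverse)
qed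

text \<open>Chevalley's argument: if neither \<open>z\<close> nor its inverse is in
  \<open>V\<close>, maximality expresses \<open>inverse y\<close> as a polynomial over
  \<open>V\<close> in each of them. Of two shortest expressions, the longer one can be shortened by
  means of the other.\<close>

lemma maximal_subring_valuation:
  assumes V: "subring_of V" "y \<in> V" "inverse y \<notin> V" "y \<noteq> 0"
    and max: "\<And>R. subring_of R \<Longrightarrow> V \<subseteq> R \<Longrightarrow> inverse y \<notin> R \<Longrightarrow> R = V" and z: "z \<noteq> 0"
  shows "z \<in> V \<or> inverse z \<in> V"
proof (rule ccontr)
  note OD = subring_ofD[OF V(1)]
  assume no: "\<not> (z \<in> V \<or> inverse z \<in> V)"
  define Q where "Q = (\<lambda>w n. \<exists>c. (\<forall>i. c i \<in> V) \<and> inverse y = (\<Sum>i<n. c i * w ^ i))"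
  have ex: "\<exists>n. Q w n" if w: "w \<notin> V" for w
  proof -
    have "inverse y \<in> adjoin V w"
      using max[OF subring_adjoin[OF V(1), of w]] subset_adjoin[OF V(1), of _ w] mem_adjoin[OF V(1), of w] w by blast
    then obtain r where "inverse y = poly r w" "\<forall>i. coeff r i \<in> V" unfolding adjoin_def by auto
    then have "Q w (Suc (degree r))" unfolding Q_def
      by (intro exI[of _ "coeff r"]) (auto simp: poly_altdef lessThan_Suc_atMost)
    then show ?thesis by blast
  qed
  have big: "\<exists>m\<ge>1. n = Suc m" if Qn: "Q w n" for w n
  proof -
    obtain c where c: "\<And>i. c i \<in> V" "inverse y = (\<Sum>i<n. c i * w ^ i)"
      using Qn unfolding Q_def by metis
    have "n \<noteq> 0"
    proof
      assume "n = 0"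
      then have "inverse y = 0" using c(2) by simp
      then show False using V(3) OD(1) by metis
    qed
    moreover have "n \<noteq> 1"
    proof
      assume "n = 1"
      then have "inverse y = c 0" using c(2) by simp
      then show False using V(3) c(1) by metis
    qed
    ultimately show ?thesis by (cases n) auto
  qed
  \<comment> \<open>The expression in \<open>inverse w\<close>, multiplied by \<open>w ^ n\<close>,
    makes \<open>(1 - y * s 0) * w ^ n\<close> equal to \<open>y\<close> times a combination of
    lower powers. The factor \<open>1 - y * s 0\<close> is a unit, so the top term of the expression
    in \<open>w\<close> can be replaced.\<close>
  have red: "Q w n" if w: "w \<noteq> 0" "Q w (Suc n)" "Q (inverse w) (Suc m)" "m \<le> n" "1 \<le> n" for w n m
  proof -
    obtain c where c: "\<And>i. c i \<in> V" "inverse y = (\<Sum>i<Suc n. c i * w ^ i)" using w(2) unfolding Q_def by metis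
    obtain s where s: "\<And>i. s i \<in> V" "inverse y = (\<Sum>i<Suc m. s i * inverse w ^ i)"
      using w(3) unfolding Q_def by metis
    define u where "u = 1 - y * s 0"
    have iu: "inverse u \<in> V" unfolding u_def by (rule maximal_subring_inverse[OF V max s(1)])
    have u0: "u \<noteq> 0"
    proof
      assume "u = 0"
      then have "inverse y = s 0" using V(4) by (simp add: u_def field_simps)
      with s(1) V(3) show False by metis
    qed
    define T where "T = (\<Sum>j<n. (if n - j \<le> m then s (n - j) else 0) * w ^ j)"
    have "w ^ n * inverse y = (\<Sum>i\<le>m. s i * w ^ (n - i))"
      unfolding s(2) sum_distrib_left lessThan_Suc_atMost
    proof (rule sum.cong)
      fix i assume "i \<in> {..m}"
      then have "w ^ n = w ^ (n - i) * w ^ i" using w(4) by (simp flip: power_add)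
      then show "w ^ n * (s i * inverse w ^ i) = s i * w ^ (n - i)"
        using w(1) by (simp add: field_simps)
    qed simp
    also have "\<dots> = s 0 * w ^ n + (\<Sum>i\<in>{1..m}. s i * w ^ (n - i))"
      by (simp add: atMost_atLeast0 sum.atLeast_Suc_atMost)
    also have "(\<Sum>i\<in>{1..m}. s i * w ^ (n - i)) = (\<Sum>j\<in>{n-m..<n}. s (n - j) * w ^ j)"
      using w(4,5) by (intro sum.reindex_bij_witness[of _ "\<lambda>j. n - j" "\<lambda>i. n - i"]) auto
    also have "\<dots> = T" unfolding T_def by (intro sum.mono_neutral_cong_left) auto
    finally have "u * w ^ n = y * T" using V(4) by (simp add: u_def field_simps)
    then have wn: "w ^ n = y * inverse u * T" using u0 by (simp add: field_simps)
    define c' where "c' = (\<lambda>j. c j + c n * y * inverse u * (if n - j \<le> m then s (n - j) else 0))"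
    have "inverse y = (\<Sum>j<n. c j * w ^ j) + c n * (y * inverse u * T)"
      unfolding c(2) wn[symmetric] by simp
    also have "\<dots> = (\<Sum>j<n. c' j * w ^ j)"
      by (simp add: c'_def T_def sum_distrib_left sum.distrib distrib_right mult.assoc)
    finally have "inverse y = (\<Sum>j<n. c' j * w ^ j)" .
    moreover have "c' j \<in> V" for j unfolding c'_def using c(1) s(1) iu V(2) by (auto intro!: OD)
    ultimately show ?thesis unfolding Q_def by blast
  qed
  define N where "N = (\<lambda>w. LEAST n. Q w n)"
  have N: "Q z (N z)" "Q (inverse z) (N (inverse z))"
    using ex[of z] ex[of "inverse z"] no unfolding N_def by (auto intro: LeastI_ex)
  obtain n m where nm: "N z = Suc n" "1 \<le> n" "N (inverse z) = Suc m" "1 \<le> m"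
    using big[OF N(1)] big[OF N(2)] by auto
  show False
  proof (cases "m \<le> n")
    case True
    then have "Q z n" using red[of z n m] N nm z by simp
    then show False using Least_le[of "Q z" n] nm(1) unfolding N_def by simp
  next
    case False
    then have "Q (inverse z) m" using red[of "inverse z" m n] N nm z by simp
    then show False using Least_le[of "Q (inverse z)" m] nm(3) unfolding N_def by simp
  qed
qed

text \<open>The valuation is discrete because \<open>F\<close> is finite over \<open>K(w)\<close>:
  chains of proper divisors of a nonunit \<open>w\<close> have bounded length. This yields a
  generator \<open>t\<close> of the ideal \<open>M\<close> of nonunits and excludes nonzero elements
  divisible by all powers of \<open>t\<close>, so that \<open>v\<close> is the exponent of
  \<open>t\<close>.\<close>

lemma place_of_valuation_ring:
  assumes V: "subring_of V" "range \<iota> \<subseteq> V" and val: "\<And>z. z \<noteq> 0 \<Longrightarrow> z \<in> V \<or> inverse z \<in> V"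
    and y: "y \<in> V" "inverse y \<notin> V" "y \<notin> range \<iota>"
  shows "\<exists>v. is_place \<iota> v \<and> 0 < v y"
proof -
  note OD = subring_ofD[OF V(1)]
  have cO [simp]: "\<iota> c \<in> V" for c using V(2) by auto
  define M where "M = {a \<in> V. a = 0 \<or> inverse a \<notin> V}"
  have M_O: "a \<in> M \<Longrightarrow> a \<in> V" for a by (simp add: M_def)
  have M_mult: "a * b \<in> M" if "a \<in> M" "b \<in> V" for a b
  proof -
    have "inverse (a * b) \<notin> V" if "a * b \<noteq> 0"
    proof
      assume "inverse (a * b) \<in> V"
      then have "b * inverse (a * b) \<in> V" using \<open>b \<in> V\<close> OD(4) by blast
      moreover have "b * inverse (a * b) = inverse a" using \<open>a * b \<noteq> 0\<close> by (simp add: field_simps)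
      ultimately have "inverse a \<in> V" by (simp only:)
      then show False using \<open>a \<in> M\<close> \<open>a * b \<noteq> 0\<close> by (simp add: M_def)
    qed
    then show ?thesis using that M_O[OF that(1)] OD(4) unfolding M_def by blast
  qed
  have M_add: "a + b \<in> M" if ab: "a \<in> M" "b \<in> M" for a b
  proof -
    have *: "a + b \<in> M" if "a \<in> M" "b \<in> M" "b \<noteq> 0" "a / b \<in> V" for a b
    proof -
      have "a + b = b * (a / b + 1)" using that by (simp add: field_simps)
      also have "\<dots> \<in> M" using that by (intro M_mult OD) auto
      finally show ?thesis .
    qed
    show ?thesis
    proof (cases "a = 0 \<or> b = 0")
      case False
      then have "a / b \<in> V \<or> b / a \<in> V" using val[of "a / b"] by (auto simp: field_simps)
      then show ?thesis using *[of a b] *[of b a] False ab by (auto simp: add.commute)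
    qed (use ab in auto)
  qed
  have M_sum: "(\<Sum>i\<in>I. f i) \<in> M" if "\<And>i. i \<in> I \<Longrightarrow> f i \<in> M" for I :: "nat set" and f
  proof -
    have "0 \<in> M" using OD(1) by (simp add: M_def)
    then show ?thesis using that by (induction I rule: infinite_finite_induct) (auto intro: M_add)
  qed
  have M_minus: "- a \<in> M" if "a \<in> M" for a using M_mult[OF that OD(5)[OF OD(2)]] by simp
  have c_M: "\<iota> c \<notin> M" if "c \<noteq> 0" for c
    using that cO[of "inverse c"] by (auto simp: M_def simp del: cO)
  \<comment> \<open>Each \<open>u i\<close> properly divides \<open>w\<close> and its successors. So
    the \<open>u i\<close> are independent over \<open>K\<close> modulo \<open>w V\<close>: the term
    of lowest index with nonzero coefficient divided by \<open>u i\<close> would be a constant in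
    \<open>M\<close>.\<close>
  have chain: "r \<le> card B" if w: "w \<in> M" "w \<noteq> 0" and B: "finite B" "\<And>f. in_frac_span (peval w) B (\<lambda>b. b) f"
    and u: "\<And>i. i < r \<Longrightarrow> u i \<in> V \<and> u i \<noteq> 0 \<and> w / u i \<in> M" "\<And>i j. i < j \<Longrightarrow> j < r \<Longrightarrow> u j / u i \<in> M"
    for w B r u
  proof -
    have wr: "w \<notin> range \<iota>" using w c_M by auto
    have "lin_indep (peval w) {..<r} u"
    proof (rule lin_indep_modulo[OF V])
      fix c b assume b: "b \<in> V" and eq: "(\<Sum>i<r. \<iota> (c i) * u i) = w * b"
      show "\<forall>i\<in>{..<r}. c i = 0"
      proof (rule ccontr)
        assume "\<not> ?thesis"
        then have "\<exists>i. i < r \<and> c i \<noteq> 0" by auto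
        then obtain i where i: "i < r" "c i \<noteq> 0" and less: "\<And>j. j < i \<Longrightarrow> c j = 0"
          using exists_least_iff[of "\<lambda>i. i < r \<and> c i \<noteq> 0"] by (metis order.strict_trans)
        have "(\<Sum>j<r. \<iota> (c j) * u j) = \<iota> (c i) * u i + (\<Sum>j\<in>{..<r} - {i}. \<iota> (c j) * u j)"
          using i by (simp add: sum.remove)
        also have "(\<Sum>j\<in>{..<r} - {i}. \<iota> (c j) * u j) = (\<Sum>j\<in>{Suc i..<r}. \<iota> (c j) * u j)"
          using less by (intro sum.mono_neutral_right) (auto simp: Suc_le_eq not_less_iff_gr_or_eq)
        finally have "\<iota> (c i) * u i = w * b - (\<Sum>j\<in>{Suc i..<r}. \<iota> (c j) * u j)" using eq by simp
        then have "\<iota> (c i) * u i / u i = (w / u i) * b + - (\<Sum>j\<in>{Suc i..<r}. (u j / u i) * \<iota> (c j))"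
          by (simp add: diff_divide_distrib sum_divide_distrib mult_ac)
        then have "\<iota> (c i) = (w / u i) * b + - (\<Sum>j\<in>{Suc i..<r}. (u j / u i) * \<iota> (c j))"
          using u(1)[OF i(1)] by simp
        also have "\<dots> \<in> M" using u i b by (intro M_add M_mult M_minus M_sum) auto
        finally show False using c_M i by blast
      qed
    qed (use w u M_O in auto)
    then show ?thesis
      using card_lin_indep_le[OF domain_embedding_peval[OF wr] B(1), of "{..<r}" "\<lambda>b. b" u] B(2) by simp
  qed
  have unbounded: False if w: "w \<in> M" "w \<noteq> 0"
    and u: "\<And>r :: nat. \<exists>u :: nat \<Rightarrow> 'f. (\<forall>i<r. u i \<in> V \<and> u i \<noteq> 0 \<and> w / u i \<in> M) \<and> (\<forall>i j. i < j \<and> j < r \<longrightarrow> u j / u i \<in> M)" for w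
  proof -
    have "w \<notin> range \<iota>" using w c_M by auto
    then obtain B where B: "finite B" "\<And>f. in_frac_span (peval w) B (\<lambda>b. b) f"
      using function_field_basis by metis
    obtain u where "\<forall>i<Suc (card B). u i \<in> V \<and> u i \<noteq> 0 \<and> w / u i \<in> M"
      "\<forall>i j. i < j \<and> j < Suc (card B) \<longrightarrow> u j / u i \<in> M" using u[of "Suc (card B)"] by blast
    then show False using chain[OF w B, of "Suc (card B)" u] by simp
  qed
  have y0: "y \<noteq> 0" using y(3) rangeI[of \<iota> 0] by auto
  have yM: "y \<in> M" using y by (simp add: M_def)
  \<comment> \<open>Without a generator, every nonzero \<open>t\<close> in \<open>M\<close> has a
    proper divisor \<open>g t\<close> in \<open>M\<close>; iterating \<open>g\<close> from
    \<open>y\<close> gives chains of any length.\<close>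
  have "\<exists>t\<in>M. t \<noteq> 0 \<and> (\<forall>a\<in>M. a / t \<in> V)"
  proof (rule ccontr)
    assume contra: "\<not> ?thesis"
    have "\<exists>a. a \<in> M \<and> a \<noteq> 0 \<and> t / a \<in> M" if t: "t \<in> M" "t \<noteq> 0" for t
    proof -
      obtain a where a: "a \<in> M" "a / t \<notin> V" using contra t by blast
      then have "a \<noteq> 0" using OD(1) by auto
      moreover have "t / a \<in> M" using val[of "a / t"] a t \<open>a \<noteq> 0\<close> unfolding M_def by auto
      ultimately show ?thesis using a by blast
    qed
    then obtain g where g: "\<And>t. t \<in> M \<Longrightarrow> t \<noteq> 0 \<Longrightarrow> g t \<in> M \<and> g t \<noteq> 0 \<and> t / g t \<in> M" by metis
    define x where "x = (\<lambda>n. (g ^^ n) y)"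
    have x: "x n \<in> M \<and> x n \<noteq> 0" for n by (induction n) (use g yM y0 in \<open>auto simp: x_def\<close>)
    have step: "x n / x (Suc n) \<in> M" for n using g x[of n] by (simp add: x_def)
    have dec: "x a / x (a + Suc b) \<in> M" for a b
    proof (induction b)
      case (Suc b)
      have "x a / x (a + Suc (Suc b)) = (x a / x (a + Suc b)) * (x (a + Suc b) / x (Suc (a + Suc b)))"
        using x by simp
      then show ?case using M_mult[OF Suc M_O[OF step]] by metis
    qed (use step in simp)
    have dec': "x a / x b \<in> M" if "a < b" for a b
      using dec[of a "b - a - 1"] that by simp
    show False
    proof (rule unbounded[OF yM y0])
      fix r :: nat
      have "y = x 0" by (simp add: x_def)
      \<comment> \<open>Later iterates divide earlier ones, hence the reversed index;
        \<open>r - i\<close> is positive for \<open>i < r\<close>, so each of these iterates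
        properly divides \<open>y = x 0\<close>.\<close>
      then show "\<exists>u :: nat \<Rightarrow> 'f. (\<forall>i<r. u i \<in> V \<and> u i \<noteq> 0 \<and> y / u i \<in> M) \<and> (\<forall>i j. i < j \<and> j < r \<longrightarrow> u j / u i \<in> M)"
        using x M_O dec' by (intro exI[of _ "\<lambda>i. x (r - i)"]) auto
    qed
  qed
  then obtain t where t: "t \<in> M" "t \<noteq> 0" "\<And>a. a \<in> M \<Longrightarrow> a / t \<in> V" by blast
  have tn: "t ^ n \<in> V" for n using M_O[OF t(1)] OD(7) by blast
  have tpow: "t powi n \<notin> V" if "n < 0" for n
  proof
    assume "t powi n \<in> V"
    then have "t ^ nat (- n - 1) * t powi n \<in> V" using tn OD(4) by blast
    also have "t ^ nat (- n - 1) * t powi n = t powi (- n - 1) * t powi n"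
      using that by (simp add: power_int_def)
    also have "\<dots> = t powi (- 1)" using t(2) by (simp flip: power_int_add)
    finally have "inverse t \<in> V" by (simp add: power_int_def)
    with t show False by (simp add: M_def)
  qed
  have tpow': "t powi n \<in> V" if "0 \<le> n" for n using tn that by (simp add: power_int_def)
  define U where "U = {a. a \<noteq> 0 \<and> a \<in> V \<and> inverse a \<in> V}"
  have U_mult: "a * b \<in> U" if "a \<in> U" "b \<in> U" for a b using that OD(4) by (auto simp: U_def)
  have dec1: "\<exists>n u. u \<in> U \<and> f = t powi n * u" if f: "f \<in> V" "f \<noteq> 0" for f
  proof -
    \<comment> \<open>Otherwise all powers of \<open>t\<close> properly divide \<open>f\<close>, and
      \<open>1, t, t ^ 2, ...\<close> contains chains of any length.\<close>
    have "\<exists>n. f / t ^ n \<in> V \<and> f / t ^ Suc n \<notin> V"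
    proof (rule ccontr)
      assume contra: "\<not> ?thesis"
      have all: "f / t ^ n \<in> V" for n by (induction n) (use contra f in auto)
      have "f = (f / t ^ 1) * t" using t by simp
      then have fM: "f \<in> M" using M_mult[OF t(1) all[of 1]] by (simp add: mult.commute)
      have quot: "t ^ j / t ^ i \<in> M" if "i < j" for i j
      proof -
        have "t ^ j = t * (t ^ (j - i - 1) * t ^ i)"
          using that by (simp flip: power_add power_Suc)
        then have "t ^ j / t ^ i = t * t ^ (j - i - 1)" using t by simp
        then show ?thesis using M_mult[OF t(1) tn] by metis
      qed
      have fq: "f / t ^ i \<in> M" for i
      proof -
        have "f / t ^ i = t * (f / t ^ Suc i)" using t by simp
        then show ?thesis using M_mult[OF t(1) all] by metis
      qed
      show False using unbounded[OF fM f(2)] tn t(2) quot fq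
        by (metis (no_types, lifting) power_not_zero)
    qed
    then obtain n where n: "f / t ^ n \<in> V" "f / t ^ Suc n \<notin> V" by blast
    have "f / t ^ n \<notin> M" using t(3)[of "f / t ^ n"] n(2) by (auto simp: mult.commute)
    then have "f / t ^ n \<in> U" using n(1) f t(2) by (auto simp: M_def U_def)
    then show ?thesis using t(2) by (intro exI[of _ "int n"] exI[of _ "f / t ^ n"]) auto
  qed
  have dec2: "\<exists>n u. u \<in> U \<and> f = t powi n * u" if f: "f \<noteq> 0" for f
  proof (cases "f \<in> V")
    case False
    then have "inverse f \<in> V" using val f by blast
    then obtain n u where "u \<in> U" "inverse f = t powi n * u" using dec1 f by force
    then have "inverse u \<in> U" "f = t powi (- n) * inverse u"
      using f by (auto simp: U_def power_int_minus) (metis inverse_inverse_eq inverse_mult_distrib mult.commute)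
    then show ?thesis by blast
  qed (use dec1 f in blast)
  have ge: "n \<le> m" if "t powi m * u = t powi n * b" "u \<in> U" "b \<in> V" for m n u b
  proof (rule ccontr)
    assume "\<not> n \<le> m"
    have "t powi (m - n) = b * inverse u" using that t(2)
      by (simp add: U_def power_int_diff field_simps)
    moreover have "b * inverse u \<in> V" using that OD(4) by (auto simp: U_def)
    ultimately show False using tpow[of "m - n"] \<open>\<not> n \<le> m\<close> by simp
  qed
  define v where "v = (\<lambda>f. if f = 0 then 0 else THE n. \<exists>u\<in>U. f = t powi n * u)"
  have v: "v (t powi n * u) = n" if u: "u \<in> U" for n u
  proof -
    have "(THE m. \<exists>u'\<in>U. t powi n * u = t powi m * u') = n"
    proof (rule the_equality)
      fix m assume "\<exists>u'\<in>U. t powi n * u = t powi m * u'"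
      then obtain u' where "u' \<in> U" "t powi n * u = t powi m * u'" by blast
      then show "m = n" using ge[of n u m u'] ge[of m u' n u] u by (auto simp: U_def)
    qed (use u in blast)
    then show ?thesis using u t(2) by (auto simp: v_def U_def)
  qed
  have dec3: "\<exists>u\<in>U. f = t powi (v f) * u" if "f \<noteq> 0" for f using dec2[OF that] v by metis
  have v_ge: "n \<le> v f" if "f = t powi n * b" "b \<in> V" "f \<noteq> 0" for f n b
    using dec3[OF that(3)] ge that(1,2) by metis
  have add: "min (v f) (v g) \<le> v (f + g)" if "f \<noteq> 0" "g \<noteq> 0" "f + g \<noteq> 0" for f g
  proof -
    have *: "v f \<le> v (f + g)" if le: "v f \<le> v g" and nz: "f \<noteq> 0" "g \<noteq> 0" "f + g \<noteq> 0" for f g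
    proof -
      obtain a where a: "a \<in> U" "f = t powi v f * a" using dec3 nz by metis
      obtain b where b: "b \<in> U" "g = t powi v g * b" using dec3 nz by metis
      have "t powi v g = t powi v f * t powi (v g - v f)" using t(2) by (simp flip: power_int_add)
      then have "f + g = t powi v f * (a + t powi (v g - v f) * b)"
        using a(2) b(2) by (simp add: algebra_simps)
      moreover have "a + t powi (v g - v f) * b \<in> V"
        using a b le by (intro OD(6) OD(4) tpow') (auto simp: U_def)
      ultimately show ?thesis using v_ge nz by blast
    qed
    show ?thesis using *[of f g] *[of g f] that by (cases "v f \<le> v g") (auto simp: add.commute)
  qed
  have "is_place \<iota> v" unfolding is_place_def
  proof (intro conjI allI impI)
    show "v 0 = 0" by (simp add: v_def)
    fix f g :: 'f assume "f \<noteq> 0" "g \<noteq> 0"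
    then obtain a b where "a \<in> U" "f = t powi v f * a" "b \<in> U" "g = t powi v g * b" using dec3 by metis
    then have "f * g = t powi (v f + v g) * (a * b)" "a * b \<in> U"
      using t(2) U_mult by (metis mult.assoc mult.left_commute power_int_add, blast)
    then show "v (f * g) = v f + v g" using v by metis
  next
    fix a
    show "v (\<iota> a) = 0"
    proof (cases "a = 0")
      case False
      then have "\<iota> a \<in> U" using cO[of "inverse a"] by (simp add: U_def del: cO) simp
      then show ?thesis using v[of "\<iota> a" 0] by simp
    qed (simp add: v_def)
  next
    have "1 \<in> U" using OD(2) by (simp add: U_def)
    then have "v (t powi n) = n" for n using v[of 1 n] by simp
    then show "surj v" by (metis surjI)
  qed (use add in blast)
  moreover have "1 \<le> v y"
    using v_ge[of y 1 "y / t"] t yM y0 by (auto simp: power_int_def)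
  ultimately show ?thesis by auto
qed

text \<open>Applied to \<open>inverse y\<close>, this also yields poles, which is how functions
  without poles are seen to be constant.\<close>

lemma zero_exists:
  assumes y: "y \<notin> range \<iota>"
  shows "\<exists>v. is_place \<iota> v \<and> 0 < v y"
proof -
  have y0: "y \<noteq> 0" using y rangeI[of \<iota> 0] by auto
  obtain V where V: "subring_of V" "range \<iota> \<subseteq> V" "y \<in> V" "inverse y \<notin> V"
    "\<And>R. subring_of R \<Longrightarrow> V \<subseteq> R \<Longrightarrow> inverse y \<notin> R \<Longrightarrow> R = V"
    using maximal_subring[OF y] by blast
  show ?thesis
    using place_of_valuation_ring[OF V(1,2) maximal_subring_valuation[OF V(1,3,4) y0 V(5)] V(3,4) y] .
qed

end

section \<open>Valuations\<close>

text \<open>Restores the value \<open>\<infinity>\<close> at \<open>0\<close>, where places have the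
  conventional value \<open>0\<close>. For a place \<open>v\<close>, the functions satisfying a
  given bound form an additive group.\<close>

definition vge :: "'f::field place \<Rightarrow> int \<Rightarrow> 'f \<Rightarrow> bool" where
  "vge v n f \<longleftrightarrow> f = 0 \<or> n \<le> v f"

lemma vge_0 [simp]: "vge v n 0"
  by (simp add: vge_def)

lemma vge_mono: "vge v n f \<Longrightarrow> m \<le> n \<Longrightarrow> vge v m f"
  by (auto simp: vge_def)

lemma valuation_ring_vge: "f \<in> valuation_ring v \<longleftrightarrow> vge v 0 f"
  by (simp add: valuation_ring_def vge_def)

lemma maximal_ideal_vge: "f \<in> maximal_ideal v \<longleftrightarrow> vge v 1 f"
  by (auto simp: maximal_ideal_def vge_def)

context function_field
begin

lemma card_const_gt_1: "1 < CARD('k)"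
proof -
  have "card {0, 1 :: 'k} \<le> CARD('k)" by (rule card_mono[OF finite_const]) simp
  then show ?thesis by simp
qed

abbreviation place :: "'f place \<Rightarrow> bool" where "place \<equiv> is_place \<iota>"

context
  fixes v assumes v: "place v"
begin

lemma val_0: "v 0 = 0"
  and val_mult: "f \<noteq> 0 \<Longrightarrow> g \<noteq> 0 \<Longrightarrow> v (f * g) = v f + v g"
  and val_add: "f \<noteq> 0 \<Longrightarrow> g \<noteq> 0 \<Longrightarrow> f + g \<noteq> 0 \<Longrightarrow> min (v f) (v g) \<le> v (f + g)"
  and val_const: "v (\<iota> a) = 0"
  and val_surj: "surj v"
  using v unfolding is_place_def by auto

lemma val_1: "v 1 = 0"
  using val_const[of 1] by simp

lemma val_inverse: "v (inverse f) = - v f"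
proof (cases "f = 0")
  case False
  then have "v f + v (inverse f) = 0" using val_mult[of f "inverse f"] val_1 by simp
  then show ?thesis by simp
qed (simp add: val_0)

lemma val_divide: "f \<noteq> 0 \<Longrightarrow> g \<noteq> 0 \<Longrightarrow> v (f / g) = v f - v g"
  using val_mult[of f "inverse g"] val_inverse[of g] by (simp add: divide_inverse)

lemma val_power: "v (f ^ n) = int n * v f"
proof (cases "f = 0")
  case False
  then show ?thesis by (induction n) (auto simp: val_mult val_1 algebra_simps)
qed (cases n; simp add: val_0 val_1)

lemma val_power_int: "v (f powi n) = n * v f"
  by (simp add: power_int_def val_power val_inverse)

lemma val_minus: "v (- f) = v f"
proof (cases "f = 0")
  case False
  have "- f = \<iota> (- 1) * f" by simp
  then show ?thesis using val_mult[of "\<iota> (- 1)" f] val_const[of "- 1"] False by simp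
qed simp

lemma vge_add: "vge v n f \<Longrightarrow> vge v n g \<Longrightarrow> vge v n (f + g)"
  using val_add[of f g] by (fastforce simp: vge_def)

lemma vge_minus: "vge v n f \<Longrightarrow> vge v n (- f)"
  by (simp add: vge_def val_minus)

lemma vge_diff: "vge v n f \<Longrightarrow> vge v n g \<Longrightarrow> vge v n (f - g)"
  using vge_add[of n f "- g"] vge_minus[of n g] by simp

lemma vge_sum: "(\<And>i. i \<in> I \<Longrightarrow> vge v n (f i)) \<Longrightarrow> vge v n (\<Sum>i\<in>I. f i)"
  by (induction I rule: infinite_finite_induct) (auto intro: vge_add)

lemma vge_mult: "vge v m f \<Longrightarrow> vge v n g \<Longrightarrow> vge v (m + n) (f * g)"
  by (cases "f = 0 \<or> g = 0") (auto simp: vge_def val_mult)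

lemma vge_mult0: "vge v 0 f \<Longrightarrow> vge v n g \<Longrightarrow> vge v n (f * g)"
  using vge_mult[of 0 f n g] by simp

lemma vge_const: "vge v 0 (\<iota> a)"
  by (simp add: vge_def val_const)

lemma vge_1: "vge v 0 1"
  by (simp add: vge_def val_1)

lemma vge_power: "vge v 0 f \<Longrightarrow> vge v 0 (f ^ n)"
  by (induction n) (auto intro: vge_mult0 vge_1)

lemma vge_power_pos:
  assumes "vge v 1 f" "0 < n"
  shows "vge v 1 (f ^ n)"
proof -
  have "vge v 1 (f ^ (n - 1) * f)"
    using assms by (intro vge_mult0 vge_power) (auto intro: vge_mono)
  then show ?thesis using assms(2) by (simp add: power_eq_if mult.commute)
qed

lemma vge_mult_cancel: "f \<noteq> 0 \<Longrightarrow> vge v n (f * g) \<longleftrightarrow> vge v (n - v f) g"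
  by (cases "g = 0") (auto simp: vge_def val_mult)

lemma vge_divide: "vge v n f \<Longrightarrow> g \<noteq> 0 \<Longrightarrow> vge v (n - v g) (f / g)"
  by (cases "f = 0") (auto simp: vge_def val_divide)

lemma vge_const_iff: "vge v 1 (\<iota> a) \<longleftrightarrow> a = 0"
  by (simp add: vge_def val_const)

lemma val_dominant:
  assumes f: "f \<noteq> 0" and g: "vge v (v f + 1) g"
  shows "f + g \<noteq> 0" "v (f + g) = v f"
proof -
  show nz: "f + g \<noteq> 0"
  proof
    assume "f + g = 0"
    then have "g = - f" by (simp add: eq_neg_iff_add_eq_0 add.commute)
    with f g show False by (auto simp: vge_def val_minus)
  qed
  have "vge v (v f) (f + g)" using g f by (intro vge_add) (auto simp: vge_def)
  moreover have "\<not> vge v (v f + 1) (f + g)"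
  proof
    assume "vge v (v f + 1) (f + g)"
    then have "vge v (v f + 1) (f + g - g)" using g vge_diff by blast
    with f show False by (simp add: vge_def)
  qed
  ultimately show "v (f + g) = v f" using nz by (auto simp: vge_def)
qed

lemma subring_valuation_ring: "subring_of {f. vge v 0 f}"
  unfolding subring_of_def using vge_diff vge_mult0 vge_1 by auto

lemma local_parameter: obtains t where "v t = 1" "t \<noteq> 0"
  using val_surj val_0 by (metis surjD zero_neq_one)

lemma val_nonconst: "v f \<noteq> 0 \<Longrightarrow> f \<notin> range \<iota>"
  using val_const by auto

lemma vge_peval: "vge v 0 y \<Longrightarrow> vge v 0 (peval y r)"
  by (induction r) (auto intro!: vge_add vge_mult0 vge_const)

section \<open>Residue fields and degrees of places\<close>

definition residue_indep :: "'f set \<Rightarrow> bool" where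
  "residue_indep B \<longleftrightarrow> finite B \<and> B \<subseteq> valuation_ring v \<and>
     (\<forall>c. (\<Sum>b\<in>B. \<iota> (c b) * b) \<in> maximal_ideal v \<longrightarrow> (\<forall>b\<in>B. c b = 0))"

definition residue_basis :: "'f set \<Rightarrow> bool" where
  "residue_basis B \<longleftrightarrow> residue_indep B \<and>
     (\<forall>f\<in>valuation_ring v. \<exists>c. f - (\<Sum>b\<in>B. \<iota> (c b) * b) \<in> maximal_ideal v)"

lemma residue_basisD:
  "residue_basis B \<Longrightarrow> vge v 0 f \<Longrightarrow> \<exists>c. vge v 1 (f - (\<Sum>b\<in>B. \<iota> (c b) * b))"
  by (simp add: residue_basis_def valuation_ring_vge maximal_ideal_vge)

text \<open>\<open>place_degree\<close> is a definite description, so a basis and the uniqueness of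
  its size are both owed. Elements with independent residues are independent over
  \<open>K[t]\<close> by \<open>lin_indep_modulo\<close>, which bounds their number.\<close>

lemma residue_basis_exists: "\<exists>B. residue_basis B"
proof -
  obtain t where t: "v t = 1" "t \<noteq> 0" using local_parameter .
  have tr: "t \<notin> range \<iota>" using t val_nonconst by simp
  obtain N where N: "finite N" "\<And>f. in_frac_span (peval t) N (\<lambda>b. b) f"
    using function_field_basis[OF tr] by metis
  have bound: "card B \<le> card N" if B: "residue_indep B" for B
  proof -
    have "lin_indep (peval t) B (\<lambda>b. b)"
    proof (rule lin_indep_modulo[OF subring_valuation_ring])
      fix c w assume w: "w \<in> {f. vge v 0 f}" "(\<Sum>b\<in>B. \<iota> (c b) * b) = t * w"
      have "vge v 1 (t * w)" using w(1) t vge_mult[of 1 t 0 w] by (simp add: vge_def)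
      then show "\<forall>b\<in>B. c b = 0" using B w(2) unfolding residue_indep_def maximal_ideal_vge by metis
    qed (use B t in \<open>auto simp: residue_indep_def valuation_ring_def vge_def val_const\<close>)
    then show ?thesis
      using card_lin_indep_le[OF domain_embedding_peval[OF tr] N(1), of B "\<lambda>b. b" "\<lambda>b. b"] N(2) B
      by (simp add: residue_indep_def)
  qed
  have "residue_indep {}" by (simp add: residue_indep_def)
  then obtain B where B: "residue_indep B" and max: "\<And>B'. residue_indep B' \<Longrightarrow> card B' \<le> card B"
    using ex_has_greatest_nat[of residue_indep "{}" card "Suc (card N)"] bound
    by (metis less_Suc_eq_le)
  have "\<exists>c. f - (\<Sum>b\<in>B. \<iota> (c b) * b) \<in> maximal_ideal v" if f: "f \<in> valuation_ring v" for f
  proof (cases "f \<in> B")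
    case True
    have "(\<Sum>b\<in>B. \<iota> (if b = f then 1 else 0) * b) = f"
      using B True by (simp add: residue_indep_def if_distrib[of \<iota>] if_distrib[of "\<lambda>x. x * _"] cong: if_cong)
    then show ?thesis by (intro exI[of _ "\<lambda>b. if b = f then 1 else 0"]) (simp add: maximal_ideal_vge)
  next
    case False
    have fin: "finite B" using B by (simp add: residue_indep_def)
    have "\<not> residue_indep (insert f B)" using max[of "insert f B"] False fin by auto
    then obtain c where c: "(\<Sum>b\<in>insert f B. \<iota> (c b) * b) \<in> maximal_ideal v" "\<exists>b\<in>insert f B. c b \<noteq> 0"
      using B f unfolding residue_indep_def by auto
    have cf: "c f \<noteq> 0"
    proof
      assume 0: "c f = 0"
      then have "(\<Sum>b\<in>B. \<iota> (c b) * b) \<in> maximal_ideal v" using c(1) fin False by simp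
      then have "\<forall>b\<in>B. c b = 0" using B unfolding residue_indep_def by metis
      with 0 c(2) show False by auto
    qed
    have "vge v 1 (\<iota> (inverse (c f)) * (\<Sum>b\<in>insert f B. \<iota> (c b) * b))"
      by (rule vge_mult0[OF vge_const]) (use c(1) in \<open>simp add: maximal_ideal_vge\<close>)
    also have "\<iota> (inverse (c f)) * (\<Sum>b\<in>insert f B. \<iota> (c b) * b) = f - (\<Sum>b\<in>B. \<iota> (- c b / c f) * b)"
      using fin False cf by (simp add: distrib_left sum_distrib_left sum_negf divide_inverse mult_ac)
    finally show ?thesis unfolding maximal_ideal_vge by (rule exI[of _ "\<lambda>b. - c b / c f"])
  qed
  with B show ?thesis unfolding residue_basis_def by blast
qed

definition residue_span :: "'f set \<Rightarrow> 'f set" where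
  "residue_span B = (\<lambda>c. \<Sum>b\<in>B. \<iota> (c b) * b) ` (B \<rightarrow>\<^sub>E UNIV)"

lemma residue_spanI: "(\<Sum>b\<in>B. \<iota> (c b) * b) \<in> residue_span B"
  unfolding residue_span_def by (rule image_eqI[of _ _ "restrict c B"]) auto

lemma residue_span_props:
  assumes B: "residue_basis B"
  shows "finite (residue_span B)" "card (residue_span B) = CARD('k) ^ card B"
    "r \<in> residue_span B \<Longrightarrow> vge v 0 r"
    "r \<in> residue_span B \<Longrightarrow> s \<in> residue_span B \<Longrightarrow> r - s \<in> residue_span B"
    "r \<in> residue_span B \<Longrightarrow> vge v 1 r \<Longrightarrow> r = 0"
    "vge v 0 f \<Longrightarrow> \<exists>r\<in>residue_span B. vge v 1 (f - r)"
proof -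
  have fin: "finite B" and BO: "\<And>b. b \<in> B \<Longrightarrow> vge v 0 b"
    and ind: "\<And>c. vge v 1 (\<Sum>b\<in>B. \<iota> (c b) * b) \<Longrightarrow> \<forall>b\<in>B. c b = 0"
    using B by (auto simp: residue_basis_def residue_indep_def valuation_ring_vge maximal_ideal_vge)
  show "finite (residue_span B)"
    unfolding residue_span_def using fin finite_const by (intro finite_imageI finite_PiE) auto
  have diff: "(\<Sum>b\<in>B. \<iota> (c b) * b) - (\<Sum>b\<in>B. \<iota> (c' b) * b) = (\<Sum>b\<in>B. \<iota> (c b - c' b) * b)" for c c'
    by (simp add: sum_subtractf algebra_simps)
  have "inj_on (\<lambda>c. \<Sum>b\<in>B. \<iota> (c b) * b) (B \<rightarrow>\<^sub>E UNIV)"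
  proof (rule inj_onI)
    fix c c' assume *: "c \<in> B \<rightarrow>\<^sub>E UNIV" "c' \<in> B \<rightarrow>\<^sub>E UNIV" "(\<Sum>b\<in>B. \<iota> (c b) * b) = (\<Sum>b\<in>B. \<iota> (c' b) * b)"
    then have "\<forall>b\<in>B. c b - c' b = 0" using diff[of c c'] by (intro ind) simp
    then show "c = c'" using * by (intro PiE_ext) auto
  qed
  then show "card (residue_span B) = CARD('k) ^ card B"
    unfolding residue_span_def by (simp add: card_image card_PiE fin)
  show "r \<in> residue_span B \<Longrightarrow> vge v 0 r"
    unfolding residue_span_def using BO by (auto intro!: vge_sum vge_mult0 vge_const)
  show "r \<in> residue_span B \<Longrightarrow> s \<in> residue_span B \<Longrightarrow> r - s \<in> residue_span B"
  proof -
    assume "r \<in> residue_span B" "s \<in> residue_span B"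
    then obtain c c' where "r = (\<Sum>b\<in>B. \<iota> (c b) * b)" "s = (\<Sum>b\<in>B. \<iota> (c' b) * b)"
      unfolding residue_span_def by blast
    then have "r - s = (\<Sum>b\<in>B. \<iota> (c b - c' b) * b)" using diff by simp
    then show ?thesis using residue_spanI[of "\<lambda>b. c b - c' b" B] by simp
  qed
  show "r = 0" if r: "r \<in> residue_span B" "vge v 1 r"
  proof -
    obtain c where c: "r = (\<Sum>b\<in>B. \<iota> (c b) * b)" using r(1) unfolding residue_span_def by blast
    then show ?thesis using ind[of c] r(2) by simp
  qed
  show "\<exists>r\<in>residue_span B. vge v 1 (f - r)" if f: "vge v 0 f"
    using residue_basisD[OF B f] residue_spanI by auto
qed

text \<open>As \<open>K\<close> is finite, the size of a basis shows in the number of residue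
  classes; congruence maps one set of representatives injectively into the other.\<close>

lemma card_residue_basis_le:
  assumes B: "residue_basis B" and B': "residue_basis B'"
  shows "card B \<le> card B'"
proof -
  note R = residue_span_props[OF B] and R' = residue_span_props[OF B']
  have "\<forall>r\<in>residue_span B. \<exists>s\<in>residue_span B'. vge v 1 (r - s)" using R(3) R'(6) by blast
  then obtain h where h: "\<And>r. r \<in> residue_span B \<Longrightarrow> h r \<in> residue_span B' \<and> vge v 1 (r - h r)" by metis
  have "inj_on h (residue_span B)"
  proof (rule inj_onI)
    fix r s assume *: "r \<in> residue_span B" "s \<in> residue_span B" "h r = h s"
    have "vge v 1 ((r - h r) - (s - h s))" using h * vge_diff by blast
    then have "r - s = 0" using * R(4) by (intro R(5)) auto
    then show "r = s" by simp
  qed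
  then have "card (residue_span B) \<le> card (residue_span B')"
    using h R'(1) by (intro card_inj_on_le) auto
  then have "CARD('k) ^ card B \<le> CARD('k) ^ card B'" unfolding R(2) R'(2) .
  then show ?thesis by (rule power_le_imp_le_exp[OF card_const_gt_1])
qed

lemma place_degree_eq:
  assumes "residue_basis B"
  shows "place_degree \<iota> v = card B"
  unfolding place_degree_def
proof (rule the_equality)
  have eq: "finite B' \<and> card B' = n \<and> B' \<subseteq> valuation_ring v \<and>
        (\<forall>c. (\<Sum>b\<in>B'. \<iota> (c b) * b) \<in> maximal_ideal v \<longrightarrow> (\<forall>b\<in>B'. c b = 0)) \<and>
        (\<forall>f\<in>valuation_ring v. \<exists>c. f - (\<Sum>b\<in>B'. \<iota> (c b) * b) \<in> maximal_ideal v)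
     \<longleftrightarrow> residue_basis B' \<and> card B' = n" for B' n
    by (auto simp: residue_basis_def residue_indep_def)
  show "\<exists>B'. finite B' \<and> card B' = card B \<and> B' \<subseteq> valuation_ring v \<and>
        (\<forall>c. (\<Sum>b\<in>B'. \<iota> (c b) * b) \<in> maximal_ideal v \<longrightarrow> (\<forall>b\<in>B'. c b = 0)) \<and>
        (\<forall>f\<in>valuation_ring v. \<exists>c. f - (\<Sum>b\<in>B'. \<iota> (c b) * b) \<in> maximal_ideal v)"
    unfolding eq using assms by blast
  fix n
  assume "\<exists>B'. finite B' \<and> card B' = n \<and> B' \<subseteq> valuation_ring v \<and>
        (\<forall>c. (\<Sum>b\<in>B'. \<iota> (c b) * b) \<in> maximal_ideal v \<longrightarrow> (\<forall>b\<in>B'. c b = 0)) \<and>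
        (\<forall>f\<in>valuation_ring v. \<exists>c. f - (\<Sum>b\<in>B'. \<iota> (c b) * b) \<in> maximal_ideal v)"
  then obtain B' where "residue_basis B'" "card B' = n" unfolding eq by blast
  then show "n = card B" using card_residue_basis_le assms by (metis antisym)
qed

text \<open>The representatives form an additive group, so that leading coefficients can be taken
  additively.\<close>

definition residue_system :: "'f set \<Rightarrow> bool" where
  "residue_system R \<longleftrightarrow> finite R \<and> card R = CARD('k) ^ place_degree \<iota> v \<and>
     (\<forall>r\<in>R. vge v 0 r \<and> (vge v 1 r \<longrightarrow> r = 0)) \<and> (\<forall>r\<in>R. \<forall>s\<in>R. r - s \<in> R) \<and>
     (\<forall>f. vge v 0 f \<longrightarrow> (\<exists>r\<in>R. vge v 1 (f - r)))"

lemma residue_system_exists: "\<exists>R. residue_system R"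
proof -
  obtain B where B: "residue_basis B" using residue_basis_exists by blast
  note R = residue_span_props[OF B]
  have "residue_system (residue_span B)"
    unfolding residue_system_def place_degree_eq[OF B] using R by auto
  then show ?thesis by blast
qed

lemma residue_systemD:
  assumes "residue_system R"
  shows "finite R" "card R = CARD('k) ^ place_degree \<iota> v"
    "r \<in> R \<Longrightarrow> vge v 0 r" "r \<in> R \<Longrightarrow> s \<in> R \<Longrightarrow> r - s \<in> R"
    "r \<in> R \<Longrightarrow> vge v 1 r \<Longrightarrow> r = 0" "vge v 0 f \<Longrightarrow> \<exists>r\<in>R. vge v 1 (f - r)"
  using assms unfolding residue_system_def by auto

lemma place_degree_pos: "0 < place_degree \<iota> v"
proof -
  obtain B where B: "residue_basis B" using residue_basis_exists by blast
  have "B \<noteq> {}"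
  proof
    assume "B = {}"
    then have "vge v 1 1" using B vge_1 by (auto simp: residue_basis_def valuation_ring_vge maximal_ideal_vge)
    then show False by (simp add: vge_def val_1)
  qed
  then show ?thesis using B place_degree_eq[OF B] by (auto simp: card_gt_0_iff residue_basis_def residue_indep_def)
qed

lemma rational_residue:
  assumes deg: "place_degree \<iota> v = 1" and f: "vge v 0 f"
  obtains a where "vge v 1 (f - \<iota> a)"
proof -
  obtain B where B: "residue_basis B" using residue_basis_exists by blast
  then have "card B = 1" using place_degree_eq deg by simp
  then obtain b where b: "B = {b}" by (auto simp: card_1_singleton_iff)
  have *: "\<exists>c. vge v 1 (f - \<iota> c * b)" if "vge v 0 f" for f
    using residue_basisD[OF B that] by (auto simp: b)
  obtain c where c: "vge v 1 (f - \<iota> c * b)" using *[OF f] by blast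
  \<comment> \<open>The basis element \<open>b\<close> need not be constant; expanding
    \<open>1\<close> as well shows that it is congruent to the constant
    \<open>1 / c0\<close>.\<close>
  obtain c0 where c0: "vge v 1 (1 - \<iota> c0 * b)" using *[OF vge_1] by blast
  have "c0 \<noteq> 0" using c0 by (auto simp: vge_def val_1)
  have "vge v 1 ((f - \<iota> c * b) - \<iota> (c / c0) * (1 - \<iota> c0 * b))"
    by (intro vge_diff vge_mult0 vge_const c c0)
  also have "(f - \<iota> c * b) - \<iota> (c / c0) * (1 - \<iota> c0 * b) = f - \<iota> (c / c0)"
    using \<open>c0 \<noteq> 0\<close> by (simp add: divide_inverse algebra_simps)
  finally show thesis using that by blast
qed

text \<open>The map taking \<open>f\<close> to the residue of \<open>f / t powi a\<close> is
  additive, its kernel lies in the next step of the filtration, and its values are representatives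
  of the residue field.\<close>

lemma card_le_card_vge_Suc:
  assumes sub: "\<And>f g. f \<in> X \<Longrightarrow> g \<in> X \<Longrightarrow> f - g \<in> X" and X: "\<And>f. f \<in> X \<Longrightarrow> vge v a f"
    and fin: "finite {f \<in> X. vge v (a + 1) f}"
  shows "finite X \<and> card X \<le> card {f \<in> X. vge v (a + 1) f} * CARD('k) ^ place_degree \<iota> v"
proof -
  obtain R where "residue_system R" using residue_system_exists by blast
  note R = residue_systemD[OF this]
  obtain t where t: "v t = 1" "t \<noteq> 0" using local_parameter .
  have ta: "t powi a \<noteq> 0" "v (t powi a) = a" using t by (simp_all add: val_power_int)
  have "\<forall>f\<in>X. \<exists>r\<in>R. vge v 1 (f / t powi a - r)"
    using R(6) X vge_divide[of a _ "t powi a"] ta by fastforce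
  then obtain h where h: "\<And>f. f \<in> X \<Longrightarrow> h f \<in> R \<and> vge v 1 (f / t powi a - h f)" by metis
  have hom: "h (f - g) = h f - h g" if "f \<in> X" "g \<in> X" for f g
  proof -
    let ?d = "(f / t powi a - h f) - (g / t powi a - h g) - ((f - g) / t powi a - h (f - g))"
    have "vge v 1 (f / t powi a - h f)" "vge v 1 (g / t powi a - h g)"
      "vge v 1 ((f - g) / t powi a - h (f - g))" using h that sub by blast+
    then have "vge v 1 ?d" by (rule vge_diff[OF vge_diff])
    moreover have "?d = h (f - g) - (h f - h g)" by (simp add: diff_divide_distrib)
    ultimately have "h (f - g) - (h f - h g) = 0" using h that sub R(4) by (intro R(5)) auto
    then show ?thesis by simp
  qed
  have ker: "{f \<in> X. h f = 0} \<subseteq> {f \<in> X. vge v (a + 1) f}"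
  proof safe
    fix f assume f: "f \<in> X" "h f = 0"
    then have "vge v 1 (f / t powi a)" using h[of f] by simp
    moreover have "vge v a (t powi a)" using ta by (simp add: vge_def)
    ultimately have "vge v (a + 1) (t powi a * (f / t powi a))" using vge_mult by blast
    then show "vge v (a + 1) f" using t(2) by simp
  qed
  have "finite X \<and> card X \<le> card {f \<in> X. h f = 0} * card R"
    using sub hom finite_subset[OF ker fin] h R(1) by (intro card_le_card_kernel_mult) auto
  moreover have "card {f \<in> X. h f = 0} \<le> card {f \<in> X. vge v (a + 1) f}" by (rule card_mono[OF fin ker])
  ultimately show ?thesis using R(2) by (metis mult_le_mono1 order_trans)
qed

lemma card_le_card_vge:
  assumes sub: "\<And>f g. f \<in> X \<Longrightarrow> g \<in> X \<Longrightarrow> f - g \<in> X" and X: "\<And>f. f \<in> X \<Longrightarrow> vge v a f"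
    and fin: "finite {f \<in> X. vge v (a + int n) f}"
  shows "finite X \<and> card X \<le> card {f \<in> X. vge v (a + int n) f} * CARD('k) ^ (n * place_degree \<iota> v)"
  using fin
proof (induction n)
  case 0
  moreover have "{f \<in> X. vge v (a + int 0) f} = X" using X by auto
  ultimately show ?case by simp
next
  case (Suc n)
  define Y where "Y = {f \<in> X. vge v (a + int n) f}"
  have Y': "{f \<in> Y. vge v (a + int n + 1) f} = {f \<in> X. vge v (a + int (Suc n)) f}"
    by (auto simp: Y_def algebra_simps intro: vge_mono)
  have "finite Y \<and> card Y \<le> card {f \<in> Y. vge v (a + int n + 1) f} * CARD('k) ^ place_degree \<iota> v"
    using sub vge_diff Suc.prems unfolding Y'[symmetric] by (intro card_le_card_vge_Suc) (auto simp: Y_def)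
  then have Y: "finite Y" "card Y \<le> card {f \<in> X. vge v (a + int (Suc n)) f} * CARD('k) ^ place_degree \<iota> v"
    unfolding Y' by auto
  then have "finite X" "card X \<le> card Y * CARD('k) ^ (n * place_degree \<iota> v)"
    using Suc.IH unfolding Y_def by auto
  moreover have "card Y * CARD('k) ^ (n * place_degree \<iota> v) \<le>
      card {f \<in> X. vge v (a + int (Suc n)) f} * CARD('k) ^ place_degree \<iota> v * CARD('k) ^ (n * place_degree \<iota> v)"
    using Y(2) by (intro mult_right_mono) auto
  ultimately have "card X \<le> card {f \<in> X. vge v (a + int (Suc n)) f} * CARD('k) ^ place_degree \<iota> v *
      CARD('k) ^ (n * place_degree \<iota> v)" by linarith
  also have "\<dots> = card {f \<in> X. vge v (a + int (Suc n)) f} * CARD('k) ^ (Suc n * place_degree \<iota> v)"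
    by (simp only: power_add mult_Suc mult.assoc)
  finally show ?case using \<open>finite X\<close> by (intro conjI)
qed

text \<open>Among the classes of the \<open>f ^ p ^ i\<close> two agree; as Frobenius is additive,
  the smaller exponent cancels, and \<open>f ^ p ^ s\<close> is congruent to \<open>f\<close> for
  some positive \<open>s\<close> at most the size of the residue field. The factorial is divisible
  by every such \<open>s\<close>, so one exponent serves all places of degree at most
  \<open>\<delta>\<close>; the factor \<open>n\<close> makes it as large as desired.\<close>

lemma frobenius_residue:
  assumes deg: "place_degree \<iota> v \<le> \<delta>" and f: "vge v 0 f"
  shows "vge v 1 (f ^ p ^ (fact (CARD('k) ^ \<delta>) * n) - f)"
proof -
  obtain R where "residue_system R" using residue_system_exists by blast
  note R = residue_systemD[OF this]
  have "\<forall>i. \<exists>r. r \<in> R \<and> vge v 1 (f ^ p ^ i - r)" using R(6)[OF vge_power[OF f]] by blast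
  then obtain h where h: "\<And>i. h i \<in> R \<and> vge v 1 (f ^ p ^ i - h i)" by metis
  have c1: "1 \<le> CARD('k)" using finite_const by (simp add: Suc_le_eq card_gt_0_iff)
  have "\<not> inj_on h {..card R}"
    using card_inj_on_le[of h "{..card R}" R] h R(1) by auto
  then obtain i j where ij: "i < j" "j \<le> card R" "h i = h j"
    unfolding inj_on_def by (metis atMost_iff linorder_neqE_nat)
  define s where "s = j - i"
  have s: "0 < s" "s \<le> CARD('k) ^ \<delta>"
    using ij R(2) power_increasing[OF deg c1] unfolding s_def by auto
  have "vge v 1 ((f ^ p ^ j - h j) - (f ^ p ^ i - h i))" using h vge_diff by blast
  then have "vge v 1 (f ^ p ^ j - f ^ p ^ i)" using ij by (simp add: algebra_simps)
  also have "f ^ p ^ j - f ^ p ^ i = (f ^ p ^ s - f) ^ p ^ i"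
    using ij by (simp add: s_def diff_pow flip: power_mult power_add)
  finally have base: "vge v 1 (f ^ p ^ s - f)"
    using p_pos by (auto simp: vge_def val_power zero_less_mult_iff int_one_le_iff_zero_less)
  have "vge v 1 (f ^ p ^ (s * m) - f)" for m
  proof (induction m)
    case (Suc m)
    have "f ^ p ^ (s * Suc m) = (f ^ p ^ s) ^ p ^ (s * m)" by (simp add: power_add power_mult[symmetric] mult.commute)
    then have "f ^ p ^ (s * Suc m) - f = (f ^ p ^ s - f) ^ p ^ (s * m) + (f ^ p ^ (s * m) - f)"
      by (simp add: diff_pow)
    moreover have "vge v 1 ((f ^ p ^ s - f) ^ p ^ (s * m))"
      using vge_power_pos[OF base] p_pos by simp
    ultimately show ?case using Suc vge_add by metis
  qed simp
  moreover have "s dvd fact (CARD('k) ^ \<delta>) * n" using s by (intro dvd_mult2 dvd_fact) auto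
  ultimately show ?thesis by (metis dvdE)
qed

end

section \<open>Weak approximation\<close>

text \<open>If the ring of \<open>v\<close> were contained in that of \<open>w\<close>, units for
  \<open>v\<close> would be units for \<open>w\<close>, so \<open>w\<close> would be a multiple of
  \<open>v\<close>; both are normalized, hence they would be equal.\<close>

lemma places_incomparable:
  assumes v: "place v" and w: "place w" and ne: "v \<noteq> w"
  shows "\<exists>f. f \<noteq> 0 \<and> 0 \<le> v f \<and> w f < 0"
proof (rule ccontr)
  assume "\<not> ?thesis"
  then have le: "\<And>f. f \<noteq> 0 \<Longrightarrow> 0 \<le> v f \<Longrightarrow> 0 \<le> w f" by force
  obtain t where t: "v t = 1" "t \<noteq> 0" using local_parameter[OF v] .
  have wf: "w f = v f * w t" if f: "f \<noteq> 0" for f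
  proof -
    define g where "g = f / t powi v f"
    have g: "g \<noteq> 0" "v g = 0" using f t by (auto simp: g_def val_divide[OF v] val_power_int[OF v])
    have "0 \<le> w g" "0 \<le> w (inverse g)" using le[of g] le[of "inverse g"] g val_inverse[OF v, of g] by auto
    then have "w g = 0" using val_inverse[OF w, of g] by simp
    moreover have "f = g * t powi v f" using t by (simp add: g_def)
    ultimately show ?thesis using g t val_mult[OF w, of g "t powi v f"] val_power_int[OF w] by simp
  qed
  obtain f where f: "w f = 1" "f \<noteq> 0" using local_parameter[OF w] .
  have "v f * w t = 1" using wf[OF f(2)] f(1) by simp
  moreover have "0 \<le> w t" using le t by simp
  ultimately have "w t = 1" by (auto simp: zmult_eq_1_iff)
  then have "v f = w f" for f using wf[of f] val_0[OF v] val_0[OF w] by (cases "f = 0") auto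
  with ne show False by blast
qed

lemma places_separated2:
  assumes v: "place v" and w: "place w" and ne: "v \<noteq> w"
  shows "\<exists>f. f \<noteq> 0 \<and> 0 < v f \<and> w f < 0"
proof -
  obtain f where f: "f \<noteq> 0" "0 \<le> v f" "w f < 0" using places_incomparable[OF v w ne] by blast
  obtain g where g: "g \<noteq> 0" "0 \<le> w g" "v g < 0" using places_incomparable[OF w v] ne by blast
  show ?thesis using f g by (intro exI[of _ "f / g"]) (simp add: val_divide[OF v] val_divide[OF w])
qed

lemma places_separated:
  assumes "finite T" and v: "place v" and T: "\<And>w. w \<in> T \<Longrightarrow> place w" "v \<notin> T"
  shows "\<exists>f. f \<noteq> 0 \<and> 0 < v f \<and> (\<forall>w\<in>T. w f < 0)"
  using assms(1) T
proof (induction T rule: finite_induct)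
  case empty
  then show ?case using local_parameter[OF v] by (metis emptyE zero_less_one)
next
  case (insert w T)
  then obtain f where f: "f \<noteq> 0" "0 < v f" "\<And>u. u \<in> T \<Longrightarrow> u f < 0" by auto
  have w: "place w" "v \<noteq> w" using insert by auto
  obtain h where h: "h \<noteq> 0" "0 < v h" "w h < 0" using places_separated2[OF v w] by blast
  show ?case
  proof (cases "w f < 0")
    case False
    \<comment> \<open>Where \<open>f\<close> and \<open>h\<close> both have poles, this exponent
      exceeds the pole order of \<open>f\<close>, so that \<open>h ^ r\<close> dominates. At the
      other places of \<open>insert w T\<close> exactly one of the two has a pole. Hence no poles
      cancel.\<close>
    define r where "r = Suc (nat (\<Sum>u\<in>T. \<bar>u f\<bar>))"
    have hr: "h ^ r \<noteq> 0" using h by simp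
    have neg: "f + h ^ r \<noteq> 0 \<and> u (f + h ^ r) < 0" if u: "u \<in> insert w T" for u
    proof -
      have pu: "place u" using u insert by auto
      have "0 < r" by (simp add: r_def)
      then have r0: "0 < int r" by simp
      consider "0 \<le> u f" "u h < 0" | "u f < 0" "0 \<le> u h" | "u f < 0" "u h < 0" "u \<in> T"
        using u False h(3) f(3) by (cases "u = w"; force)
      then show ?thesis
      proof cases
        case 1
        then have "int r * u h < 0" using r0 by (simp add: mult_pos_neg)
        then have "vge u (u (h ^ r) + 1) f" using 1 by (simp add: vge_def val_power[OF pu])
        then show ?thesis using val_dominant[OF pu hr, of f] \<open>int r * u h < 0\<close>
          by (simp add: val_power[OF pu] add.commute)
      next
        case 2
        then have "0 \<le> int r * u h" by simp
        then have "u f + 1 \<le> u (h ^ r)" unfolding val_power[OF pu] using 2 by linarith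
        then have "vge u (u f + 1) (h ^ r)" by (simp add: vge_def)
        then show ?thesis using val_dominant[OF pu f(1), of "h ^ r"] 2 by simp
      next
        case 3
        have "\<bar>u f\<bar> \<le> (\<Sum>u\<in>T. \<bar>u f\<bar>)" using insert 3 by (intro member_le_sum) auto
        then have "\<bar>u f\<bar> < int r" by (simp add: r_def)
        moreover have "int r * u h \<le> int r * (- 1)" using 3 r0 by (intro mult_left_mono) auto
        ultimately have lt: "int r * u h < u f" using 3 by simp
        then have "vge u (u (h ^ r) + 1) f" using 3 by (simp add: vge_def val_power[OF pu])
        then show ?thesis using val_dominant[OF pu hr, of f] lt 3
          by (simp add: val_power[OF pu] add.commute)
      qed
    qed
    have "vge v 1 (f + h ^ r)" 
      using f h by (intro vge_add[OF v] vge_power_pos[OF v]) (auto simp: vge_def r_def)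
    then have "0 < v (f + h ^ r)" using neg[of w] by (simp add: vge_def)
    then show ?thesis using neg by (intro exI[of _ "f + h ^ r"]) auto
  qed (use f in auto)
qed

text \<open>If \<open>f\<close> vanishes at \<open>v\<close> and has poles at the rest of
  \<open>T\<close>, then \<open>1 / (1 + f ^ N)\<close> is close to \<open>1\<close> at
  \<open>v\<close> and close to \<open>0\<close> elsewhere on \<open>T\<close> for large
  \<open>N\<close>.\<close>

lemma approximate_one:
  assumes T: "finite T" "\<And>w. w \<in> T \<Longrightarrow> place w" "v \<in> T"
  obtains e where "vge v n (e - 1)" "\<And>w. w \<in> T \<Longrightarrow> w \<noteq> v \<Longrightarrow> vge w n e"
proof -
  have v: "place v" using T by blast
  obtain f where f: "f \<noteq> 0" "0 < v f" "\<And>w. w \<in> T \<Longrightarrow> w \<noteq> v \<Longrightarrow> w f < 0"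
    using places_separated[of "T - {v}" v] T v by auto
  define N where "N = Suc (nat n)"
  define g where "g = f ^ N"
  have N: "n \<le> int N" "0 < int N" by (auto simp: N_def)
  have vg: "int N \<le> v g" using f(2) N mult_left_mono[of 1 "v f" "int N"] by (simp add: g_def val_power[OF v])
  have g0: "g \<noteq> 0" using f by (simp add: g_def)
  have d: "1 + g \<noteq> 0" "v (1 + g) = 0"
    using val_dominant[OF v, of 1 g] vg N by (auto simp: vge_def val_1[OF v])
  have "vge v n (inverse (1 + g) - 1)"
  proof -
    have "inverse (1 + g) - 1 = - (g / (1 + g))" using d by (simp add: field_simps)
    moreover have "vge v n (g / (1 + g))"
      using d g0 vg N by (simp add: vge_def val_divide[OF v])
    ultimately show ?thesis using vge_minus[OF v] by simp
  qed
  moreover have "vge w n (inverse (1 + g))" if w: "w \<in> T" "w \<noteq> v" for w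
  proof -
    have pw: "place w" using T w by blast
    have wg: "w g \<le> - int N"
      using f(3)[OF w] N mult_left_mono[of "w f" "- 1" "int N"] by (simp add: g_def val_power[OF pw])
    then have "w (g + 1) = w g" using val_dominant(2)[OF pw g0, of 1] N by (simp add: vge_def val_1[OF pw])
    then show ?thesis using wg N by (simp add: vge_def val_inverse[OF pw] add.commute)
  qed
  ultimately show thesis using that by blast
qed

end

section \<open>Zeros and poles\<close>

lemma int_set_bounded:
  assumes "finite (S :: int set)"
  obtains M where "\<And>s. s \<in> S \<Longrightarrow> s \<le> M"
  using that Max_ge[OF assms] by blast

context function_field
begin

lemma val_inverse_pos_iff: "place v \<Longrightarrow> 0 < v (inverse f) \<longleftrightarrow> v f < 0"
  by (simp add: val_inverse)

abbreviation pdeg :: "'f place \<Rightarrow> nat" where "pdeg \<equiv> place_degree \<iota>"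

text \<open>Let \<open>R\<close> be the ring of functions regular on \<open>T\<close>, and let
  \<open>e v\<close> be close to \<open>1\<close> at \<open>v\<close> and to \<open>0\<close> at the
  rest of \<open>T\<close>. The elements \<open>t v ^ i * b * e v\<close>, with
  \<open>i < v y\<close> and \<open>b\<close> in a basis of the residue field, are independent over
  \<open>K\<close> modulo \<open>y R\<close>, hence over \<open>K[y]\<close>; their number is the
  left side.\<close>

lemma zeros_degree_le:
  assumes y: "y \<notin> range \<iota>" and B: "finite B" "\<And>f. in_frac_span (peval y) B (\<lambda>b. b) f"
    and T: "finite T" "\<And>v. v \<in> T \<Longrightarrow> place v \<and> 0 < v y"
  shows "(\<Sum>v\<in>T. nat (v y) * pdeg v) \<le> card B"
proof -
  have pl: "\<And>v. v \<in> T \<Longrightarrow> place v" using T by blast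
  have y0: "y \<noteq> 0" using y rangeI[of \<iota> 0] by auto
  define n where "n = (\<lambda>v :: 'f place. nat (v y))"
  have n: "int (n v) = v y" if "v \<in> T" for v using T(2)[OF that] by (simp add: n_def)
  have "\<forall>v\<in>T. \<exists>t. v t = 1 \<and> t \<noteq> 0" using local_parameter[OF pl] by metis
  then obtain t where t: "\<And>v. v \<in> T \<Longrightarrow> v (t v) = 1" "\<And>v. v \<in> T \<Longrightarrow> t v \<noteq> 0" by metis
  have "\<forall>v\<in>T. \<exists>Bv. residue_basis v Bv" using residue_basis_exists[OF pl] by metis
  then obtain Bv where Bv: "\<And>v. v \<in> T \<Longrightarrow> residue_basis v (Bv v)" by metis
  have Bv1: "finite (Bv v)" "\<And>b. b \<in> Bv v \<Longrightarrow> vge v 0 b"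
    and Bv2: "\<And>c. vge v 1 (\<Sum>b\<in>Bv v. \<iota> (c b) * b) \<Longrightarrow> \<forall>b\<in>Bv v. c b = 0"
    and Bv3: "card (Bv v) = pdeg v" if "v \<in> T" for v
    using Bv[OF that] place_degree_eq[OF pl[OF that] Bv[OF that]]
    unfolding residue_basis_def[OF pl[OF that]] residue_indep_def[OF pl[OF that]] valuation_ring_vge maximal_ideal_vge
    by (auto simp: subset_iff valuation_ring_vge)
  define I where "I = (SIGMA v:T. {..<n v} \<times> Bv v)"
  have finI: "finite I" unfolding I_def using T(1) Bv1 by blast
  \<comment> \<open>A precision of at least all these numbers ensures that replacing
    \<open>e v\<close> by \<open>1\<close> at \<open>v\<close> and by \<open>0\<close> at another
    \<open>w\<close> in \<open>T\<close> changes the elements only by terms of order at least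
    \<open>v y\<close> and \<open>w y\<close>.\<close>
  define S where "S = (\<lambda>(w, v, i, b). w y - w (t v ^ i * b)) ` (T \<times> I) \<union> (\<lambda>w. w y) ` T"
  have finS: "finite S" unfolding S_def using T(1) finI by blast
  obtain M where M: "\<And>s. s \<in> S \<Longrightarrow> s \<le> M" by (rule int_set_bounded[OF finS]) blast
  have "\<forall>v\<in>T. \<exists>e. vge v M (e - 1) \<and> (\<forall>w\<in>T. w \<noteq> v \<longrightarrow> vge w M e)"
    using approximate_one[OF T(1) pl] by metis
  then obtain e where e: "\<And>v. v \<in> T \<Longrightarrow> vge v M (e v - 1)" "\<And>v w. v \<in> T \<Longrightarrow> w \<in> T \<Longrightarrow> w \<noteq> v \<Longrightarrow> vge w M (e v)"
    by metis
  define u where "u = (\<lambda>(v, i, b). t v ^ i * b * e v)"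
  have tO: "vge v 0 (t v ^ i * b)" if "v \<in> T" "b \<in> Bv v" for v i b
  proof -
    have "vge v 0 (t v)" using t(1)[OF that(1)] by (simp add: vge_def)
    then show ?thesis using that Bv1(2) by (intro vge_mult0[OF pl] vge_power[OF pl]) auto
  qed
  have u_same: "vge v (v y) (t v ^ i * b * e v - t v ^ i * b)" if "v \<in> T" "b \<in> Bv v" for v i b
  proof -
    have "vge v M (t v ^ i * b * (e v - 1))" by (rule vge_mult0[OF pl[OF that(1)] tO[OF that] e(1)[OF that(1)]])
    moreover have "v y \<le> M" using M that by (auto simp: S_def)
    ultimately have "vge v (v y) (t v ^ i * b * (e v - 1))" using vge_mono by blast
    then show ?thesis by (simp add: right_diff_distrib)
  qed
  have u_other: "vge w (w y) (u x)" if x: "x \<in> I" "w \<in> T" "w \<noteq> fst x" for w x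
  proof -
    obtain v i b where xv: "x = (v, i, b)" "v \<in> T" "i < n v" "b \<in> Bv v" using x by (auto simp: I_def)
    show ?thesis
    proof (cases "t v ^ i * b = 0")
      case False
      have "w y - w (t v ^ i * b) \<in> S"
        unfolding S_def using x xv by (intro UnI1 image_eqI[of _ _ "(w, x)"]) auto
      then have "w y \<le> w (t v ^ i * b) + M" using M by fastforce
      moreover have "vge w (w (t v ^ i * b) + M) (t v ^ i * b * e v)"
        using vge_mult[OF pl[OF x(2)], of "w (t v ^ i * b)" "t v ^ i * b" M "e v"] e(2)[of v w] x xv
        by (simp add: vge_def)
      ultimately have "vge w (w y) (t v ^ i * b * e v)" using vge_mono by blast
      then show ?thesis by (simp add: xv u_def)
    next
      case True
      then have "u x = 0" unfolding xv(1) u_def by simp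
      then show ?thesis by simp
    qed
  qed
  define R where "R = {f. \<forall>w\<in>T. vge w 0 f}"
  have R: "subring_of R" unfolding R_def subring_of_def
    using vge_diff[OF pl] vge_mult0[OF pl] vge_1[OF pl] by auto
  have uR: "u x \<in> R" if x: "x \<in> I" for x
    unfolding R_def
  proof safe
    fix w assume w: "w \<in> T"
    obtain v i b where xv: "x = (v, i, b)" "v \<in> T" "i < n v" "b \<in> Bv v" using x by (auto simp: I_def)
    have yw: "0 \<le> w y" using T(2)[OF w] by simp
    show "vge w 0 (u x)"
    proof (cases "w = v")
      case True
      have "vge v 0 (t v ^ i * b * e v - t v ^ i * b)" using u_same[OF xv(2,4)] yw True vge_mono by blast
      then have "vge v 0 ((t v ^ i * b * e v - t v ^ i * b) + t v ^ i * b)"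
        using tO[OF xv(2,4)] vge_add[OF pl[OF xv(2)]] by blast
      then show ?thesis by (simp add: u_def xv True)
    next
      case False
      then show ?thesis using u_other[OF x w] xv yw vge_mono by fastforce
    qed
  qed
  have "lin_indep (peval y) I u"
  proof (rule lin_indep_modulo[OF R _ _ y0 finI uR])
    show "range \<iota> \<subseteq> R" using vge_const[OF pl] by (auto simp: R_def)
    show "y \<in> R" using T(2) by (auto simp: R_def vge_def intro: less_imp_le)
    fix c z assume z: "z \<in> R" and eq: "(\<Sum>x\<in>I. \<iota> (c x) * u x) = y * z"
    have "c (v, i, b) = 0" if v: "v \<in> T" and i: "i < n v" and b: "b \<in> Bv v" for v i b
    proof -
      note pv = pl[OF v]
      have yv: "vge v (v y) (y * z)"
        using vge_mult[OF pv, of "v y" y 0 z] z v by (auto simp: R_def vge_def)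
      define s where "s = (\<lambda>i. \<Sum>b\<in>Bv v. \<iota> (c (v, i, b)) * b)"
      have sO: "vge v 0 (s i)" for i unfolding s_def
        using Bv1[OF v] by (intro vge_sum[OF pv] vge_mult0[OF pv] vge_const[OF pv]) auto
      define J where "J = {v} \<times> ({..<n v} \<times> Bv v)"
      have JI: "J \<subseteq> I" using v by (auto simp: J_def I_def)
      have "vge v (v y) (\<Sum>x\<in>I - J. \<iota> (c x) * u x)"
      proof (intro vge_sum[OF pv] vge_mult0[OF pv vge_const[OF pv]] u_other[OF _ v])
        fix x assume x: "x \<in> I - J"
        then show "x \<in> I" by blast
        show "v \<noteq> fst x" using x by (auto simp: I_def J_def)
      qed
      moreover have "(\<Sum>x\<in>I. \<iota> (c x) * u x) = (\<Sum>x\<in>I - J. \<iota> (c x) * u x) + (\<Sum>x\<in>J. \<iota> (c x) * u x)"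
        using JI finI by (simp add: sum.subset_diff)
      ultimately have vJ: "vge v (v y) (\<Sum>x\<in>J. \<iota> (c x) * u x)"
      proof -
        assume *: "vge v (v y) (\<Sum>x\<in>I - J. \<iota> (c x) * u x)"
          "(\<Sum>x\<in>I. \<iota> (c x) * u x) = (\<Sum>x\<in>I - J. \<iota> (c x) * u x) + (\<Sum>x\<in>J. \<iota> (c x) * u x)"
        then have "(\<Sum>x\<in>J. \<iota> (c x) * u x) = y * z - (\<Sum>x\<in>I - J. \<iota> (c x) * u x)" using eq by simp
        then show ?thesis using vge_diff[OF pv yv *(1)] by simp
      qed
      have "vge v (v y) (\<Sum>x\<in>J. \<iota> (c x) * (u x - t v ^ fst (snd x) * snd (snd x)))"
        using u_same[OF v] by (intro vge_sum[OF pv] vge_mult0[OF pv vge_const[OF pv]]) (auto simp: J_def u_def)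
      then have "vge v (v y) ((\<Sum>x\<in>J. \<iota> (c x) * u x) -
          (\<Sum>x\<in>J. \<iota> (c x) * (u x - t v ^ fst (snd x) * snd (snd x))))"
        using vJ vge_diff[OF pv] by blast
      also have "(\<Sum>x\<in>J. \<iota> (c x) * u x) - (\<Sum>x\<in>J. \<iota> (c x) * (u x - t v ^ fst (snd x) * snd (snd x)))
          = (\<Sum>x\<in>J. \<iota> (c x) * (t v ^ fst (snd x) * snd (snd x)))"
        by (simp add: sum_subtractf[symmetric] right_diff_distrib)
      also have "\<dots> = (\<Sum>i<n v. t v ^ i * s i)"
        unfolding J_def s_def by (simp add: sum.cartesian_product' sum_distrib_left mult_ac)
      finally have tot: "vge v (v y) (\<Sum>i<n v. t v ^ i * s i)" .
      \<comment> \<open>The \<open>s i\<close> are peeled off from the lowest index: each turns out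
        to lie in the maximal ideal, and it is a combination of a residue basis.\<close>
      have "\<forall>b\<in>Bv v. c (v, i, b) = 0" using i
      proof (induction i rule: less_induct)
        case (less i)
        have "(\<Sum>j<n v. t v ^ j * s j) = t v ^ i * s i + (\<Sum>j\<in>{..<n v} - {i}. t v ^ j * s j)"
          using less.prems by (simp add: sum.remove)
        also have "(\<Sum>j\<in>{..<n v} - {i}. t v ^ j * s j) = (\<Sum>j\<in>{Suc i..<n v}. t v ^ j * s j)"
        proof (rule sum.mono_neutral_right)
          show "\<forall>j\<in>{..<n v} - {i} - {Suc i..<n v}. t v ^ j * s j = 0"
            using less by (auto simp: s_def)
        qed auto
        finally have eq: "t v ^ i * s i = (\<Sum>j<n v. t v ^ j * s j) - (\<Sum>j\<in>{Suc i..<n v}. t v ^ j * s j)" by simp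
        have "vge v (int i + 1) (\<Sum>j<n v. t v ^ j * s j)"
          using tot less.prems n[OF v] by (intro vge_mono[OF tot]) simp
        moreover have "vge v (int i + 1) (\<Sum>j\<in>{Suc i..<n v}. t v ^ j * s j)"
        proof (rule vge_sum[OF pv])
          fix j assume j: "j \<in> {Suc i..<n v}"
          have "vge v (int j + 0) (t v ^ j * s j)"
            using sO t[OF v] by (intro vge_mult[OF pv]) (auto simp: vge_def val_power[OF pv])
          then show "vge v (int i + 1) (t v ^ j * s j)" using j by (auto intro: vge_mono)
        qed
        ultimately have "vge v (int i + 1) (t v ^ i * s i)" using eq vge_diff[OF pv] by simp
        then have "vge v 1 (s i)" using vge_mult_cancel[OF pv, of "t v ^ i" _ "s i"] t[OF v] by (simp add: val_power[OF pv])
        then show ?case using Bv2[OF v, of "\<lambda>b. c (v, i, b)"] by (simp add: s_def)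
      qed
      then show ?thesis using b by blast
    qed
    then show "\<forall>x\<in>I. c x = 0" by (auto simp: I_def)
  qed
  then have "card I \<le> card B"
    using B finI by (intro card_lin_indep_le[OF domain_embedding_peval[OF y]])
  moreover have "card I = (\<Sum>v\<in>T. n v * pdeg v)"
    unfolding I_def using T(1) Bv1 Bv3 by (simp add: card_SigmaI)
  ultimately show ?thesis by (simp add: n_def)
qed

lemma finite_zeros: "finite {v. place v \<and> 0 < v y}"
proof (cases "y \<in> range \<iota>")
  case True
  then have "{v. place v \<and> 0 < v y} = {}" using val_const by fastforce
  then show ?thesis by (metis finite.emptyI)
next
  case False
  obtain B where B: "finite B" "\<And>f. in_frac_span (peval y) B (\<lambda>b. b) f" using function_field_basis[OF False] by metis
  show ?thesis
  proof (rule ccontr)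
    assume "infinite {v. place v \<and> 0 < v y}"
    then obtain T where T: "finite T" "card T = Suc (card B)" "T \<subseteq> {v. place v \<and> 0 < v y}"
      using infinite_arbitrarily_large[of _ "Suc (card B)"] by blast
    have "(\<Sum>v\<in>T. 1) \<le> (\<Sum>v\<in>T. nat (v y) * pdeg v)"
      using T(3) place_degree_pos by (intro sum_mono) (fastforce simp: Suc_le_eq)
    also have "\<dots> \<le> card B" using T by (intro zeros_degree_le[OF False B]) auto
    finally show False using T(2) by simp
  qed
qed

lemma finite_poles: "finite {v. place v \<and> v y < 0}"
proof -
  have "{v. place v \<and> v y < 0} = {v. place v \<and> 0 < v (inverse y)}" using val_inverse_pos_iff by blast
  then show ?thesis using finite_zeros by simp
qed

definition supp :: "'f \<Rightarrow> 'f place set" where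
  "supp f = {v. place v \<and> v f \<noteq> 0}"

lemma finite_supp: "finite (supp f)"
proof -
  have "supp f = {v. place v \<and> 0 < v f} \<union> {v. place v \<and> v f < 0}" by (auto simp: supp_def)
  then show ?thesis using finite_zeros finite_poles by simp
qed

section \<open>Riemann-Roch spaces\<close>

text \<open>The divisor is a plain function, so that it can be updated pointwise and twisted by
  values \<open>v z\<close>; finiteness of supports is required only where it matters.\<close>

definition Lsp :: "('f place \<Rightarrow> int) \<Rightarrow> 'f set" where
  "Lsp A = {f. \<forall>v. place v \<longrightarrow> vge v (- A v) f}"

lemma Lsp_diff: "f \<in> Lsp A \<Longrightarrow> g \<in> Lsp A \<Longrightarrow> f - g \<in> Lsp A"
  using vge_diff by (auto simp: Lsp_def)

lemma Lsp_mono: "(\<And>v. place v \<Longrightarrow> A v \<le> A' v) \<Longrightarrow> Lsp A \<subseteq> Lsp A'"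
  by (auto simp: Lsp_def intro: vge_mono)

lemma Lsp_cong: "(\<And>v. place v \<Longrightarrow> A v = A' v) \<Longrightarrow> Lsp A = Lsp A'"
  by (auto simp: Lsp_def)

lemma card_Lsp_le:
  assumes "finite T" "\<And>v. v \<in> T \<Longrightarrow> place v" and "finite (Lsp A)"
    and "\<And>v. v \<in> T \<Longrightarrow> A v \<le> A' v" "\<And>v. place v \<Longrightarrow> v \<notin> T \<Longrightarrow> A v = A' v"
  shows "finite (Lsp A') \<and> card (Lsp A') \<le> card (Lsp A) * CARD('k) ^ (\<Sum>v\<in>T. nat (A' v - A v) * pdeg v)"
  using assms
proof (induction T arbitrary: A' rule: finite_induct)
  case empty
  then have "Lsp A = Lsp A'" by (intro Lsp_cong) auto
  with empty show ?case by simp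
next
  case (insert v T)
  \<comment> \<open>One place at a time: \<open>A''\<close> is \<open>A'\<close> before the change
    at \<open>v\<close>.\<close>
  define A'' where "A'' = A'(v := A v)"
  have pv: "place v" using insert by blast
  have IH: "finite (Lsp A'') \<and> card (Lsp A'') \<le> card (Lsp A) * CARD('k) ^ (\<Sum>v\<in>T. nat (A'' v - A v) * pdeg v)"
    using insert by (intro insert.IH) (auto simp: A''_def)
  have s: "(\<Sum>v\<in>T. nat (A'' v - A v) * pdeg v) = (\<Sum>v\<in>T. nat (A' v - A v) * pdeg v)"
    using insert by (intro sum.cong) (auto simp: A''_def)
  have A'v: "- A' v + int (nat (A' v - A v)) = - A v" using insert by simp
  have eq: "{f \<in> Lsp A'. vge v (- A' v + int (nat (A' v - A v))) f} = Lsp A''"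
  proof (intro equalityI subsetI)
    fix f assume f: "f \<in> Lsp A''"
    have "vge u (- A' u) f" if "place u" for u
    proof (cases "u = v")
      case True
      then have "vge v (- A v) f" using f pv by (auto simp: Lsp_def A''_def)
      then show ?thesis using insert.prems(3)[of v] True by (auto intro: vge_mono)
    qed (use f that in \<open>auto simp: Lsp_def A''_def\<close>)
    moreover have "vge v (- A v) f" using f pv by (auto simp: Lsp_def A''_def)
    ultimately show "f \<in> {f \<in> Lsp A'. vge v (- A' v + int (nat (A' v - A v))) f}"
      unfolding A'v by (auto simp: Lsp_def)
  next
    fix f assume "f \<in> {f \<in> Lsp A'. vge v (- A' v + int (nat (A' v - A v))) f}"
    then have f: "f \<in> Lsp A'" "vge v (- A v) f" unfolding A'v by auto
    show "f \<in> Lsp A''" unfolding Lsp_def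
    proof safe
      fix u assume "place u"
      then show "vge u (- A'' u) f" using f by (cases "u = v") (auto simp: Lsp_def A''_def)
    qed
  qed
  have "finite (Lsp A') \<and> card (Lsp A') \<le> card (Lsp A'') * CARD('k) ^ (nat (A' v - A v) * pdeg v)"
  proof -
    have "finite (Lsp A') \<and> card (Lsp A') \<le>
        card {f \<in> Lsp A'. vge v (- A' v + int (nat (A' v - A v))) f} * CARD('k) ^ (nat (A' v - A v) * pdeg v)"
    proof (rule card_le_card_vge[OF pv])
      show "\<And>f. f \<in> Lsp A' \<Longrightarrow> vge v (- A' v) f" using pv by (simp add: Lsp_def)
      show "finite {f \<in> Lsp A'. vge v (- A' v + int (nat (A' v - A v))) f}" unfolding eq using IH by simp
    qed (rule Lsp_diff)
    then show ?thesis unfolding eq .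
  qed
  moreover have "card (Lsp A'') * CARD('k) ^ (nat (A' v - A v) * pdeg v) \<le>
      card (Lsp A) * CARD('k) ^ (\<Sum>v\<in>T. nat (A' v - A v) * pdeg v) * CARD('k) ^ (nat (A' v - A v) * pdeg v)"
    using IH unfolding s by (intro mult_right_mono) auto
  ultimately have "finite (Lsp A')" "card (Lsp A') \<le>
      card (Lsp A) * CARD('k) ^ (\<Sum>v\<in>T. nat (A' v - A v) * pdeg v) * CARD('k) ^ (nat (A' v - A v) * pdeg v)"
    by (blast, linarith)
  moreover have "(\<Sum>v\<in>insert v T. nat (A' v - A v) * pdeg v) =
      (\<Sum>v\<in>T. nat (A' v - A v) * pdeg v) + nat (A' v - A v) * pdeg v"
    using insert by simp
  ultimately show ?case by (simp only: power_add mult.assoc simp_thms)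
qed

lemma Lsp_const: "Lsp (\<lambda>_. 0) = range \<iota>"
proof (intro equalityI subsetI)
  fix f assume f: "f \<in> Lsp (\<lambda>_. 0)"
  show "f \<in> range \<iota>"
  proof (rule ccontr)
    assume "f \<notin> range \<iota>"
    then have "inverse f \<notin> range \<iota>" by (rule inverse_nonconst)
    then obtain v where v: "place v" "0 < v (inverse f)" using zero_exists by blast
    moreover have "f \<noteq> 0" using \<open>f \<notin> range \<iota>\<close> rangeI[of \<iota> 0] by auto
    ultimately show False using f by (auto simp: Lsp_def vge_def val_inverse)
  qed
qed (auto simp: Lsp_def vge_const)

text \<open>Only positive values of \<open>A\<close> allow poles; negative ones merely impose
  conditions and may occur at infinitely many places.\<close>

lemma finite_Lsp:
  assumes "finite {v. place v \<and> 0 < A v}"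
  shows "finite (Lsp A)"
proof -
  have "finite (Lsp (\<lambda>v. max 0 (A v)))"
    using card_Lsp_le[OF assms, of "\<lambda>_. 0" "\<lambda>v. max 0 (A v)"] finite_range_emb by (auto simp: Lsp_const)
  moreover have "Lsp A \<subseteq> Lsp (\<lambda>v. max 0 (A v))" by (intro Lsp_mono) simp
  ultimately show ?thesis using finite_subset by blast
qed

section \<open>Degrees of zero and pole divisors, and Riemann's inequality\<close>

definition zdeg :: "'f \<Rightarrow> nat" where
  "zdeg f = (\<Sum>v | place v \<and> 0 < v f. nat (v f) * pdeg v)"

definition pole_part :: "'f \<Rightarrow> 'f place \<Rightarrow> int" where
  "pole_part y v = max 0 (- v y)"

lemma finite_pole_part: "finite {v. place v \<and> 0 < int M * pole_part y v}"
  by (rule finite_subset[OF _ finite_poles[of y]]) (auto simp: pole_part_def zero_less_mult_iff)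

lemma frobenius_poly_nonzero:
  assumes "y \<notin> range \<iota>" "0 < r"
  shows "y ^ p ^ r - y \<noteq> 0"
proof
  assume "y ^ p ^ r - y = 0"
  then have "peval y (monom 1 (p ^ r) - monom 1 1) = 0" by simp
  then have "monom 1 (p ^ r) - monom 1 1 = (0 :: 'k poly)" using peval_eq_0_iff[OF assms(1)] by blast
  then have "coeff (monom 1 (p ^ r) - monom 1 1 :: 'k poly) 1 = 0" by simp
  moreover have "p ^ r \<noteq> 1" using p_pos assms(2) by simp
  ultimately show False by (simp add: coeff_diff)
qed

text \<open>At a place where \<open>y\<close> is regular, some \<open>y ^ p ^ s - y\<close> vanishes
  by \<open>frobenius_residue\<close>. A product of powers of such expressions is a polynomial in
  \<open>y\<close> that cancels the finitely many poles concerned.\<close>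

lemma clear_finite_poles:
  assumes y: "y \<notin> range \<iota>" and B: "finite B"
  obtains h where "h \<noteq> 0" "\<And>b v. b \<in> B \<Longrightarrow> place v \<Longrightarrow> 0 \<le> v y \<Longrightarrow> vge v 0 (peval y h * b)"
proof -
  define T where "T = (\<Union>b\<in>B. {v. place v \<and> v b < 0}) \<inter> {v. 0 \<le> v y}"
  have T: "finite T" "\<And>v. v \<in> T \<Longrightarrow> place v \<and> 0 \<le> v y"
    unfolding T_def using B finite_poles by auto
  define \<pi> where "\<pi> = (\<lambda>v. monom 1 (p ^ fact (CARD('k) ^ pdeg v)) - monom 1 1 :: 'k poly)"
  have \<pi>: "\<pi> v \<noteq> 0" "v \<in> T \<Longrightarrow> vge v 1 (peval y (\<pi> v))" for v
  proof -
    have "peval y (\<pi> v) = y ^ p ^ fact (CARD('k) ^ pdeg v) - y" by (simp add: \<pi>_def)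
    then show "\<pi> v \<noteq> 0" "v \<in> T \<Longrightarrow> vge v 1 (peval y (\<pi> v))"
      using frobenius_poly_nonzero[OF y, of "fact (CARD('k) ^ pdeg v)"] frobenius_residue[of v "pdeg v" y 1] T(2)
      by (auto simp: vge_def)
  qed
  have "finite ((\<lambda>(v, b). - v b) ` (T \<times> B))" using T B by blast
  then obtain M where M: "\<And>s. s \<in> (\<lambda>(v, b). - v b) ` (T \<times> B) \<Longrightarrow> s \<le> M" by (rule int_set_bounded) blast
  define h where "h = (\<Prod>v\<in>T. \<pi> v ^ nat M)"
  have "vge v 0 (peval y h * b)" if b: "b \<in> B" and v: "place v" "0 \<le> v y" for b v
  proof (cases "v \<in> T")
    case True
    have hy: "peval y h = peval y (\<pi> v) ^ nat M * peval y (\<Prod>v\<in>T - {v}. \<pi> v ^ nat M)"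
      using T True by (simp add: h_def prod.remove)
    have yO: "vge v 0 y" using v by (simp add: vge_def)
    have "vge v (int (nat M)) (peval y (\<pi> v) ^ nat M)"
    proof (cases "peval y (\<pi> v) = 0")
      case False
      then have "int (nat M) * 1 \<le> int (nat M) * v (peval y (\<pi> v))"
        using \<pi>(2)[OF True] by (intro mult_left_mono) (auto simp: vge_def)
      then show ?thesis by (simp add: vge_def val_power[OF v(1)])
    qed (use peval_eq_0_iff[OF y] \<pi>(1) in auto)
    moreover have "vge v (- int (nat M)) b"
    proof -
      have "- v b \<le> M" using M True b by auto
      then show ?thesis by (auto simp: vge_def)
    qed
    ultimately have "vge v 0 (peval y (\<pi> v) ^ nat M * b)" using vge_mult[OF v(1)] by fastforce
    then have "vge v 0 (peval y (\<Prod>v\<in>T - {v}. \<pi> v ^ nat M) * (peval y (\<pi> v) ^ nat M * b))"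
      by (rule vge_mult0[OF v(1) vge_peval[OF v(1) yO]])
    then show ?thesis by (simp add: hy mult_ac)
  next
    case False
    then have "vge v 0 b" using b v by (auto simp: T_def vge_def)
    then show ?thesis using v by (intro vge_mult0 vge_peval) (auto simp: vge_def)
  qed
  moreover have "h \<noteq> 0" using \<pi> T by (simp add: h_def)
  ultimately show thesis using that by blast
qed

text \<open>Once the basis elements have poles only at poles of \<open>y\<close>, they may be
  multiplied by arbitrary polynomials in \<open>y\<close> of degree at most \<open>m\<close>. The
  constant \<open>\<kappa>\<close> absorbs the poles of the basis elements and does not depend on
  \<open>m\<close>.\<close>

lemma card_Lsp_lower:
  assumes y: "y \<notin> range \<iota>" and B: "finite B" "lin_indep (peval y) B (\<lambda>b. b)"
  obtains \<kappa> where "\<And>m. CARD('k) ^ (card B * (m + 1)) \<le> card (Lsp (\<lambda>v. int (m + \<kappa>) * pole_part y v))"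
proof -
  obtain h where h: "h \<noteq> 0" "\<And>b v. b \<in> B \<Longrightarrow> place v \<Longrightarrow> 0 \<le> v y \<Longrightarrow> vge v 0 (peval y h * b)"
    using clear_finite_poles[OF y B(1)] by metis
  define b' where "b' = (\<lambda>b. peval y h * b)"
  have hy: "peval y h \<noteq> 0" using h peval_eq_0_iff[OF y] by simp
  have ind: "lin_indep (peval y) B b'" unfolding lin_indep_def
  proof (intro allI impI)
    fix a assume "(\<Sum>b\<in>B. peval y (a b) * b' b) = 0"
    then have "peval y h * (\<Sum>b\<in>B. peval y (a b) * b) = 0" by (simp add: b'_def sum_distrib_left mult_ac)
    then have "(\<Sum>b\<in>B. peval y (a b) * b) = 0" using hy by simp
    then show "\<forall>b\<in>B. a b = 0" using lin_indepD[OF B(2), of a] by simp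
  qed
  have "finite ((\<lambda>(v, b). - v (b' b)) ` ({v. place v \<and> v y < 0} \<times> B))" using finite_poles B by blast
  then obtain K where K: "\<And>s. s \<in> (\<lambda>(v, b). - v (b' b)) ` ({v. place v \<and> v y < 0} \<times> B) \<Longrightarrow> s \<le> K"
    by (rule int_set_bounded) blast
  define \<kappa> where "\<kappa> = nat K"
  have "CARD('k) ^ (card B * (m + 1)) \<le> card (Lsp (\<lambda>v. int (m + \<kappa>) * pole_part y v))" for m
  proof -
    define r where "r = (\<lambda>g (b :: 'f). \<Sum>i\<le>m. monom (g (b, i)) i :: 'k poly)"
    define \<Phi> where "\<Phi> = (\<lambda>g. \<Sum>b\<in>B. peval y (r g b) * b' b)"
    have "inj_on \<Phi> (B \<times> {..m} \<rightarrow>\<^sub>E UNIV)"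
    proof (rule inj_onI)
      fix g g' assume g: "g \<in> B \<times> {..m} \<rightarrow>\<^sub>E UNIV" "g' \<in> B \<times> {..m} \<rightarrow>\<^sub>E UNIV" "\<Phi> g = \<Phi> g'"
      then have "(\<Sum>b\<in>B. peval y (r g b - r g' b) * b' b) = 0"
        by (simp add: \<Phi>_def left_diff_distrib sum_subtractf)
      then have *: "\<And>b. b \<in> B \<Longrightarrow> r g b = r g' b" using lin_indepD[OF ind, of "\<lambda>b. r g b - r g' b"] by simp
      have "g (b, i) = g' (b, i)" if "b \<in> B" "i \<le> m" for b i
      proof -
        have "coeff (r g b) i = coeff (r g' b) i" using *[OF that(1)] by simp
        then show ?thesis using that(2) by (simp add: r_def coeff_sum coeff_monom)
      qed
      then show "g = g'" using g by (intro PiE_ext[of g "B \<times> {..m}" "\<lambda>_. UNIV"]) auto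
    qed
    moreover have "\<Phi> ` (B \<times> {..m} \<rightarrow>\<^sub>E UNIV) \<subseteq> Lsp (\<lambda>v. int (m + \<kappa>) * pole_part y v)"
    proof safe
      fix g
      show "\<Phi> g \<in> Lsp (\<lambda>v. int (m + \<kappa>) * pole_part y v)"
        unfolding Lsp_def \<Phi>_def
      proof (intro CollectI allI impI vge_sum)
        fix v b assume v: "place v" and b: "b \<in> B"
        show "vge v (- (int (m + \<kappa>) * pole_part y v)) (peval y (r g b) * b' b)"
        proof (cases "0 \<le> v y")
          case True
          then have "vge v 0 (peval y (r g b) * b' b)"
            unfolding b'_def by (intro vge_mult0[OF v] vge_peval[OF v] h(2)[OF b v]) (auto simp: vge_def)
          then show ?thesis using True by (simp add: pole_part_def max_def)
        next
          case False
          have "vge v (int m * v y) (peval y (r g b))"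
            unfolding r_def peval_sum peval_monom
          proof (rule vge_sum[OF v])
            fix i assume i: "i \<in> {..m}"
            have "int m * v y \<le> int i * v y" using i False by (intro mult_right_mono_neg) auto
            then have "vge v (int m * v y) (y ^ i)" by (simp add: vge_def val_power[OF v])
            then show "vge v (int m * v y) (\<iota> (g (b, i)) * y ^ i)" by (rule vge_mult0[OF v vge_const[OF v]])
          qed
          moreover have "vge v (int \<kappa> * v y) (b' b)"
          proof -
            have "- v (b' b) \<le> K" using False v b by (intro K image_eqI[of _ _ "(v, b)"]) auto
            then have "- v (b' b) \<le> int \<kappa>" by (simp add: \<kappa>_def)
            moreover have "int \<kappa> * 1 \<le> int \<kappa> * (- v y)" using False by (intro mult_left_mono) auto
            ultimately show ?thesis by (auto simp: vge_def)
          qed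
          ultimately have "vge v (int m * v y + int \<kappa> * v y) (peval y (r g b) * b' b)" by (rule vge_mult[OF v])
          then show ?thesis using False by (simp add: pole_part_def algebra_simps)
        qed
      qed
    qed
    ultimately have "card (B \<times> {..m} \<rightarrow>\<^sub>E (UNIV :: 'k set)) \<le> card (Lsp (\<lambda>v. int (m + \<kappa>) * pole_part y v))"
      by (intro card_inj_on_le finite_Lsp finite_pole_part)
    then show ?thesis using B(1) by (simp add: card_PiE card_cartesian_product)
  qed
  then show thesis using that by blast
qed

lemma zdeg_inverse: "zdeg (inverse y) = (\<Sum>v | place v \<and> v y < 0. nat (- v y) * pdeg v)"
  unfolding zdeg_def by (rule sum.cong) (auto simp: val_inverse_pos_iff val_inverse)

lemma card_Lsp_pole_part:
  "card (Lsp (\<lambda>v. int M * pole_part y v)) \<le> CARD('k) * CARD('k) ^ (M * zdeg (inverse y))"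
proof -
  let ?T = "{v. place v \<and> v y < 0}"
  have "finite (Lsp (\<lambda>v. int M * pole_part y v)) \<and> card (Lsp (\<lambda>v. int M * pole_part y v)) \<le>
      card (Lsp (\<lambda>_. 0)) * CARD('k) ^ (\<Sum>v\<in>?T. nat (int M * pole_part y v - 0) * pdeg v)"
    by (rule card_Lsp_le[OF finite_poles]) (auto simp: Lsp_const pole_part_def finite_range_emb intro: mult_nonneg_nonpos)
  then have "card (Lsp (\<lambda>v. int M * pole_part y v)) \<le>
      card (Lsp (\<lambda>_. 0)) * CARD('k) ^ (\<Sum>v\<in>?T. nat (int M * pole_part y v - 0) * pdeg v)" by blast
  also have "(\<Sum>v\<in>?T. nat (int M * pole_part y v - 0) * pdeg v) = M * zdeg (inverse y)"
    unfolding zdeg_inverse sum_distrib_left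
  proof (rule sum.cong)
    fix v assume v: "v \<in> ?T"
    have "nat (int M * (- v y)) = M * nat (- v y)" using nat_mult_distrib[of "int M" "- v y"] by simp
    then show "nat (int M * pole_part y v - 0) * pdeg v = M * (nat (- v y) * pdeg v)"
      using v by (simp add: pole_part_def max_def)
  qed simp
  finally show ?thesis by (simp add: Lsp_const finite_range_emb)
qed

text \<open>For the second inequality, the space for \<open>m + \<kappa>\<close> times the pole
  divisor is counted from below and from above; the exponents grow like \<open>card B * m\<close>
  and \<open>zdeg (inverse y) * m\<close>.\<close>

lemma zeros_basis_poles:
  assumes y: "y \<notin> range \<iota>" and B: "finite B" "lin_indep (peval y) B (\<lambda>b. b)" "\<And>f. in_frac_span (peval y) B (\<lambda>b. b) f"
  shows "zdeg y \<le> card B" "card B \<le> zdeg (inverse y)"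
proof -
  show "zdeg y \<le> card B" unfolding zdeg_def by (rule zeros_degree_le[OF y B(1,3) finite_zeros]) auto
  obtain \<kappa> where \<kappa>: "\<And>m. CARD('k) ^ (card B * (m + 1)) \<le> card (Lsp (\<lambda>v. int (m + \<kappa>) * pole_part y v))"
    using card_Lsp_lower[OF y B(1,2)] by metis
  define D where "D = zdeg (inverse y)"
  have le: "card B * (m + 1) \<le> 1 + (m + \<kappa>) * D" for m
  proof -
    have "CARD('k) ^ (card B * (m + 1)) \<le> CARD('k) ^ (1 + (m + \<kappa>) * D)"
      using order_trans[OF \<kappa>[of m] card_Lsp_pole_part] by (simp only: D_def power_add power_one_right)
    then show ?thesis by (rule power_le_imp_le_exp[OF card_const_gt_1])
  qed
  show "card B \<le> zdeg (inverse y)"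
  proof (rule ccontr)
    assume "\<not> ?thesis"
    then have "Suc D \<le> card B" by (simp add: D_def)
    \<comment> \<open>The value \<open>m = \<kappa> * D\<close> already contradicts
      \<open>D < card B\<close> unless \<open>D = 0\<close>, and then \<open>m = 1\<close>
      does.\<close>
    then have "Suc D * (\<kappa> * D + 1) \<le> 1 + (\<kappa> * D + \<kappa>) * D"
      using le[of "\<kappa> * D"] mult_le_mono1[of "Suc D" "card B" "\<kappa> * D + 1"] by linarith
    then have "D = 0" by (simp add: algebra_simps)
    then show False using le[of 1] \<open>Suc D \<le> card B\<close> by simp
  qed
qed

text \<open>The dimension of \<open>F\<close> over \<open>K(y)\<close> lies between the two degrees;
  the same for \<open>inverse y\<close> gives equality.\<close>

lemma zdeg_inverse_eq: "zdeg (inverse y) = zdeg y"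
proof -
  have le: "zdeg y \<le> zdeg (inverse y)" if yr: "y \<notin> range \<iota>" for y
  proof -
    obtain B where "finite B" "lin_indep (peval y) B (\<lambda>b. b)" "\<And>f. in_frac_span (peval y) B (\<lambda>b. b) f"
      using function_field_basis[OF yr] by metis
    then show ?thesis using zeros_basis_poles[OF yr, of B] by simp
  qed
  show ?thesis
  proof (cases "y \<in> range \<iota>")
    case True
    then obtain a where "y = \<iota> a" by blast
    have *: "\<not> 0 < v y" "\<not> 0 < v (inverse y)" if "place v" for v
      using val_const[OF that, of a] val_inverse[OF that, of y] \<open>y = \<iota> a\<close> by simp_all
    have z: "zdeg f = 0" if f: "\<And>v. place v \<Longrightarrow> \<not> 0 < v f" for f
      unfolding zdeg_def
    proof (rule sum.neutral, rule ballI)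
      fix v assume "v \<in> {v. place v \<and> 0 < v f}"
      then show "nat (v f) * pdeg v = 0" using f[of v] by simp
    qed
    have "zdeg y = 0" "zdeg (inverse y) = 0" using z[of y] z[of "inverse y"] * by blast+
    then show ?thesis by simp
  next
    case False
    then show ?thesis using le[OF False] le[OF inverse_nonconst[OF False]] by simp
  qed
qed

lemma degree_principal:
  assumes S: "finite S" "\<And>v. v \<in> S \<Longrightarrow> place v" "supp f \<subseteq> S"
  shows "(\<Sum>v\<in>S. v f * int (pdeg v)) = 0"
proof -
  let ?Z = "{v. place v \<and> 0 < v f}" and ?P = "{v. place v \<and> v f < 0}"
  have sub: "?Z \<union> ?P \<subseteq> S" using S by (auto simp: supp_def)
  have "(\<Sum>v\<in>S. v f * int (pdeg v)) = (\<Sum>v\<in>?Z \<union> ?P. v f * int (pdeg v))"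
  proof (rule sum.mono_neutral_right[OF S(1) sub], rule ballI)
    fix v assume "v \<in> S - (?Z \<union> ?P)"
    then have "v f = 0" using S(2)[of v] by auto
    then show "v f * int (pdeg v) = 0" by simp
  qed
  also have "\<dots> = (\<Sum>v\<in>?Z. v f * int (pdeg v)) + (\<Sum>v\<in>?P. v f * int (pdeg v))"
    using finite_zeros finite_poles by (intro sum.union_disjoint) auto
  also have "(\<Sum>v\<in>?Z. v f * int (pdeg v)) = int (zdeg f)"
    unfolding zdeg_def of_nat_sum by (intro sum.cong) auto
  also have "(\<Sum>v\<in>?P. v f * int (pdeg v)) = - int (zdeg (inverse f))"
    unfolding zdeg_inverse of_nat_sum sum_negf[symmetric] by (intro sum.cong) auto
  finally show ?thesis by (simp add: zdeg_inverse_eq)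
qed

lemma nonconst_exists: "\<exists>x. x \<notin> range \<iota>"
  using generators by metis

lemma Lsp_nontrivial:
  assumes "CARD('k) \<le> card (Lsp A)"
  obtains f where "f \<noteq> 0" "f \<in> Lsp A"
proof -
  have "\<exists>f\<in>Lsp A. f \<noteq> 0"
  proof (rule ccontr)
    assume "\<not> ?thesis"
    then have "Lsp A \<subseteq> {0}" by blast
    then have "card (Lsp A) \<le> card {0 :: 'f}" by (rule card_mono[rotated]) simp
    then show False using assms card_const_gt_1 by simp
  qed
  with that show thesis by blast
qed

text \<open>\<open>A\<close> is compared with a multiple \<open>E\<close> of the pole divisor of a
  fixed \<open>x\<close>, for which \<open>card_Lsp_lower\<close> provides many sections:
  \<open>A\<close> is moved below \<open>E\<close> within its class, and the sections lost on the
  way down from \<open>E\<close> are counted. The bound \<open>D * \<kappa>\<close> depends on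
  \<open>x\<close> only.\<close>

lemma Riemann:
  "\<exists>\<gamma> :: nat. \<forall>S A. finite S \<longrightarrow> (\<forall>v\<in>S. place v) \<longrightarrow>
    (\<forall>v. place v \<longrightarrow> v \<notin> S \<longrightarrow> A v = 0) \<longrightarrow>
    int \<gamma> \<le> (\<Sum>v\<in>S. A v * int (pdeg v)) \<longrightarrow> (\<exists>f. f \<noteq> 0 \<and> f \<in> Lsp A)"
proof -
  obtain x where x: "x \<notin> range \<iota>" using nonconst_exists by blast
  obtain B where B: "finite B" "lin_indep (peval x) B (\<lambda>b. b)" "\<And>f. in_frac_span (peval x) B (\<lambda>b. b) f"
    using function_field_basis[OF x] by metis
  obtain \<kappa> where \<kappa>: "\<And>m. CARD('k) ^ (card B * (m + 1)) \<le> card (Lsp (\<lambda>v. int (m + \<kappa>) * pole_part x v))"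
    using card_Lsp_lower[OF x B(1,2)] by metis
  define D where "D = card B"
  have D: "zdeg (inverse x) = D" using zeros_basis_poles[OF x B] zdeg_inverse_eq[of x] by (simp add: D_def)
  have Dpos: "0 < D"
  proof -
    obtain v where v: "place v" "0 < v x" using zero_exists[OF x] by blast
    have "nat (v x) * pdeg v \<le> zdeg x"
      unfolding zdeg_def using v finite_zeros[of x] by (intro member_le_sum) auto
    then show ?thesis using v place_degree_pos[OF v(1)] D zdeg_inverse_eq[of x] by (metis gr0I le_zero_eq mult_eq_0_iff nat_0_iff not_le)
  qed
  let ?P = "{v. place v \<and> v x < 0}"
  have P0: "pole_part x v = 0" if "place v" "v \<notin> ?P" for v using that by (simp add: pole_part_def)
  have "\<exists>f. f \<noteq> 0 \<and> f \<in> Lsp A" if S: "finite S" "\<And>v. v \<in> S \<Longrightarrow> place v"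
    and A: "\<And>v. place v \<Longrightarrow> v \<notin> S \<Longrightarrow> A v = 0" and deg: "int (D * \<kappa>) \<le> (\<Sum>v\<in>S. A v * int (pdeg v))" for S A
  proof -
    define A1 where "A1 = (\<lambda>v. max 0 (A v))"
    define d1 where "d1 = (\<Sum>v\<in>S. nat (A1 v) * pdeg v)"
    \<comment> \<open>With this multiple, \<open>E\<close> has at least
      \<open>CARD('k) ^ (D * (d1 + 1))\<close> sections, while the zeros imposed by the positive
      part \<open>A1\<close> of \<open>A\<close> cost at most a factor \<open>CARD('k) ^ d1\<close>;
      so a nonzero \<open>z\<close> survives.\<close>
    define M where "M = d1 + \<kappa>"
    define E where "E = (\<lambda>v. int M * pole_part x v)"
    have low: "CARD('k) ^ (D * (d1 + 1)) \<le> card (Lsp E)" using \<kappa>[of d1] by (simp only: D_def E_def M_def)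
    have finE: "finite (Lsp (\<lambda>v. E v - a v))" if "\<And>v. place v \<Longrightarrow> 0 \<le> a v" for a
    proof (rule finite_Lsp, rule finite_subset[OF _ finite_pole_part[of M x]])
      show "{v. place v \<and> 0 < E v - a v} \<subseteq> {v. place v \<and> 0 < int M * pole_part x v}"
        using that by (force simp: E_def)
    qed
    have "card (Lsp E) \<le> card (Lsp (\<lambda>v. E v - A1 v)) * CARD('k) ^ (\<Sum>v\<in>S. nat (E v - (E v - A1 v)) * pdeg v)"
    proof (rule conjunct2[OF card_Lsp_le[OF S(1)]])
      show "finite (Lsp (\<lambda>v. E v - A1 v))" by (rule finE) (simp add: A1_def)
    qed (use S A in \<open>auto simp: A1_def\<close>)
    also have "(\<Sum>v\<in>S. nat (E v - (E v - A1 v)) * pdeg v) = d1" by (simp add: d1_def)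
    finally have "CARD('k) ^ (D * (d1 + 1)) \<le> card (Lsp (\<lambda>v. E v - A1 v)) * CARD('k) ^ d1" using low by simp
    moreover have "CARD('k) * CARD('k) ^ d1 \<le> CARD('k) ^ (D * (d1 + 1))"
    proof -
      have "d1 + 1 \<le> D * (d1 + 1)" using Dpos by (cases D) auto
      then have "CARD('k) ^ (d1 + 1) \<le> CARD('k) ^ (D * (d1 + 1))" using card_const_gt_1 by (intro power_increasing) auto
      then show ?thesis by simp
    qed
    ultimately have "CARD('k) * CARD('k) ^ d1 \<le> card (Lsp (\<lambda>v. E v - A1 v)) * CARD('k) ^ d1" by linarith
    then have "CARD('k) \<le> card (Lsp (\<lambda>v. E v - A1 v))" using card_const_gt_1 by simp
    then obtain z where z: "z \<noteq> 0" "z \<in> Lsp (\<lambda>v. E v - A1 v)" using Lsp_nontrivial by metis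
    have zv: "A1 v - v z \<le> E v" if "place v" for v using z that by (auto simp: Lsp_def vge_def)
    \<comment> \<open>\<open>A'\<close> is equivalent to \<open>A\<close> and lies below
      \<open>E\<close>; dividing by \<open>z\<close> carries its sections to sections of
      \<open>A\<close>.\<close>
    define A' where "A' = (\<lambda>v. A v - v z)"
    have A'E: "A' v \<le> E v" if "place v" for v using zv[OF that] by (simp add: A'_def A1_def)
    define S' where "S' = S \<union> supp z \<union> ?P"
    have S': "finite S'" "\<And>v. v \<in> S' \<Longrightarrow> place v"
      using S finite_supp finite_poles by (auto simp: S'_def supp_def)
    have finA': "finite (Lsp A')"
    proof (rule finite_Lsp, rule finite_subset[OF _ S'(1)])
      show "{v. place v \<and> 0 < A' v} \<subseteq> S'" using A unfolding A'_def S'_def supp_def by force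
    qed
    have "card (Lsp E) \<le> card (Lsp A') * CARD('k) ^ (\<Sum>v\<in>S'. nat (E v - A' v) * pdeg v)"
    proof (rule conjunct2[OF card_Lsp_le[OF S' finA']])
      fix v assume v: "place v" "v \<notin> S'"
      then have "A v = 0" "v z = 0" "v \<notin> ?P" using A by (auto simp: S'_def supp_def)
      then show "A' v = E v" using P0 v by (simp add: A'_def E_def)
    qed (use A'E S' in auto)
    moreover define e where "e = (\<Sum>v\<in>S'. nat (E v - A' v) * pdeg v)"
    \<comment> \<open>\<open>E\<close> has degree \<open>M * D = D * d1 + D * \<kappa>\<close>, and
      \<open>A'\<close> has the degree of \<open>A\<close>, at least \<open>D * \<kappa>\<close>;
      hence \<open>e\<close> is at most \<open>D * d1\<close>.\<close>
    have e: "e + 1 \<le> D * (d1 + 1)"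
    proof -
      have SA: "A v * int (pdeg v) = 0" if "v \<in> S' - S" for v
        using that A[of v] S'(2)[of v] by simp
      have "int e = (\<Sum>v\<in>S'. (E v - A' v) * int (pdeg v))"
        unfolding e_def of_nat_sum using A'E S' by (intro sum.cong) auto
      also have "\<dots> = (\<Sum>v\<in>S'. E v * int (pdeg v)) - (\<Sum>v\<in>S'. A v * int (pdeg v)) + (\<Sum>v\<in>S'. v z * int (pdeg v))"
        by (simp add: A'_def sum_subtractf sum.distrib algebra_simps)
      also have "(\<Sum>v\<in>S'. v z * int (pdeg v)) = 0" by (rule degree_principal[OF S']) (auto simp: S'_def)
      also have "(\<Sum>v\<in>S'. A v * int (pdeg v)) = (\<Sum>v\<in>S. A v * int (pdeg v))"
      proof (rule sum.mono_neutral_right[OF S'(1)])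
        show "S \<subseteq> S'" by (auto simp: S'_def)
      qed (use SA in blast)
      also have "(\<Sum>v\<in>S'. E v * int (pdeg v)) = (\<Sum>v\<in>?P. E v * int (pdeg v))"
      proof (rule sum.mono_neutral_right[OF S'(1)], force simp: S'_def, rule ballI)
        fix v assume "v \<in> S' - ?P"
        then show "E v * int (pdeg v) = 0" using P0[of v] S'(2)[of v] by (simp add: E_def)
      qed
      also have "\<dots> = int M * int (zdeg (inverse x))"
        unfolding zdeg_inverse of_nat_sum sum_distrib_left by (intro sum.cong) (auto simp: E_def pole_part_def)
      finally have "int e \<le> int (M * D) - int (D * \<kappa>)" using deg D by simp
      also have "M * D = D * d1 + D * \<kappa>" by (simp add: M_def algebra_simps)
      finally have "int e \<le> int (D * d1)" by simp
      then have "e \<le> D * d1" by (simp only: of_nat_le_iff)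
      then show ?thesis using Dpos by (simp add: algebra_simps)
    qed
    ultimately have "CARD('k) ^ (D * (d1 + 1)) \<le> card (Lsp A') * CARD('k) ^ e" using low unfolding e_def by linarith
    moreover have "CARD('k) * CARD('k) ^ e \<le> CARD('k) ^ (D * (d1 + 1))"
      using power_increasing[OF e, of "CARD('k)"] card_const_gt_1 by simp
    ultimately have "CARD('k) * CARD('k) ^ e \<le> card (Lsp A') * CARD('k) ^ e" by linarith
    then have "CARD('k) \<le> card (Lsp A')" using card_const_gt_1 by simp
    then obtain f where f: "f \<noteq> 0" "f \<in> Lsp A'" using Lsp_nontrivial by metis
    have "vge v (- A v) (f / z)" if "place v" for v
      using f that vge_divide[OF that, of "- A' v" f z] z by (auto simp: Lsp_def A'_def)
    then have "f / z \<in> Lsp A" by (simp add: Lsp_def)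
    then show ?thesis using f z by (intro exI[of _ "f / z"]) auto
  qed
  then show ?thesis by (intro exI[of _ "D * \<kappa>"] allI impI) blast
qed

section \<open>Units with prescribed support\<close>

text \<open>Away from the poles of \<open>x\<close>, all these places are zeros of one nonzero
  function, by the uniform exponent in \<open>frobenius_residue\<close>.\<close>

lemma finite_places_degree_le: "finite {v. place v \<and> pdeg v \<le> \<delta>}"
proof -
  obtain x where x: "x \<notin> range \<iota>" using nonconst_exists by blast
  define g where "g = x ^ p ^ fact (CARD('k) ^ \<delta>) - x"
  have g: "g \<noteq> 0" unfolding g_def by (rule frobenius_poly_nonzero[OF x]) simp
  have "{v. place v \<and> pdeg v \<le> \<delta>} \<subseteq> {v. place v \<and> v x < 0} \<union> {v. place v \<and> 0 < v g}"
  proof safe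
    fix v assume v: "place v" "pdeg v \<le> \<delta>" "\<not> 0 < v g"
    have "\<not> vge v 0 x"
    proof
      assume "vge v 0 x"
      then have "vge v 1 g" using frobenius_residue[OF v(1,2), of x 1] by (simp add: g_def)
      then show False using g v(3) by (simp add: vge_def)
    qed
    then show "v x < 0" by (simp add: vge_def)
  qed
  then show ?thesis using finite_poles finite_zeros by (meson finite_UnI finite_subset)
qed

text \<open>The pigeonhole argument behind the finiteness of the class group: sections
  \<open>f n\<close> of divisors \<open>A n\<close> of one fixed degree give effective divisors
  \<open>C n\<close> of that degree, of which there are finitely many. If \<open>C n = C n'\<close>,
  then \<open>f n / f n'\<close> has divisor \<open>A n' - A n\<close>, supported on
  \<open>v\<close> and \<open>v0\<close>.\<close>

lemma unit_two_places:
  assumes v: "place v" "place v0" "v \<noteq> v0"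
  obtains f where "f \<noteq> 0" "0 < v f" "\<And>w. place w \<Longrightarrow> w \<noteq> v \<Longrightarrow> w \<noteq> v0 \<Longrightarrow> w f = 0"
proof -
  from Riemann obtain \<gamma> :: nat where \<gamma>:
    "\<forall>S A. finite S \<longrightarrow> (\<forall>v\<in>S. place v) \<longrightarrow>
    (\<forall>v. place v \<longrightarrow> v \<notin> S \<longrightarrow> A v = 0) \<longrightarrow>
    int \<gamma> \<le> (\<Sum>v\<in>S. A v * int (pdeg v)) \<longrightarrow> (\<exists>f. f \<noteq> 0 \<and> f \<in> Lsp A)" ..
  define \<delta> where "\<delta> = \<gamma> * pdeg v0"
  \<comment> \<open>The multiples \<open>n * pdeg v0\<close> at \<open>v\<close> and
    \<open>- n * pdeg v\<close> at \<open>v0\<close> balance, so the degree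
    \<open>\<gamma> * pdeg v0\<close> is independent of \<open>n\<close>, and it is at least
    \<open>\<gamma>\<close>.\<close>
  define A where "A = (\<lambda>n :: nat. \<lambda>w :: 'f place. if w = v then int n * int (pdeg v0)
      else if w = v0 then int \<gamma> - int n * int (pdeg v) else 0)"
  have degA: "(\<Sum>w\<in>S. A n w * int (pdeg w)) = int \<delta>" if "finite S" "v \<in> S" "v0 \<in> S" for n S
  proof -
    have "(\<Sum>w\<in>S. A n w * int (pdeg w)) = (\<Sum>w\<in>{v, v0}. A n w * int (pdeg w))"
      using that by (intro sum.mono_neutral_right) (auto simp: A_def)
    then show ?thesis using v(3) by (simp add: A_def \<delta>_def algebra_simps)
  qed
  have "\<exists>f. f \<noteq> 0 \<and> f \<in> Lsp (A n)" for n
  proof (rule \<gamma>[rule_format, of "{v, v0}"])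
    have "\<gamma> \<le> \<delta>" using place_degree_pos[OF v(2)] by (simp add: \<delta>_def)
    then show "int \<gamma> \<le> (\<Sum>w\<in>{v, v0}. A n w * int (pdeg w))" using degA[of "{v, v0}" n] by simp
  qed (use v in \<open>auto simp: A_def\<close>)
  then obtain f where f: "\<And>n. f n \<noteq> 0" "\<And>n. f n \<in> Lsp (A n)" by metis
  define C where "C = (\<lambda>n w. w (f n) + A n w)"
  have C0: "0 \<le> C n w" if "place w" for n w
    using f(1)[of n] f(2)[of n] that by (auto simp: Lsp_def vge_def C_def)
  have Cle: "C n w * int (pdeg w) \<le> int \<delta>" if w: "place w" for n w
  proof -
    define S where "S = insert w (insert v (insert v0 (supp (f n))))"
    have S: "finite S" "\<And>u. u \<in> S \<Longrightarrow> place u" using w v finite_supp by (auto simp: S_def supp_def)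
    have "C n w * int (pdeg w) \<le> (\<Sum>w\<in>S. C n w * int (pdeg w))"
      using S C0 by (intro member_le_sum) (auto simp: S_def)
    also have "\<dots> = (\<Sum>w\<in>S. w (f n) * int (pdeg w)) + (\<Sum>w\<in>S. A n w * int (pdeg w))"
      by (simp add: C_def sum.distrib algebra_simps)
    also have "\<dots> = int \<delta>"
      using degree_principal[OF S, of "f n"] degA[OF S(1), of n] by (auto simp: S_def)
    finally show ?thesis .
  qed
  define T where "T = {w. place w \<and> pdeg w \<le> \<delta>}"
  have T: "finite T" unfolding T_def by (rule finite_places_degree_le)
  have Cdeg: "C n w = 0 \<or> pdeg w \<le> \<delta>" "C n w \<le> int \<delta>" if w: "place w" for n w
  proof -
    have "1 * int (pdeg w) \<le> C n w * int (pdeg w)" if "C n w \<noteq> 0"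
      using that C0[OF w, of n] by (intro mult_right_mono) auto
    then show "C n w = 0 \<or> pdeg w \<le> \<delta>" using Cle[OF w, of n] by fastforce
    have "C n w * 1 \<le> C n w * int (pdeg w)"
      using C0[OF w, of n] place_degree_pos[OF w] by (intro mult_left_mono) auto
    then show "C n w \<le> int \<delta>" using Cle[OF w, of n] by simp
  qed
  define h where "h = (\<lambda>n. restrict (C n) T)"
  have "range h \<subseteq> T \<rightarrow>\<^sub>E {0..int \<delta>}"
  proof (rule image_subsetI)
    fix n show "h n \<in> T \<rightarrow>\<^sub>E {0..int \<delta>}"
      unfolding h_def restrict_PiE_iff
    proof
      fix w assume "w \<in> T"
      then have "place w" by (simp add: T_def)
      then show "C n w \<in> {0..int \<delta>}" using C0[of w n] Cdeg(2)[of w n] by simp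
    qed
  qed
  moreover have "finite (T \<rightarrow>\<^sub>E {0..int \<delta>})" using T by (intro finite_PiE) auto
  ultimately have "finite (range h)" using finite_subset by blast
  then have "\<not> inj h" using finite_imageD[of h UNIV] by auto
  then obtain n n' where nn: "n < n'" "h n = h n'" unfolding inj_def by (metis linorder_neqE_nat)
  have Ceq: "C n w = C n' w" if w: "place w" for w
  proof (cases "w \<in> T")
    case True
    then show ?thesis using fun_cong[OF nn(2), of w] by (simp add: h_def)
  next
    case False
    then show ?thesis using Cdeg(1)[OF w, of n] Cdeg(1)[OF w, of n'] w by (auto simp: T_def)
  qed
  have w: "w (f n / f n') = A n' w - A n w" if "place w" for w
    using Ceq[OF that] val_divide[OF that, of "f n" "f n'"] f(1) by (simp add: C_def)
  show thesis
  proof (rule that[of "f n / f n'"])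
    show "0 < v (f n / f n')" using w[OF v(1)] nn(1) place_degree_pos[OF v(2)] by (simp add: A_def)
    show "w (f n / f n') = 0" if "place w" "w \<noteq> v" "w \<noteq> v0" for w
      using w[OF that(1)] that by (simp add: A_def)
  qed (use f in simp)
qed

text \<open>Choosing \<open>f i\<close> among the units with trivial valuation at \<open>vs ! l\<close> for \<open>l < i\<close>, with minimal positive
  valuation at \<open>vs ! i\<close>, makes the units independent modulo \<open>p\<close>-th powers.\<close>

lemma independent_units:
  assumes vs: "distinct (v0 # vs)" "\<And>v. v \<in> set (v0 # vs) \<Longrightarrow> place v"
  obtains f where "\<And>i. i < length vs \<Longrightarrow> f i \<noteq> 0"
    "\<And>i w. i < length vs \<Longrightarrow> place w \<Longrightarrow> w \<notin> set (v0 # vs) \<Longrightarrow> w (f i) = 0"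
    "\<And>n g i. (\<And>i. n i < p) \<Longrightarrow> (\<Prod>i<length vs. f i ^ n i) = g ^ p \<Longrightarrow> i < length vs \<Longrightarrow> n i = 0"
proof -
  define Q where "Q = (\<lambda>i f. f \<noteq> 0 \<and> (\<forall>w. place w \<longrightarrow> w \<notin> set (v0 # vs) \<longrightarrow> w f = 0) \<and>
     (\<forall>l<i. (vs ! l) f = 0) \<and> 0 < (vs ! i) f)"
  have ex: "\<exists>f. Q i f" if i: "i < length vs" for i
  proof -
    have *: "place (vs ! i)" "place v0" "vs ! i \<noteq> v0" using vs i nth_mem[OF i] by auto
    obtain f where f: "f \<noteq> 0" "0 < (vs ! i) f" "\<And>w. place w \<Longrightarrow> w \<noteq> vs ! i \<Longrightarrow> w \<noteq> v0 \<Longrightarrow> w f = 0"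
      using unit_two_places[OF *] by metis
    have "(vs ! l) f = 0" if "l < i" for l
    proof (rule f(3))
      show "place (vs ! l)" "vs ! l \<noteq> vs ! i" "vs ! l \<noteq> v0"
        using that i vs nth_mem[of l vs] by (auto simp: nth_eq_iff_index_eq)
    qed
    then have "Q i f" unfolding Q_def using f nth_mem[OF i] by auto
    then show ?thesis by blast
  qed
  define f where "f = (\<lambda>i. arg_min (\<lambda>f. nat ((vs ! i) f)) (Q i))"
  have f: "Q i (f i)" "\<And>g. Q i g \<Longrightarrow> nat ((vs ! i) (f i)) \<le> nat ((vs ! i) g)" if "i < length vs" for i
    using arg_min_nat_lemma[of "Q i" _ "\<lambda>f. nat ((vs ! i) f)"] ex[OF that] unfolding f_def by blast+
  have prod_val: "w (\<Prod>i\<in>I. f i ^ n i) = (\<Sum>i\<in>I. int (n i) * w (f i))" if "place w" "I \<subseteq> {..<length vs}" for w n I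
  proof -
    have "finite I" using that finite_subset by blast
    then show ?thesis using that(2)
    proof (induction I rule: finite_induct)
      case (insert i I)
      have "f j \<noteq> 0" if "j \<in> insert i I" for j using f(1)[of j] insert.prems that by (auto simp: Q_def)
      then show ?case using insert val_mult[OF that(1), of "f i ^ n i" "\<Prod>i\<in>I. f i ^ n i"]
        by (simp add: val_power[OF that(1)])
    qed (simp add: val_1[OF that(1)])
  qed
  show thesis
  proof (rule that[of f])
    fix n g i assume n: "\<And>i. n i < p" and eq: "(\<Prod>i<length vs. f i ^ n i) = g ^ p" and i: "i < length vs"
    have "g ^ p \<noteq> 0" using f(1) unfolding eq[symmetric] by (auto simp: Q_def)
    then have g0: "g \<noteq> 0" using p_pos by (cases "g = 0") (auto simp: power_0_left)
    have vg: "int p * w g = (\<Sum>i<length vs. int (n i) * w (f i))" if "place w" for w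
      using prod_val[OF that, of "{..<length vs}" n] eq val_power[OF that, of g p] by simp
    show "n i = 0" using i
    proof (induction i rule: less_induct)
      case (less i)
      \<comment> \<open>At \<open>vs ! l\<close> only the \<open>i\<close>-th factor counts:
        exponents before \<open>i\<close> are already \<open>0\<close>, and units after
        \<open>i\<close> have value \<open>0\<close> there.\<close>
      have at: "int p * (vs ! l) g = int (n i) * (vs ! l) (f i)" if l: "l \<le> i" for l
      proof -
        have pl: "place (vs ! l)" using vs nth_mem[of l vs] l less.prems by auto
        have "int (n j) * (vs ! l) (f j) = 0" if "j \<in> {..<length vs} - {i}" for j
        proof (cases "j < i")
          case False
          then have "l < j" using that l by auto
          then show ?thesis using f(1)[of j] that by (auto simp: Q_def)
        qed (use less.IH[of j] that in auto)
        then have "(\<Sum>j\<in>{..<length vs} - {i}. int (n j) * (vs ! l) (f j)) = 0" by (intro sum.neutral ballI)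
        then show ?thesis unfolding vg[OF pl] using less.prems by (simp add: sum.remove[of _ i])
      qed
      show ?case
      proof (rule ccontr)
        assume ni: "n i \<noteq> 0"
        note fi = f(1)[OF less.prems]
        have fpos: "0 < (vs ! i) (f i)" using fi by (simp add: Q_def)
        then have "0 < int p * (vs ! i) g" using at[of i] ni by simp
        then have gpos: "0 < (vs ! i) g" using p_pos by (simp add: zero_less_mult_iff)
        \<comment> \<open>\<open>g\<close> competes with \<open>f i\<close>, and
          \<open>p * (vs ! i) g = n i * (vs ! i) (f i)\<close> with \<open>n i < p\<close> would
          make it a better candidate.\<close>
        have "Q i g" unfolding Q_def
        proof (intro conjI allI impI)
          fix w assume w: "place w" "w \<notin> set (v0 # vs)"
          then have "int p * w g = 0" unfolding vg[OF w(1)] using f(1) by (intro sum.neutral) (auto simp: Q_def)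
          then show "w g = 0" using p_pos by simp
        next
          fix l assume "l < i"
          then show "(vs ! l) g = 0" using at[of l] fi p_pos by (simp add: Q_def)
        qed (use g0 gpos in auto)
        then have "(vs ! i) (f i) \<le> (vs ! i) g" using f(2)[OF less.prems \<open>Q i g\<close>] gpos by simp
        then have "int p * (vs ! i) (f i) \<le> int p * (vs ! i) g" by (intro mult_left_mono) auto
        also have "\<dots> = int (n i) * (vs ! i) (f i)" using at[of i] by simp
        also have "\<dots> < int p * (vs ! i) (f i)" using n[of i] fpos by (intro mult_strict_right_mono) auto
        finally show False by simp
      qed
    qed
  qed (use f(1) in \<open>auto simp: Q_def\<close>)
qed

section \<open>The extension of the field over its p-th powers\<close>

lemma zero_pow_p [simp]: "(0 :: 'f) ^ p = 0"
  using p_pos(1) by simp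

text \<open>\<open>y\<close> alone is a \<open>p\<close>-basis of \<open>F\<close>: independence of
  these powers over \<open>F ^ p\<close> suffices, as they then span by \<open>p_span\<close>. Such
  a \<open>y\<close> serves as coordinate for derivations and forms.\<close>

definition p_indep :: "'f \<Rightarrow> bool" where
  "p_indep y \<longleftrightarrow> (\<forall>a. (\<Sum>i<p. a i ^ p * y ^ i) = 0 \<longrightarrow> (\<forall>i<p. a i = 0))"

lemma p_indepD: "p_indep y \<Longrightarrow> (\<Sum>i<p. a i ^ p * y ^ i) = 0 \<Longrightarrow> i < p \<Longrightarrow> a i = 0"
  by (simp add: p_indep_def)

lemma const_eq_p_power: "\<exists>b. \<iota> a = \<iota> b ^ p"
  using const_p_power[of 1 a] by (metis emb_power power_one_right)

lemma peval_p_split: "\<exists>s. peval x r = (\<Sum>i<p. peval x (s i) ^ p * x ^ i)"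
proof (induction r)
  case 0
  show ?case by (rule exI[of _ "\<lambda>_. 0"]) (use p_pos in simp)
next
  case (pCons a r)
  then obtain s where s: "peval x r = (\<Sum>i<p. peval x (s i) ^ p * x ^ i)" by blast
  obtain a' where a': "\<iota> a = \<iota> a' ^ p" using const_eq_p_power by blast
  obtain p' where p': "p = Suc p'" using p_pos by (cases p) auto
  have lp: "{..<p} = {..<Suc p'}" by (simp add: p')
  define s' where "s' = (\<lambda>i. case i of 0 \<Rightarrow> pCons a' (s p') | Suc i \<Rightarrow> s i)"
  have "(\<Sum>i<p. peval x (s' i) ^ p * x ^ i) = peval x (s' 0) ^ p + (\<Sum>i<p'. peval x (s i) ^ p * x ^ Suc i)"
    unfolding lp sum.lessThan_Suc_shift by (simp add: s'_def del: peval_simps)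
  also have "peval x (s' 0) ^ p = \<iota> a + x ^ p * peval x (s p') ^ p"
    by (simp add: s'_def a' add_p power_mult_distrib)
  also have "\<iota> a + x ^ p * peval x (s p') ^ p + (\<Sum>i<p'. peval x (s i) ^ p * x ^ Suc i)
      = \<iota> a + x * (\<Sum>i<Suc p'. peval x (s i) ^ p * x ^ i)"
    by (simp add: distrib_left sum_distrib_left p' mult_ac)
  also have "\<dots> = peval x (pCons a r)" by (simp only: s peval_simps p'[symmetric])
  finally show ?case by (intro exI[of _ s']) simp
qed

text \<open>Dimensions are compared over the fraction field of the \<open>peval x r ^ p\<close>. It
  takes \<open>p * card B\<close> elements \<open>x ^ i * b\<close> to span \<open>F\<close>, so the
  \<open>(p + 1) * card B\<close> products of \<open>1, ..., y ^ (p - 1), z\<close> with the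
  \<open>b ^ p\<close> are dependent; collecting terms gives a relation whose coefficients are
  \<open>p\<close>-th powers.\<close>

lemma p_span:
  assumes y: "p_indep y"
  shows "\<exists>a. z = (\<Sum>i<p. a i ^ p * y ^ i)"
proof -
  obtain x where x: "x \<notin> range \<iota>" using nonconst_exists by blast
  obtain B where B: "finite B" "lin_indep (peval x) B (\<lambda>b. b)" "\<And>f. in_frac_span (peval x) B (\<lambda>b. b) f"
    using function_field_basis[OF x] by metis
  have "B \<noteq> {}"
  proof
    assume "B = {}"
    then obtain g where "g \<noteq> 0" "peval x g * 1 = 0" using B(3)[of 1] unfolding in_frac_span_def by auto
    then show False using peval_eq_0_iff[OF x] by simp
  qed
  then have N: "0 < card B" using B(1) by (simp add: card_gt_0_iff)
  define e where "e = (\<lambda>r. peval x r ^ p)"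
  have e: "domain_embedding e"
    unfolding domain_embedding_def e_def using peval_eq_0_iff[OF x] p_pos by (simp add: add_p power_mult_distrib)
  define J where "J = {..<p} \<times> B"
  have J: "finite J" "card J = p * card B" using B by (simp_all add: J_def)
  define c where "c = (\<lambda>(i, b). x ^ i * b)"
  have sp: "in_frac_span e J c f" for f
  proof -
    obtain g a where ga: "g \<noteq> 0" "peval x g * f = (\<Sum>b\<in>B. peval x (a b) * b)"
      using B(3)[of f] unfolding in_frac_span_def by metis
    have "\<forall>b. \<exists>s. peval x (g ^ (p - 1) * a b) = (\<Sum>i<p. peval x (s i) ^ p * x ^ i)"
      using peval_p_split by blast
    then obtain s where s: "\<And>b. peval x (g ^ (p - 1) * a b) = (\<Sum>i<p. peval x (s b i) ^ p * x ^ i)" by metis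
    \<comment> \<open>The denominator \<open>g\<close> is raised to its \<open>p\<close>-th power in
      order to become a scalar for \<open>e\<close>.\<close>
    have "e g * f = peval x g ^ (p - 1) * (peval x g * f)"
      using p_pos by (simp add: e_def power_eq_if mult_ac)
    also have "\<dots> = (\<Sum>b\<in>B. peval x (g ^ (p - 1) * a b) * b)"
      unfolding ga(2) by (simp add: sum_distrib_left mult_ac)
    also have "\<dots> = (\<Sum>b\<in>B. \<Sum>i<p. e (s b i) * (x ^ i * b))"
      unfolding s by (simp add: sum_distrib_left sum_distrib_right e_def mult_ac)
    also have "\<dots> = (\<Sum>i<p. \<Sum>b\<in>B. e (s b i) * (x ^ i * b))" by (rule sum.swap)
    also have "\<dots> = (\<Sum>j\<in>J. e (s (snd j) (fst j)) * c j)" by (simp add: J_def c_def sum.cartesian_product')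
    finally show ?thesis by (rule in_frac_spanI[OF ga(1)])
  qed
  define w where "w = (\<lambda>i. if i < p then y ^ i else z)"
  define u where "u = (\<lambda>(i, b). w i * b ^ p)"
  have "\<not> lin_indep e ({..p} \<times> B) u"
    using card_lin_indep_le[OF e J(1) _ sp, of "{..p} \<times> B" u] J(2) N B(1) by auto
  then obtain r where r: "(\<Sum>j\<in>{..p} \<times> B. e (r j) * u j) = 0" "\<exists>j\<in>{..p} \<times> B. r j \<noteq> 0"
    unfolding lin_indep_def by blast
  define A where "A = (\<lambda>i. \<Sum>b\<in>B. peval x (r (i, b)) * b)"
  have "(\<Sum>j\<in>{..p} \<times> B. e (r j) * u j) = (\<Sum>i\<le>p. A i ^ p * w i)"
    by (simp add: sum.cartesian_product' A_def sum_p e_def u_def power_mult_distrib sum_distrib_left sum_distrib_right mult_ac)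
  then have rel: "(\<Sum>i<p. A i ^ p * y ^ i) + A p ^ p * z = 0"
    using r(1) by (simp add: lessThan_Suc_atMost[symmetric] w_def)
  have A0: "A p \<noteq> 0"
  proof
    assume 0: "A p = 0"
    then have "(\<Sum>i<p. A i ^ p * y ^ i) = 0" using rel p_pos by simp
    then have Ai: "A i = 0" if "i \<le> p" for i using p_indepD[OF y, of A i] 0 that by (cases "i = p") auto
    have "r (i, b) = 0" if "i \<le> p" "b \<in> B" for i b
      using lin_indepD[OF B(2), of "\<lambda>b. r (i, b)" b] Ai[OF that(1)] that(2) by (simp add: A_def)
    then show False using r(2) by auto
  qed
  have "z = (\<Sum>i<p. (- (A i / A p)) ^ p * y ^ i)"
  proof -
    have "A p ^ p * z = - (\<Sum>i<p. A i ^ p * y ^ i)" using rel by (simp add: add_eq_0_iff2 add.commute)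
    then have "z = - (\<Sum>i<p. A i ^ p * y ^ i) / A p ^ p" using A0 by (simp add: field_simps)
    also have "\<dots> = (\<Sum>i<p. (- (A i / A p)) ^ p * y ^ i)"
      by (simp add: minus_p power_divide sum_divide_distrib sum_negf)
    finally show ?thesis .
  qed
  then show ?thesis by (rule exI[of _ "\<lambda>i. - (A i / A p)"])
qed

lemma val_nonzero: "place v \<Longrightarrow> v f \<noteq> 0 \<Longrightarrow> f \<noteq> 0"
  using val_0 by metis

text \<open>The value of a nonzero term is congruent to its index modulo \<open>p\<close>. So the
  values are distinct, nothing cancels, and the value of the sum is the least value of a
  term.\<close>

lemma vge_p_sum:
  assumes v: "place v" and t: "v t = 1" and s: "vge v n (\<Sum>i<p. a i ^ p * t ^ i)" and i: "i < p"
  shows "vge v n (a i ^ p * t ^ i)"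
proof (rule ccontr)
  assume no: "\<not> ?thesis"
  have t0: "t \<noteq> 0" using t by (intro val_nonzero[OF v]) simp
  define w where "w = (\<lambda>i. a i ^ p * t ^ i)"
  have vw: "v (w j) = int p * v (a j) + int j" if "w j \<noteq> 0" for j
    using that t t0 by (simp add: w_def val_mult[OF v] val_power[OF v])
  define K where "K = {j. j < p \<and> w j \<noteq> 0}"
  have K: "finite K" "i \<in> K" using no i t0 by (auto simp: K_def w_def)
  obtain m where m: "m \<in> K" "\<And>j. j \<in> K \<Longrightarrow> v (w m) \<le> v (w j)"
    using ex_is_arg_min_if_finite[OF K(1), of "\<lambda>j. v (w j)"] K(2)
    unfolding is_arg_min_linorder by auto
  have "v (w m) + 1 \<le> v (w j)" if j: "j \<in> K" "j \<noteq> m" for j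
  proof -
    have "v (w m) \<noteq> v (w j)"
    proof
      assume eq: "v (w m) = v (w j)"
      have "int p * v (a m) + int m = int p * v (a j) + int j" using vw m(1) j(1) eq by (simp add: K_def)
      then have "(int p * v (a m) + int m) mod int p = (int p * v (a j) + int j) mod int p" by simp
      then have "m = j" using m(1) j(1) by (simp add: K_def)
      with j show False by simp
    qed
    then show ?thesis using m(2)[OF j(1)] by simp
  qed
  then have "vge v (v (w m) + 1) (\<Sum>j\<in>{..<p} - {m}. w j)"
    by (intro vge_sum[OF v]) (auto simp: vge_def K_def)
  moreover have "(\<Sum>j<p. w j) = w m + (\<Sum>j\<in>{..<p} - {m}. w j)"
    using m(1) by (simp add: K_def sum.remove)
  moreover have "w m \<noteq> 0" using m(1) by (simp add: K_def)
  ultimately have "(\<Sum>j<p. w j) \<noteq> 0" "v (\<Sum>j<p. w j) = v (w m)" using val_dominant[OF v] by metis+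
  then have "n \<le> v (w m)" using s by (simp add: vge_def w_def)
  then have "n \<le> v (w i)" using m(2)[OF K(2)] by simp
  then have "vge v n (w i)" by (simp add: vge_def)
  then show False using no unfolding w_def by blast
qed

lemma p_indep_local_parameter:
  assumes v: "place v" and t: "v t = 1"
  shows "p_indep t"
  unfolding p_indep_def
proof (intro allI impI)
  fix a i assume a: "(\<Sum>i<p. a i ^ p * t ^ i) = 0" and i: "i < p"
  have t0: "t \<noteq> 0" using t by (intro val_nonzero[OF v]) simp
  have "vge v n (a i ^ p * t ^ i)" for n using vge_p_sum[OF v t, of n a] a i by simp
  from this[of "v (a i ^ p * t ^ i) + 1"] have "a i ^ p * t ^ i = 0" by (simp add: vge_def)
  then show "a i = 0" using t0 by simp
qed

section \<open>Derivations\<close>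

definition pcoef :: "'f \<Rightarrow> 'f \<Rightarrow> nat \<Rightarrow> 'f" where
  "pcoef y f = (SOME a. f = (\<Sum>i<p. a i ^ p * y ^ i))"

text \<open>Differentiation with respect to \<open>y\<close>; the coefficients are
  \<open>p\<close>-th powers and count as constants. At \<open>i = 0\<close>, where
  \<open>i - 1\<close> is \<open>0\<close>, the factor \<open>of_nat i\<close> removes the
  term.\<close>

definition pder :: "'f \<Rightarrow> 'f \<Rightarrow> 'f" where
  "pder y f = (\<Sum>i<p. of_nat i * pcoef y f i ^ p * y ^ (i - 1))"

lemma of_nat_p_power: "(of_nat n :: 'f) ^ p = of_nat n"
  by (induction n) (use p_pos in \<open>auto simp: add_p\<close>)

context
  fixes y assumes y: "p_indep y"
begin

lemma pcoef: "f = (\<Sum>i<p. pcoef y f i ^ p * y ^ i)"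
  unfolding pcoef_def by (rule someI_ex[OF p_span[OF y]])

lemma pcoef_unique:
  assumes "f = (\<Sum>i<p. a i ^ p * y ^ i)" "i < p"
  shows "pcoef y f i = a i"
proof -
  have "(\<Sum>i<p. (pcoef y f i - a i) ^ p * y ^ i) = (\<Sum>i<p. pcoef y f i ^ p * y ^ i) - (\<Sum>i<p. a i ^ p * y ^ i)"
    by (simp add: diff_p left_diff_distrib sum_subtractf)
  also have "\<dots> = 0" using assms(1) pcoef[of f] by simp
  finally show ?thesis using p_indepD[OF y, of "\<lambda>i. pcoef y f i - a i" i] assms(2) by simp
qed

lemma pcoef_add: "i < p \<Longrightarrow> pcoef y (f + g) i = pcoef y f i + pcoef y g i"
proof (rule pcoef_unique)
  have "f + g = (\<Sum>i<p. pcoef y f i ^ p * y ^ i) + (\<Sum>i<p. pcoef y g i ^ p * y ^ i)"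
    using pcoef[of f] pcoef[of g] by simp
  then show "f + g = (\<Sum>i<p. (pcoef y f i + pcoef y g i) ^ p * y ^ i)"
    by (simp add: add_p distrib_right sum.distrib)
qed

lemma pcoef_scale: "i < p \<Longrightarrow> pcoef y (a ^ p * f) i = a * pcoef y f i"
proof (rule pcoef_unique)
  have "a ^ p * f = a ^ p * (\<Sum>i<p. pcoef y f i ^ p * y ^ i)" using pcoef[of f] by simp
  then show "a ^ p * f = (\<Sum>i<p. (a * pcoef y f i) ^ p * y ^ i)"
    by (simp add: power_mult_distrib sum_distrib_left mult.assoc)
qed

lemma pcoef_power: "i < p \<Longrightarrow> pcoef y (y ^ n) i = (if i = n mod p then y ^ (n div p) else 0)"
proof (rule pcoef_unique)
  have "(\<Sum>i<p. (if i = n mod p then y ^ (n div p) else 0) ^ p * y ^ i)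
      = (\<Sum>i<p. if i = n mod p then (y ^ (n div p)) ^ p * y ^ i else 0)"
    using p_pos by (intro sum.cong) auto
  also have "\<dots> = y ^ n" using p_pos by (simp flip: power_mult power_add)
  finally show "y ^ n = (\<Sum>i<p. (if i = n mod p then y ^ (n div p) else 0) ^ p * y ^ i)" by simp
qed

lemma pder_add: "pder y (f + g) = pder y f + pder y g"
  unfolding pder_def sum.distrib[symmetric]
  by (rule sum.cong) (simp_all add: pcoef_add add_p algebra_simps)

lemma pder_scale: "pder y (a ^ p * f) = a ^ p * pder y f"
  unfolding pder_def sum_distrib_left
proof (rule sum.cong)
  fix i assume "i \<in> {..<p}"
  then have "pcoef y (a ^ p * f) i = a * pcoef y f i" by (simp add: pcoef_scale)
  then show "of_nat i * pcoef y (a ^ p * f) i ^ p * y ^ (i - 1) = a ^ p * (of_nat i * pcoef y f i ^ p * y ^ (i - 1))"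
    by (simp only: power_mult_distrib mult_ac)
qed simp

lemma pder_0: "pder y 0 = 0"
  using pder_add[of 0 0] by (simp only: add_0_right add_cancel_right_right)

lemma pder_sum: "pder y (\<Sum>i\<in>I. f i) = (\<Sum>i\<in>I. pder y (f i))"
  by (induction I rule: infinite_finite_induct) (auto simp: pder_0 pder_add)

lemma pder_self_power: "pder y (y ^ n) = of_nat n * y ^ (n - 1)"
proof -
  have "pder y (y ^ n) = (\<Sum>i<p. if i = n mod p then of_nat i * (y ^ (n div p)) ^ p * y ^ (i - 1) else 0)"
    unfolding pder_def using p_pos by (intro sum.cong) (auto simp: pcoef_power)
  also have "\<dots> = of_nat (n mod p) * (y ^ (n div p)) ^ p * y ^ (n mod p - 1)" using p_pos by simp
  also have "\<dots> = of_nat (n mod p) * y ^ (n - 1)"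
  proof (cases "n mod p = 0")
    case False
    then have "n div p * p + (n mod p - 1) = n - 1" by (metis Nat.add_diff_assoc One_nat_def Suc_leI bot_nat_0.not_eq_extremum div_mult_mod_eq)
    then show ?thesis by (simp only: mult.assoc power_mult[symmetric] power_add[symmetric])
  qed simp
  also have "of_nat (n mod p) = (of_nat n :: 'f)"
  proof -
    have "(of_nat n :: 'f) = of_nat (n div p * p + n mod p)" by simp
    then show ?thesis by (simp only: of_nat_add of_nat_mult of_nat_p) simp
  qed
  finally show ?thesis .
qed

text \<open>Both sides are additive and linear over \<open>F ^ p\<close> in each argument, so powers
  of \<open>y\<close> suffice; there \<open>pder_self_power\<close> covers exponents beyond
  \<open>p\<close> as well.\<close>

lemma pder_mult: "pder y (f * g) = f * pder y g + g * pder y f"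
proof -
  have self: "pder y (y ^ (i + j)) = y ^ i * pder y (y ^ j) + y ^ j * pder y (y ^ i)" for i j
    unfolding pder_self_power by (cases i; cases j) (auto simp: algebra_simps power_add)
  have expand: "pder y h = (\<Sum>i<p. pcoef y h i ^ p * pder y (y ^ i))" for h
    by (subst pcoef[of h]) (simp add: pder_sum pder_scale)
  define a b where "a = pcoef y f" and "b = pcoef y g"
  have f: "f = (\<Sum>i<p. a i ^ p * y ^ i)" and g: "g = (\<Sum>i<p. b i ^ p * y ^ i)"
    using pcoef[of f] pcoef[of g] by (simp_all add: a_def b_def)
  have "f * g = (\<Sum>i<p. \<Sum>j<p. (a i * b j) ^ p * y ^ (i + j))"
    unfolding f g sum_product by (simp add: power_mult_distrib power_add mult_ac)
  then have "pder y (f * g) = (\<Sum>i<p. \<Sum>j<p. (a i * b j) ^ p * (y ^ i * pder y (y ^ j) + y ^ j * pder y (y ^ i)))"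
    by (simp add: pder_sum pder_scale self)
  also have "\<dots> = (\<Sum>i<p. \<Sum>j<p. (a i ^ p * y ^ i) * (b j ^ p * pder y (y ^ j)))
      + (\<Sum>i<p. \<Sum>j<p. (a i ^ p * pder y (y ^ i)) * (b j ^ p * y ^ j))"
    by (simp add: power_mult_distrib algebra_simps sum.distrib)
  also have "\<dots> = (\<Sum>i<p. a i ^ p * y ^ i) * (\<Sum>j<p. b j ^ p * pder y (y ^ j))
      + (\<Sum>i<p. a i ^ p * pder y (y ^ i)) * (\<Sum>j<p. b j ^ p * y ^ j)"
    by (simp only: sum_product)
  also have "\<dots> = f * pder y g + pder y f * g"
    by (simp only: f[symmetric] g[symmetric] expand[of f, folded a_def] expand[of g, folded b_def])
  finally show ?thesis by (simp add: mult.commute)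
qed

lemma pder_1: "pder y 1 = 0"
  using pder_self_power[of 0] by simp

lemma pder_self: "pder y y = 1"
  using pder_self_power[of 1] by simp

lemma pder_p_power: "pder y (a ^ p) = 0"
  using pder_scale[of a 1] pder_1 by simp

lemma pder_const: "pder y (\<iota> a) = 0"
  using const_eq_p_power[of a] pder_p_power by metis

lemma pder_power: "pder y (f ^ n) = of_nat n * f ^ (n - 1) * pder y f"
proof (induction n)
  case (Suc n)
  then show ?case by (cases n) (auto simp: pder_mult algebra_simps)
qed (simp add: pder_1)

lemma pder_minus: "pder y (- f) = - pder y f"
  using pder_add[of f "- f"] pder_0 by (simp add: eq_neg_iff_add_eq_0 add.commute)

lemma pder_inverse: "pder y (inverse f) = - pder y f / f ^ 2"
proof (cases "f = 0")
  case False
  then have "f * pder y (inverse f) + inverse f * pder y f = 0"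
    using pder_mult[of f "inverse f"] pder_1 by simp
  then show ?thesis using False by (simp add: field_simps power2_eq_square add_eq_0_iff)
qed (simp add: pder_0)

lemma pder_eq_0_imp_p_power:
  assumes "pder y f = 0"
  shows "\<exists>a. f = a ^ p"
proof -
  obtain p' where p': "p = Suc p'" using p_pos by (cases p) auto
  have lp: "{..<p} = {..<Suc p'}" by (simp add: p')
  define a where "a = (\<lambda>i. if i < p' then of_nat (Suc i) * pcoef y f (Suc i) else 0)"
  have "pder y f = (\<Sum>i<p'. of_nat (Suc i) * pcoef y f (Suc i) ^ p * y ^ i)"
    unfolding pder_def lp sum.lessThan_Suc_shift by (simp del: of_nat_Suc)
  also have "\<dots> = (\<Sum>i<p'. a i ^ p * y ^ i)"
    by (intro sum.cong) (auto simp: a_def power_mult_distrib of_nat_p_power simp del: of_nat_Suc)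
  also have "\<dots> = (\<Sum>i<p. a i ^ p * y ^ i)" unfolding lp by (simp add: a_def)
  finally have "(\<Sum>i<p. a i ^ p * y ^ i) = 0" using assms by simp
  then have a0: "a i = 0" if "i < p" for i using p_indepD[OF y] that by blast
  have c0: "pcoef y f (Suc i) = 0" if "i < p'" for i
    using a0[of i] that of_nat_neq_0[of "Suc i"] by (simp add: a_def p' del: of_nat_Suc)
  have "f = (\<Sum>i<Suc p'. pcoef y f i ^ p * y ^ i)" using pcoef[of f] unfolding lp .
  also have "\<dots> = pcoef y f 0 ^ p" unfolding sum.lessThan_Suc_shift using c0 by simp
  finally show ?thesis by blast
qed

text \<open>Differentiating a relation multiplies its coefficients by their indices, which are
  invertible apart from \<open>0\<close>, and shortens it. By induction only the coefficient of
  \<open>x ^ 0\<close> could remain.\<close>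

lemma p_indep_if_pder:
  assumes x: "pder y x \<noteq> 0"
  shows "p_indep x"
proof -
  have "\<forall>i<n. a i = 0" if "n \<le> p" "(\<Sum>i<n. a i ^ p * x ^ i) = 0" for n a
    using that
  proof (induction n arbitrary: a)
    case (Suc n)
    have "0 = pder y (\<Sum>i<Suc n. a i ^ p * x ^ i)" by (simp only: Suc.prems pder_0)
    also have "\<dots> = (\<Sum>i<Suc n. a i ^ p * (of_nat i * x ^ (i - 1) * pder y x))"
      by (simp only: pder_sum pder_scale pder_power)
    also have "\<dots> = (\<Sum>i<n. a (Suc i) ^ p * (of_nat (Suc i) * x ^ i * pder y x))"
      unfolding sum.lessThan_Suc_shift by (simp del: of_nat_Suc)
    also have "\<dots> = pder y x * (\<Sum>i<n. (of_nat (Suc i) * a (Suc i)) ^ p * x ^ i)"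
      by (simp add: sum_distrib_left power_mult_distrib of_nat_p_power mult_ac del: of_nat_Suc)
    finally have "(\<Sum>i<n. (of_nat (Suc i) * a (Suc i)) ^ p * x ^ i) = 0" using x by simp
    then have "\<forall>i<n. of_nat (Suc i) * a (Suc i) = 0" using Suc.IH[of "\<lambda>i. of_nat (Suc i) * a (Suc i)"] Suc.prems(1) by simp
    then have *: "of_nat (Suc i) * a (Suc i) = 0" if "i < n" for i using that by blast
    have s: "a (Suc i) = 0" if "i < n" for i
    proof -
      have "of_nat (Suc i) \<noteq> (0 :: 'f)" using that Suc.prems(1) by (intro of_nat_neq_0) auto
      then show ?thesis using *[OF that] by (simp only: mult_eq_0_iff simp_thms)
    qed
    moreover have "a 0 = 0" using Suc.prems(2) s unfolding sum.lessThan_Suc_shift by simp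
    ultimately show ?case by (metis less_Suc_eq_0_disj)
  qed simp
  then show ?thesis unfolding p_indep_def by blast
qed

lemma pder_chain:
  assumes x: "p_indep x"
  shows "pder y f = pder x f * pder y x"
proof -
  define a where "a = pcoef x f"
  have "f = (\<Sum>i<p. a i ^ p * x ^ i)"
    unfolding a_def pcoef_def by (rule someI_ex[OF p_span[OF x]])
  then have "pder y f = pder y (\<Sum>i<p. a i ^ p * x ^ i)" by simp
  also have "\<dots> = (\<Sum>i<p. a i ^ p * (of_nat i * x ^ (i - 1) * pder y x))"
    by (simp only: pder_sum pder_scale pder_power)
  also have "\<dots> = pder x f * pder y x"
    unfolding pder_def[of x] a_def by (simp add: sum_distrib_left sum_distrib_right mult_ac)
  finally show ?thesis .
qed

end

lemma pder_p_indep_iff: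
  assumes y: "p_indep y"
  shows "p_indep x \<longleftrightarrow> pder y x \<noteq> 0"
proof
  assume x: "p_indep x"
  then show "pder y x \<noteq> 0" using pder_chain[OF y x, of y] pder_self[OF y] by auto
qed (rule p_indep_if_pder[OF y])

text \<open>Without cancellation in the expansion, every term is integral; as \<open>i < p\<close>,
  so is every coefficient \<open>pcoef t f i\<close>.\<close>

lemma vge_pder_local:
  assumes v: "place v" and t: "v t = 1" and f: "vge v 0 f"
  shows "vge v 0 (pder t f)"
proof -
  have pt: "p_indep t" by (rule p_indep_local_parameter[OF v t])
  have t0: "t \<noteq> 0" using t by (intro val_nonzero[OF v]) simp
  have vt: "vge v 0 t" using t by (simp add: vge_def)
  have c: "vge v 0 (pcoef t f i)" if i: "i < p" for i
  proof -
    have s: "vge v 0 (\<Sum>i<p. pcoef t f i ^ p * t ^ i)" using f pcoef[OF pt, of f] by simp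
    have "vge v 0 (pcoef t f i ^ p * t ^ i)" by (rule vge_p_sum[OF v t s i])
    then have "0 \<le> int p * v (pcoef t f i) + int i" if "pcoef t f i \<noteq> 0"
      using that t0 t by (auto simp: vge_def val_mult[OF v] val_power[OF v])
    moreover have "int p * v (pcoef t f i) \<le> int p * (- 1)" if "v (pcoef t f i) < 0"
      using that by (intro mult_left_mono) auto
    ultimately show ?thesis using i unfolding vge_def by fastforce
  qed
  have "vge v 0 (of_nat i * pcoef t f i ^ p * t ^ (i - 1))" if "i < p" for i
    using vge_const[OF v, of "of_nat i"] c[OF that] vt by (intro vge_mult0[OF v] vge_power[OF v]) auto
  then show ?thesis unfolding pder_def by (intro vge_sum[OF v]) auto
qed

section \<open>The Cartier operator on functions\<close>

text \<open>The Cartier operator in the coordinate \<open>y\<close>: it takes \<open>f dy\<close> to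
  \<open>Cop y f dy\<close>.\<close>

definition Cop :: "'f \<Rightarrow> 'f \<Rightarrow> 'f" where
  "Cop y f = pcoef y f (p - 1)"

context
  fixes y assumes y: "p_indep y"
begin

lemma Cop_add: "Cop y (f + g) = Cop y f + Cop y g"
  unfolding Cop_def using p_pos by (simp add: pcoef_add[OF y])

lemma Cop_scale: "Cop y (a ^ p * f) = a * Cop y f"
  unfolding Cop_def using p_pos by (simp add: pcoef_scale[OF y])

lemma Cop_0: "Cop y 0 = 0"
  using Cop_add[of 0 0] by (simp only: add_0_right add_cancel_right_right)

lemma Cop_sum: "Cop y (\<Sum>i\<in>I. f i) = (\<Sum>i\<in>I. Cop y (f i))"
  by (induction I rule: infinite_finite_induct) (auto simp: Cop_0 Cop_add)

text \<open>Exact forms are killed: differentiating \<open>y ^ i\<close> with \<open>i < p\<close>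
  never produces the exponent \<open>p - 1\<close>.\<close>

lemma Cop_pder: "Cop y (pder y f) = 0"
proof -
  obtain p' where p': "p = Suc p'" using p_pos by (cases p) auto
  have "Cop y (of_nat i * y ^ (i - 1)) = 0" if i: "i < p" for i
  proof (cases i)
    case (Suc j)
    have "Cop y (of_nat i ^ p * y ^ j) = of_nat i * Cop y (y ^ j)" by (rule Cop_scale)
    moreover have "Cop y (y ^ j) = 0" unfolding Cop_def using i Suc p_pos by (simp add: pcoef_power[OF y])
    ultimately have "Cop y (of_nat i * y ^ j) = 0" unfolding of_nat_p_power by simp
    then show ?thesis by (simp add: Suc)
  qed (simp add: Cop_0)
  moreover have "pder y f = (\<Sum>i<p. pcoef y f i ^ p * (of_nat i * y ^ (i - 1)))"
    unfolding pder_def by (simp add: mult_ac)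
  ultimately show ?thesis by (simp add: Cop_sum Cop_scale)
qed

lemma Cop_power_pder: "n < p - 1 \<Longrightarrow> Cop y (z ^ n * pder y z) = 0"
proof -
  assume n: "n < p - 1"
  have "pder y (z ^ Suc n) = of_nat (Suc n) * (z ^ n * pder y z)"
    by (simp only: pder_power[OF y] diff_Suc_1 mult.assoc)
  then have "0 = Cop y (of_nat (Suc n) ^ p * (z ^ n * pder y z))"
    using Cop_pder[of "z ^ Suc n"] by (simp add: of_nat_p_power del: of_nat_Suc)
  also have "\<dots> = of_nat (Suc n) * Cop y (z ^ n * pder y z)" by (rule Cop_scale)
  finally show ?thesis using of_nat_neq_0[of "Suc n"] n by (simp del: of_nat_Suc)
qed

text \<open>The set of all \<open>z\<close> with the asserted property contains \<open>y\<close> and the \<open>p\<close>-th powers; it is closed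
  under products and, because \<open>z ^ n * z'\<close> is exact for \<open>n < p - 1\<close>, under \<open>z \<mapsto> z + 1\<close>; hence it is
  a subfield.\<close>

lemma Cop_pder_self: "Cop y (z ^ (p - 1) * pder y z) = pder y z"
proof -
  define Z where "Z = {z. Cop y (z ^ (p - 1) * pder y z) = pder y z}"
  have pw: "z ^ p = z * z ^ (p - 1)" for z :: 'f using p_pos by (simp add: power_eq_if)
  have Z_mult: "a * b \<in> Z" if "a \<in> Z" "b \<in> Z" for a b
  proof -
    have "(a * b) ^ (p - 1) * pder y (a * b) = a ^ p * (b ^ (p - 1) * pder y b) + b ^ p * (a ^ (p - 1) * pder y a)"
      by (simp add: pder_mult[OF y] power_mult_distrib pw algebra_simps)
    then show ?thesis using that by (simp add: Z_def Cop_add Cop_scale pder_mult[OF y])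
  qed
  have Z_p: "a ^ p \<in> Z" for a by (simp add: Z_def pder_p_power[OF y] Cop_0)
  have Z_y: "y \<in> Z"
    unfolding Z_def using p_pos by (simp add: pder_self[OF y] Cop_def pcoef_power[OF y])
  have Z_1: "1 \<in> Z" using Z_p[of 1] by simp
  have Z_Suc: "z + 1 \<in> Z" if "z \<in> Z" for z
  proof -
    have "(z + 1) ^ (p - 1) * pder y (z + 1) = (\<Sum>n\<le>p - 1. of_nat ((p - 1) choose n) ^ p * (z ^ n * pder y z))"
      by (simp add: pder_add[OF y] pder_1[OF y] binomial_ring[of z 1] sum_distrib_left sum_distrib_right of_nat_p_power mult_ac)
    then have "Cop y ((z + 1) ^ (p - 1) * pder y (z + 1)) =
        (\<Sum>n\<le>p - 1. of_nat ((p - 1) choose n) * Cop y (z ^ n * pder y z))"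
      by (simp only: Cop_sum Cop_scale)
    also have "\<dots> = (\<Sum>n\<in>{p - 1}. of_nat ((p - 1) choose n) * Cop y (z ^ n * pder y z))"
      by (intro sum.mono_neutral_right) (auto simp: Cop_power_pder)
    also have "\<dots> = pder y (z + 1)" using that by (simp add: Z_def pder_add[OF y] pder_1[OF y])
    finally show ?thesis by (simp add: Z_def)
  qed
  have Z_inverse: "inverse a \<in> Z" if "a \<in> Z" "a \<noteq> 0" for a
  proof -
    have "inverse a = a ^ (p - 1) * inverse a ^ p" using that(2) by (simp add: pw field_simps)
    moreover have "a ^ n \<in> Z" for n by (induction n) (use that Z_1 Z_mult in auto)
    ultimately show ?thesis using Z_mult Z_p by metis
  qed
  have Z_add: "a + b \<in> Z" if "a \<in> Z" "b \<in> Z" for a b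
  proof (cases "b = 0")
    case False
    then have "a + b = b * (a * inverse b + 1)" by (simp add: field_simps)
    then show ?thesis using that False Z_mult Z_Suc Z_inverse by metis
  qed (use that in simp)
  have "y ^ n \<in> Z" for n by (induction n) (use Z_1 Z_mult Z_y in auto)
  then have t: "pcoef y z i ^ p * y ^ i \<in> Z" for i using Z_mult Z_p by blast
  have Z_0: "0 \<in> Z" using Z_p[of 0] p_pos by simp
  have "(\<Sum>i<n. pcoef y z i ^ p * y ^ i) \<in> Z" for n by (induction n) (use Z_0 Z_add t in auto)
  then have "z \<in> Z" using pcoef[OF y, of z] by metis
  then show ?thesis by (simp add: Z_def)
qed

text \<open>Terms of index below \<open>p - 1\<close> are exact and vanish; the top one is
  \<open>Cop_pder_self\<close>. As \<open>x\<close> is arbitrary, the Cartier operator is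
  independent of the coordinate.\<close>

lemma Cop_change: "Cop y ((\<Sum>i<p. f i ^ p * x ^ i) * pder y x) = f (p - 1) * pder y x"
proof -
  have "Cop y ((\<Sum>i<p. f i ^ p * x ^ i) * pder y x) = (\<Sum>i<p. f i * Cop y (x ^ i * pder y x))"
    by (simp add: sum_distrib_right mult.assoc Cop_sum Cop_scale)
  also have "\<dots> = (\<Sum>i\<in>{p - 1}. f i * Cop y (x ^ i * pder y x))"
    using p_pos by (intro sum.mono_neutral_right) (auto simp: Cop_power_pder)
  finally show ?thesis using Cop_pder_self[of x] by simp
qed

text \<open>\<open>df / f\<close> is \<open>f ^ (p - 1) df\<close> divided by the
  \<open>p\<close>-th power \<open>f ^ p\<close>, so \<open>Cop_pder_self\<close> applies.\<close>

lemma Cop_dlog: "Cop y (pder y f / f) = pder y f / f"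
proof (cases "f = 0")
  case False
  have pw: "f ^ p = f * f ^ (p - 1)" using p_pos by (simp add: power_eq_if)
  have eq: "pder y f / f = inverse f ^ p * (f ^ (p - 1) * pder y f)"
    unfolding power_inverse pw using False by (simp add: field_simps)
  have "Cop y (pder y f / f) = inverse f * pder y f"
    unfolding eq Cop_scale Cop_pder_self ..
  then show ?thesis by (simp add: divide_inverse mult.commute)
qed (simp add: Cop_0)

end

end

section \<open>Separating elements\<close>

text \<open>\<open>L\<close> is a subset rather than a type, so membership of the coefficients is
  carried through the long division.\<close>

lemma poly_division_subfield:
  fixes L :: "'f::field set"
  assumes L: "subring_of L" "\<And>a. a \<in> L \<Longrightarrow> inverse a \<in> L"
    and "\<And>i. coeff a i \<in> L" and b: "\<And>i. coeff b i \<in> L" "b \<noteq> 0"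
  shows "\<exists>q r. (\<forall>i. coeff q i \<in> L) \<and> (\<forall>i. coeff r i \<in> L) \<and> a = q * b + r \<and> (r = 0 \<or> degree r < degree b)"
  using assms(3)
proof (induction "if a = 0 then 0 else Suc (degree a)" arbitrary: a rule: less_induct)
  case less
  note LD = subring_ofD[OF L(1)]
  show ?case
  proof (cases "a = 0 \<or> degree a < degree b")
    case True
    then show ?thesis using less.prems LD(1) by (intro exI[of _ 0] exI[of _ a]) auto
  next
    case False
    define c where "c = monom (lead_coeff a * inverse (lead_coeff b)) (degree a - degree b)"
    have c: "coeff c i \<in> L" for i using less.prems b L LD by (auto simp: c_def coeff_monom)
    define a' where "a' = a - c * b"
    have a'L: "coeff a' i \<in> L" for i unfolding a'_def using less.prems c b by (auto simp: coeff_mult intro!: LD)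
    have "degree (c * b) \<le> degree a"
      using degree_mult_le[of c b] degree_monom_le[of "lead_coeff a * inverse (lead_coeff b)" "degree a - degree b"] False
      unfolding c_def by linarith
    then have "degree a' \<le> degree a" unfolding a'_def by (intro degree_diff_le) auto
    moreover have "coeff a' (degree a) = 0"
    proof -
      have "coeff (c * b) (degree a) = lead_coeff a * inverse (lead_coeff b) * coeff b (degree b)"
        using False coeff_monom_mult[of "lead_coeff a * inverse (lead_coeff b)" "degree a - degree b" b "degree a"]
        by (simp add: c_def)
      then show ?thesis using b(2) by (simp add: a'_def)
    qed
    ultimately have "a' = 0 \<or> degree a' < degree a" by (rule eq_zero_or_degree_less)
    then have "(if a' = 0 then 0 else Suc (degree a')) < (if a = 0 then 0 else Suc (degree a))"
      using False by auto
    then obtain q r where qr: "\<forall>i. coeff q i \<in> L" "\<forall>i. coeff r i \<in> L" "a' = q * b + r" "r = 0 \<or> degree r < degree b"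
      using less.hyps[OF _ a'L] by blast
    have "a = (c + q) * b + r" using qr(3) by (simp add: a'_def algebra_simps)
    moreover have "\<forall>i. coeff (c + q) i \<in> L" using c qr(1) LD(6) by simp
    ultimately show ?thesis using qr by blast
  qed
qed

text \<open>A nonzero combination \<open>g\<close> of \<open>r\<close> and \<open>s\<close> over
  \<open>L\<close> of least degree divides \<open>r\<close>. Its degree is too small for a zero at
  \<open>z\<close>, so the cofactor vanishes there and has full degree, and \<open>g\<close> is a
  unit. A common divisor over \<open>F\<close> divides \<open>g\<close> too.\<close>

lemma coprime_if_minimal:
  fixes L :: "'f::field set"
  assumes L: "subring_of L" "\<And>a. a \<in> L \<Longrightarrow> inverse a \<in> L"
    and r: "\<And>i. coeff r i \<in> L" "r \<noteq> 0" "poly r z = 0"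
    and min: "\<And>s. (\<And>i. coeff s i \<in> L) \<Longrightarrow> s \<noteq> 0 \<Longrightarrow> poly s z = 0 \<Longrightarrow> degree r \<le> degree s"
    and s: "\<And>i. coeff s i \<in> L" "s \<noteq> 0" "degree s < degree r"
  shows "coprime r s"
proof -
  note LD = subring_ofD[OF L(1)]
  define I where "I = {a * r + b * s | a b. (\<forall>i. coeff a i \<in> L) \<and> (\<forall>i. coeff b i \<in> L)}"
  have IL: "coeff g i \<in> L" if "g \<in> I" for g i
    using that r s unfolding I_def by (auto simp: coeff_mult intro!: LD)
  have "1 * s \<in> I"
    unfolding I_def using LD(1,2) by (intro CollectI exI[of _ 0] exI[of _ 1]) (auto simp: coeff_pCons split: nat.splits)
  then have "s \<in> I \<and> s \<noteq> 0" using s by simp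
  then obtain g where g: "g \<in> I" "g \<noteq> 0" and gmin: "\<And>h. h \<in> I \<Longrightarrow> h \<noteq> 0 \<Longrightarrow> degree g \<le> degree h"
    using ex_has_least_nat[of "\<lambda>h. h \<in> I \<and> h \<noteq> 0" s degree] by blast
  obtain a b where ab: "g = a * r + b * s" "\<forall>i. coeff a i \<in> L" "\<forall>i. coeff b i \<in> L" using g(1) unfolding I_def by blast
  obtain q \<rho> where q: "\<forall>i. coeff q i \<in> L" "r = q * g + \<rho>" "\<rho> = 0 \<or> degree \<rho> < degree g"
    using poly_division_subfield[OF L r(1) IL[OF g(1)] g(2)] by blast
  have "\<rho> = (1 - q * a) * r + (- (q * b)) * s" using q(2) ab(1) by (simp add: algebra_simps)
  moreover have "\<forall>i. coeff (1 - q * a) i \<in> L" "\<forall>i. coeff (- (q * b)) i \<in> L"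
    using q ab LD(1,2) by (auto simp: coeff_mult coeff_pCons intro!: LD(3,4,5,8) split: nat.splits)
  ultimately have "\<rho> \<in> I" unfolding I_def by blast
  then have "\<rho> = 0" using q(3) gmin[of \<rho>] by fastforce
  then have rqg: "r = q * g" using q(2) by simp
  have "degree g \<le> degree s" using gmin \<open>s \<in> I \<and> s \<noteq> 0\<close> by blast
  then have "poly g z \<noteq> 0" using min[OF IL[OF g(1)] g(2)] s(3) by auto
  then have "poly q z = 0" using r(3) rqg by simp
  moreover have "q \<noteq> 0" using rqg r(2) by auto
  ultimately have "degree r \<le> degree q" using min q(1) by blast
  moreover have "degree r = degree q + degree g" using rqg r(2) by (simp add: degree_mult_eq)
  ultimately have "degree g = 0" by simp
  then have "is_unit g" using g(2) by (simp add: is_unit_iff_degree)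
  moreover have "c dvd g" if "c dvd r" "c dvd s" for c using that by (simp add: ab(1))
  ultimately show ?thesis by (intro coprimeI) (meson dvd_unit_imp_unit)
qed

context function_field
begin

lemma simple_extension_peval:
  "simple_extension \<iota> x = {peval x r / peval x s | r s. peval x s \<noteq> 0}"
  unfolding simple_extension_def peval_def ..

context
  fixes t assumes t: "p_indep t"
begin

lemma p_indep_nonconst: "t \<notin> range \<iota>"
  using pder_const[OF t] pder_self[OF t] by (metis rangeE zero_neq_one)

lemma subring_simple_extension: "subring_of (simple_extension \<iota> t)"
  unfolding subring_of_def
proof (intro conjI ballI)
  let ?L = "simple_extension \<iota> t"
  have I: "peval t r / peval t s \<in> ?L" if "s \<noteq> 0" for r s
    using that peval_eq_0_iff[OF p_indep_nonconst] unfolding simple_extension_peval by blast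
  show "0 \<in> ?L" "1 \<in> ?L" using I[of 1 0] I[of 1 1] by simp_all
  fix a b assume "a \<in> ?L" "b \<in> ?L"
  then obtain r s r' s' where *: "a = peval t r / peval t s" "peval t s \<noteq> 0"
    "b = peval t r' / peval t s'" "peval t s' \<noteq> 0" unfolding simple_extension_peval by blast
  have "a - b = peval t (r * s' - r' * s) / peval t (s * s')" "a * b = peval t (r * r') / peval t (s * s')"
    unfolding *(1,3) using *(2,4) by (simp_all add: field_simps)
  moreover have "s * s' \<noteq> 0" using * by auto
  ultimately show "a - b \<in> ?L" "a * b \<in> ?L" using I by metis+
qed

lemma inverse_simple_extension: "a \<in> simple_extension \<iota> t \<Longrightarrow> inverse a \<in> simple_extension \<iota> t"
proof -
  assume "a \<in> simple_extension \<iota> t"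
  then obtain r s where rs: "a = peval t r / peval t s" "peval t s \<noteq> 0" unfolding simple_extension_peval by blast
  show ?thesis
  proof (cases "peval t r = 0")
    case True
    then show ?thesis using subring_ofD(1)[OF subring_simple_extension] rs by simp
  next
    case False
    then show ?thesis unfolding simple_extension_peval using rs by (intro CollectI exI[of _ s] exI[of _ r]) simp
  qed
qed

lemma peval_in_simple_extension: "peval t r \<in> simple_extension \<iota> t"
  unfolding simple_extension_peval by (intro CollectI exI[of _ r] exI[of _ 1]) simp

lemma simple_extension_p_split:
  assumes c: "c \<in> simple_extension \<iota> t"
  shows "\<exists>s. (\<forall>l. s l \<in> simple_extension \<iota> t) \<and> c = (\<Sum>l<p. s l ^ p * t ^ l)"
proof -
  obtain a b where ab: "c = peval t a / peval t b" "peval t b \<noteq> 0" using c unfolding simple_extension_peval by blast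
  obtain s where s: "peval t (a * b ^ (p - 1)) = (\<Sum>l<p. peval t (s l) ^ p * t ^ l)" using peval_p_split by blast
  have "peval t b ^ p = peval t b * peval t b ^ (p - 1)" using p_pos by (simp add: power_eq_if)
  then have "c = peval t (a * b ^ (p - 1)) / peval t b ^ p" using ab by (simp add: field_simps)
  also have "\<dots> = (\<Sum>l<p. (peval t (s l) / peval t b) ^ p * t ^ l)"
    unfolding s by (simp add: sum_divide_distrib power_divide)
  finally show ?thesis
    using ab unfolding simple_extension_peval by (intro exI[of _ "\<lambda>l. peval t (s l) / peval t b"]) auto
qed

text \<open>If a minimal polynomial \<open>r\<close> of \<open>z\<close> over \<open>K(t)\<close>
  had derivative \<open>0\<close>, only powers of \<open>X ^ p\<close> would occur. Expanding its
  coefficients over \<open>p\<close>-th powers turns \<open>r(z) = 0\<close> into a relation among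
  the powers of \<open>t\<close> over \<open>F ^ p\<close>. By \<open>p\<close>-independence,
  polynomials of degree at most \<open>m div p\<close> vanish at \<open>z\<close>, so they are zero
  by minimality, and so is \<open>r\<close>.\<close>

lemma separable_over_simple_extension: "separable_over (simple_extension \<iota> t) z"
proof -
  let ?L = "simple_extension \<iota> t"
  note L = subring_simple_extension inverse_simple_extension
  note LD = subring_ofD[OF L(1)]
  let ?P = "\<lambda>r. (\<forall>i. coeff r i \<in> ?L) \<and> r \<noteq> 0 \<and> poly r z = 0"
  have "\<exists>r. ?P r"
  proof -
    note tr = p_indep_nonconst
    obtain B where B: "finite B" "\<And>f. in_frac_span (peval t) B (\<lambda>b. b) f" using function_field_basis[OF tr] by metis
    have "\<not> lin_indep (peval t) {..card B} (\<lambda>j. z ^ j)"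
      using card_lin_indep_le[OF domain_embedding_peval[OF tr] B(1), of "{..card B}" "\<lambda>b. b" "\<lambda>j. z ^ j"] B(2) by auto
    then obtain c j where c: "(\<Sum>j\<le>card B. peval t (c j) * z ^ j) = 0" "j \<le> card B" "c j \<noteq> 0"
      unfolding lin_indep_def by auto
    define r where "r = (\<Sum>j\<le>card B. monom (peval t (c j)) j)"
    have co: "coeff r i = (if i \<le> card B then peval t (c i) else 0)" for i
      by (simp add: r_def coeff_sum coeff_monom)
    have "coeff r j \<noteq> 0" using c peval_eq_0_iff[OF tr] by (simp add: co)
    then have "r \<noteq> 0" by auto
    moreover have "poly r z = 0" using c(1) by (simp add: r_def poly_sum poly_monom)
    ultimately show ?thesis using co peval_in_simple_extension LD(1) by (intro exI[of _ r]) auto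
  qed
  then obtain r where r: "?P r" and rmin: "\<And>s. ?P s \<Longrightarrow> degree r \<le> degree s"
    using ex_has_least_nat[of ?P _ degree] by blast
  define m where "m = degree r"
  have m: "0 < m"
  proof (rule ccontr)
    assume "\<not> 0 < m"
    then obtain a where "r = [:a:]" using degree_eq_zeroE[of r] by (auto simp: m_def)
    then show False using r by simp
  qed
  have natL: "of_nat n \<in> ?L" for n by (induction n) (use LD in auto)
  have "pderiv r \<noteq> 0"
  proof
    assume d0: "pderiv r = 0"
    have nz: "coeff r k = 0" if k: "\<not> p dvd k" for k
    proof -
      obtain k' where k': "k = Suc k'" using k by (cases k) auto
      have "of_nat k * coeff r k = 0" using coeff_pderiv[of r k'] d0 k' by simp
      moreover have "of_nat k \<noteq> (0 :: 'f)" using k char_field by (simp add: of_nat_eq_0_iff_char_dvd)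
      ultimately show ?thesis by simp
    qed
    have "\<forall>i. \<exists>s. (\<forall>l. s l \<in> ?L) \<and> coeff r (p * i) = (\<Sum>l<p. s l ^ p * t ^ l)"
      using simple_extension_p_split r by blast
    then obtain c where c: "\<And>i l. c i l \<in> ?L" "\<And>i. coeff r (p * i) = (\<Sum>l<p. c i l ^ p * t ^ l)" by metis
    define M where "M = m div p"
    have "poly r z = (\<Sum>k\<le>m. coeff r k * z ^ k)" by (simp add: poly_altdef m_def)
    also have "\<dots> = (\<Sum>k\<in>(\<lambda>i. p * i) ` {..M}. coeff r k * z ^ k)"
    proof (rule sum.mono_neutral_right)
      show "(\<lambda>i. p * i) ` {..M} \<subseteq> {..m}"
        using p_pos by (auto simp: M_def less_eq_div_iff_mult_less_eq mult.commute)
      show "\<forall>k\<in>{..m} - (\<lambda>i. p * i) ` {..M}. coeff r k * z ^ k = 0"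
      proof
        fix k assume k: "k \<in> {..m} - (\<lambda>i. p * i) ` {..M}"
        have "\<not> p dvd k"
        proof
          assume "p dvd k"
          then have "k = p * (k div p)" "k div p \<le> M" using k by (auto simp: M_def div_le_mono)
          then show False using k by auto
        qed
        then show "coeff r k * z ^ k = 0" using nz by simp
      qed
    qed simp
    also have "\<dots> = (\<Sum>i\<le>M. coeff r (p * i) * z ^ (p * i))"
      using p_pos by (subst sum.reindex) (auto simp: inj_on_def)
    also have "\<dots> = (\<Sum>i\<le>M. \<Sum>l<p. (c i l * z ^ i) ^ p * t ^ l)"
      unfolding c(2) by (simp add: sum_distrib_right sum_distrib_left power_mult_distrib power_mult[symmetric] mult_ac)
    also have "\<dots> = (\<Sum>l<p. (\<Sum>i\<le>M. c i l * z ^ i) ^ p * t ^ l)"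
      unfolding sum_p sum_distrib_right by (rule sum.swap)
    finally have "(\<Sum>l<p. (\<Sum>i\<le>M. c i l * z ^ i) ^ p * t ^ l) = 0" using r by simp
    then have z0: "(\<Sum>i\<le>M. c i l * z ^ i) = 0" if "l < p" for l
      using p_indepD[OF t, of "\<lambda>l. \<Sum>i\<le>M. c i l * z ^ i" l] that by simp
    have c0: "c i l = 0" if l: "l < p" and i: "i \<le> M" for i l
    proof -
      define s where "s = (\<Sum>i\<le>M. monom (c i l) i)"
      have co: "coeff s i = (if i \<le> M then c i l else 0)" for i by (simp add: s_def coeff_sum coeff_monom)
      have "poly s z = 0" using z0[OF l] by (simp add: s_def poly_sum poly_monom)
      moreover have "degree s \<le> M" by (rule degree_le) (simp add: co)
      moreover have "M < m" using m p_pos by (simp add: M_def)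
      ultimately have "s = 0" using rmin[of s] co c(1) LD(1) by (fastforce simp: m_def)
      then show ?thesis using co[of i] i by simp
    qed
    have "coeff r m = 0"
    proof (cases "p dvd m")
      case True
      then have "m = p * M" by (simp add: M_def)
      moreover have "coeff r (p * M) = 0" unfolding c(2) using c0 by (intro sum.neutral) simp
      ultimately show ?thesis by simp
    qed (rule nz)
    then show False using r by (simp add: m_def)
  qed
  moreover have "coeff (pderiv r) i \<in> ?L" for i unfolding coeff_pderiv by (rule LD(4)[OF natL]) (use r in simp)
  moreover have "degree (pderiv r) \<le> m - 1"
    by (rule degree_le) (auto simp: coeff_pderiv m_def intro!: coeff_eq_0)
  then have "degree (pderiv r) < degree r" using m by (simp add: m_def)
  ultimately have "coprime r (pderiv r)"
    using r rmin by (intro coprime_if_minimal[OF L, of r z "pderiv r"]) auto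
  then show ?thesis unfolding separable_over_def using r by (intro exI[of _ r]) simp
qed

text \<open>Supplies the witness for the definite description in \<open>cartier\<close>.\<close>

lemma separating_if_p_indep: "separating_element \<iota> t"
  unfolding separating_element_def
  using separable_over_simple_extension p_indep_nonconst curve unfolding curve_function_field_def by blast

end

section \<open>Differential forms\<close>

text \<open>\<open>- kappa t v\<close> is the order of \<open>dt\<close> at \<open>v\<close>, as
  \<open>dt\<close> is \<open>d\<tau>\<close> divided by \<open>pder t \<tau>\<close>. The chosen
  local parameter is immaterial by the next lemma.\<close>

definition kappa :: "'f \<Rightarrow> 'f place \<Rightarrow> int" where
  "kappa t v = v (pder t (SOME \<tau>. v \<tau> = 1))"

text \<open>Of two local parameters, each has an integral derivative with respect to the other, so
  the chain rule gives both inequalities.\<close>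

lemma kappa:
  assumes t: "p_indep t" and v: "place v" and \<tau>: "v \<tau> = 1"
  shows "v (pder t \<tau>) = kappa t v"
proof -
  have le: "v (pder t \<tau>) \<le> v (pder t \<sigma>)" if \<tau>: "v \<tau> = 1" and \<sigma>: "v \<sigma> = 1" for \<tau> \<sigma>
  proof -
    have p: "p_indep \<tau>" "p_indep \<sigma>" using p_indep_local_parameter[OF v] that by auto
    have "vge v 0 (pder \<tau> \<sigma>)" using \<sigma> by (intro vge_pder_local[OF v \<tau>]) (simp add: vge_def)
    moreover have nz: "pder \<tau> \<sigma> \<noteq> 0" "pder t \<tau> \<noteq> 0" using pder_p_indep_iff p t by blast+
    ultimately show ?thesis
      unfolding pder_chain[OF t p(1), of \<sigma>] by (simp add: val_mult[OF v] vge_def)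
  qed
  have "v (SOME \<tau>. v \<tau> = 1) = 1" using \<tau> by (rule someI)
  then show ?thesis unfolding kappa_def using le[OF \<tau>] le[OF _ \<tau>] by (intro antisym) auto
qed

lemma vge_pder:
  assumes t: "p_indep t" and v: "place v" and f: "vge v 0 f"
  shows "vge v (kappa t v) (pder t f)"
proof -
  obtain \<tau> where \<tau>: "v \<tau> = 1" "\<tau> \<noteq> 0" using local_parameter[OF v] .
  have p: "p_indep \<tau>" using p_indep_local_parameter[OF v \<tau>(1)] .
  have "vge v (0 + kappa t v) (pder \<tau> f * pder t \<tau>)"
    using kappa[OF t v \<tau>(1)] by (intro vge_mult[OF v] vge_pder_local[OF v \<tau>(1) f]) (simp add: vge_def)
  then show ?thesis using pder_chain[OF t p, of f] by simp
qed

lemma vge_dlog_unit: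
  assumes t: "p_indep t" and v: "place v" and f: "v f = 0"
  shows "vge v (kappa t v) (pder t f / f)"
proof (cases "f = 0")
  case False
  have "vge v (kappa t v) (pder t f)" using f by (intro vge_pder[OF t v]) (simp add: vge_def)
  from vge_divide[OF v this False] f show ?thesis by simp
qed simp

text \<open>\<open>f = \<tau> ^ n * u\<close> with a unit \<open>u\<close> gives
  \<open>n d\<tau> / \<tau> + du / u\<close>; a function with a pole is inverted first, which only
  changes the sign. Relative to \<open>kappa\<close>, the \<open>- 1\<close> stands for a simple
  pole.\<close>

lemma vge_dlog:
  assumes t: "p_indep t" and v: "place v"
  shows "vge v (kappa t v - 1) (pder t f / f)"
proof (cases "f = 0")
  case f0: False
  obtain \<tau> where \<tau>: "v \<tau> = 1" "\<tau> \<noteq> 0" using local_parameter[OF v] .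
  have *: "vge v (kappa t v - 1) (pder t f / f)" if f: "0 \<le> v f" "f \<noteq> 0" for f
  proof -
    define n where "n = nat (v f)"
    define u where "u = f / \<tau> ^ n"
    have u: "u \<noteq> 0" "v u = 0" "f = \<tau> ^ n * u"
      using f \<tau> by (auto simp: u_def n_def val_divide[OF v] val_power[OF v])
    have "pder t f / f = of_nat n * (pder t \<tau> / \<tau>) + pder t u / u"
    proof (cases n)
      case (Suc k)
      have "pder t (\<tau> ^ Suc k) = of_nat (Suc k) * \<tau> ^ k * pder t \<tau>"
        by (simp only: pder_power[OF t] diff_Suc_1)
      then show ?thesis unfolding u(3) Suc pder_mult[OF t] using u(1) \<tau>(2)
        by (simp add: field_simps del: of_nat_Suc)
    qed (use u in simp)
    moreover have "vge v (kappa t v - 1) (pder t \<tau> / \<tau>)"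
      using vge_divide[OF v, of "kappa t v" "pder t \<tau>" \<tau>] kappa[OF t v \<tau>(1)] \<tau> by (simp add: vge_def)
    then have "vge v (kappa t v - 1) (of_nat n * (pder t \<tau> / \<tau>))"
      using vge_mult0[OF v vge_const[OF v, of "of_nat n"], of "kappa t v - 1" "pder t \<tau> / \<tau>"] by simp
    moreover have "vge v (kappa t v - 1) (pder t u / u)"
      using vge_dlog_unit[OF t v u(2)] by (rule vge_mono) simp
    ultimately show ?thesis using vge_add[OF v] by simp
  qed
  show ?thesis
  proof (cases "0 \<le> v f")
    case False
    then have "vge v (kappa t v - 1) (pder t (inverse f) / inverse f)"
      using f0 by (intro *) (auto simp: val_inverse[OF v])
    moreover have "pder t (inverse f) / inverse f = - (pder t f / f)"
      unfolding pder_inverse[OF t] using f0 by (simp add: field_simps power2_eq_square)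
    ultimately show ?thesis using vge_minus[OF v] by fastforce
  qed (use * f0 in blast)
qed simp

section \<open>The module of differentials as the line spanned by \<open>d t\<close>\<close>

context
  fixes smul :: "'f \<Rightarrow> 'w::ab_group_add \<Rightarrow> 'w" and d :: "'f \<Rightarrow> 'w" and t :: 'f
  assumes kd: "kaehler_differentials \<iota> smul d" and t: "p_indep t"
begin

lemma smul_vs: "vector_space smul"
  using kd unfolding kaehler_differentials_def by blast

interpretation W: vector_space smul
  by (rule smul_vs)

lemma smul_assoc: "smul a (smul b w) = smul (a * b) w"
  by (rule W.scale_scale)

definition ev_form :: "('f \<Rightarrow>\<^sub>0 'f) \<Rightarrow> 'w" where
  "ev_form s = (\<Sum>g\<in>Poly_Mapping.keys s. smul (Poly_Mapping.lookup s g) (d g))"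

lemma ev_form_eq:
  "finite A \<Longrightarrow> Poly_Mapping.keys s \<subseteq> A \<Longrightarrow> ev_form s = (\<Sum>g\<in>A. smul (Poly_Mapping.lookup s g) (d g))"
  unfolding ev_form_def by (intro sum.mono_neutral_left) (auto simp: in_keys_iff)

lemma ev_form_diff: "ev_form (r - s) = ev_form r - ev_form s"
proof -
  let ?A = "Poly_Mapping.keys r \<union> Poly_Mapping.keys s"
  have "Poly_Mapping.keys (r - s) \<subseteq> ?A" by (auto simp: in_keys_iff lookup_minus)
  then have "ev_form (r - s) = (\<Sum>g\<in>?A. smul (Poly_Mapping.lookup (r - s) g) (d g))"
    by (intro ev_form_eq) simp
  also have "\<dots> = (\<Sum>g\<in>?A. smul (Poly_Mapping.lookup r g) (d g)) - (\<Sum>g\<in>?A. smul (Poly_Mapping.lookup s g) (d g))"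
    by (simp add: lookup_minus W.scale_left_diff_distrib sum_subtractf)
  also have "\<dots> = ev_form r - ev_form s"
    using ev_form_eq[of ?A r] ev_form_eq[of ?A s] by simp
  finally show ?thesis .
qed

lemma ev_form_single: "ev_form (Poly_Mapping.single g c) = smul c (d g)"
  using ev_form_eq[of "{g}" "Poly_Mapping.single g c"] by (simp add: keys_single)

lemma ev_form_kernel:
  "surj ev_form" "ev_form s = 0 \<longleftrightarrow> s \<in> module.span (\<lambda>c. Poly_Mapping.map ((*) c)) (kaehler_relations \<iota>)"
  using kd unfolding kaehler_differentials_def Let_def ev_form_def[symmetric] by auto

lemma ev_form_relation: "s \<in> kaehler_relations \<iota> \<Longrightarrow> ev_form s = 0"
  unfolding ev_form_kernel using module.span_base[OF module_free] .

lemma d_add: "d (g + h) = d g + d h"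
proof -
  have "ev_form (Poly_Mapping.single (g + h) 1 - Poly_Mapping.single g 1 - Poly_Mapping.single h 1) = 0"
    by (rule ev_form_relation) (auto simp: kaehler_relations_def)
  from this[unfolded ev_form_diff ev_form_single] show ?thesis by (simp add: algebra_simps)
qed

lemma d_mult: "d (g * h) = smul g (d h) + smul h (d g)"
proof -
  have "ev_form (Poly_Mapping.single (g * h) 1 - Poly_Mapping.single h g - Poly_Mapping.single g h) = 0"
    by (rule ev_form_relation) (auto simp: kaehler_relations_def)
  from this[unfolded ev_form_diff ev_form_single] show ?thesis by (simp add: algebra_simps)
qed

lemma d_const: "d (\<iota> a) = 0"
proof -
  have "ev_form (Poly_Mapping.single (\<iota> a) 1) = 0"
    by (rule ev_form_relation) (auto simp: kaehler_relations_def)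
  then show ?thesis by (simp add: ev_form_single)
qed

lemma d_power: "d (f ^ n) = smul (of_nat n * f ^ (n - 1)) (d f)"
proof (induction n)
  case 0
  show ?case using d_const[of 1] by simp
next
  case (Suc n)
  have "d (f ^ Suc n) = smul f (smul (of_nat n * f ^ (n - 1)) (d f)) + smul (f ^ n) (d f)"
    by (simp add: d_mult Suc)
  also have "\<dots> = smul (f * (of_nat n * f ^ (n - 1)) + f ^ n) (d f)"
    by (simp only: smul_assoc W.scale_left_distrib)
  also have "f * (of_nat n * f ^ (n - 1)) + f ^ n = of_nat (Suc n) * f ^ n"
    by (cases n) (simp_all add: algebra_simps)
  finally show ?case by simp
qed

lemma d_sum: "d (\<Sum>i\<in>I. f i) = (\<Sum>i\<in>I. d (f i))"
  using d_const[of 0] by (induction I rule: infinite_finite_induct) (auto simp: d_add)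

lemma d_pder: "d f = smul (pder t f) (d t)"
proof -
  have "d f = d (\<Sum>i<p. pcoef t f i ^ p * t ^ i)" using pcoef[OF t, of f] by simp
  also have "\<dots> = (\<Sum>i<p. smul (of_nat i * pcoef t f i ^ p * t ^ (i - 1)) (d t))"
    by (simp add: d_sum d_mult d_power mult_ac)
  also have "\<dots> = smul (pder t f) (d t)" by (simp add: pder_def W.scale_sum_left)
  finally show ?thesis .
qed

text \<open>The functional \<open>\<Lambda>\<close>, which sends the symbol of \<open>g\<close> to
  \<open>pder t g\<close>, kills all Kaehler relations but is \<open>1\<close> on the symbol of
  \<open>t\<close>, which is therefore not in their span.\<close>

lemma d_parameter_nonzero: "d t \<noteq> 0"
proof
  assume "d t = 0"
  then have "ev_form (Poly_Mapping.single t 1) = 0" by (simp add: ev_form_single)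
  then have mem: "Poly_Mapping.single t 1 \<in> module.span (\<lambda>c. Poly_Mapping.map ((*) c)) (kaehler_relations \<iota>)"
    using ev_form_kernel by blast
  define \<Lambda> where "\<Lambda> = (\<lambda>s :: 'f \<Rightarrow>\<^sub>0 'f. \<Sum>g\<in>Poly_Mapping.keys s. Poly_Mapping.lookup s g * pder t g)"
  have eq: "\<Lambda> s = (\<Sum>g\<in>A. Poly_Mapping.lookup s g * pder t g)"
    if "finite A" "Poly_Mapping.keys s \<subseteq> A" for A s
    unfolding \<Lambda>_def using that by (intro sum.mono_neutral_left) (auto simp: in_keys_iff)
  have add: "\<Lambda> (r + s) = \<Lambda> r + \<Lambda> s" for r s
  proof -
    let ?A = "Poly_Mapping.keys r \<union> Poly_Mapping.keys s"
    have "Poly_Mapping.keys (r + s) \<subseteq> ?A" by (rule keys_add)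
    then have "\<Lambda> (r + s) = (\<Sum>g\<in>?A. Poly_Mapping.lookup (r + s) g * pder t g)" by (intro eq) simp
    also have "\<dots> = \<Lambda> r + \<Lambda> s"
      using eq[of ?A r] eq[of ?A s] by (simp add: lookup_add distrib_right sum.distrib)
    finally show ?thesis .
  qed
  have scale: "\<Lambda> (Poly_Mapping.map ((*) c) s) = c * \<Lambda> s" for c s
  proof -
    have l: "Poly_Mapping.lookup (Poly_Mapping.map ((*) c) s) k = c * Poly_Mapping.lookup s k" for k
      by (simp add: Poly_Mapping.map.rep_eq when_def)
    have "\<Lambda> (Poly_Mapping.map ((*) c) s) =
        (\<Sum>g\<in>Poly_Mapping.keys s. Poly_Mapping.lookup (Poly_Mapping.map ((*) c) s) g * pder t g)"
      by (intro eq) (auto simp: in_keys_iff l)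
    then show ?thesis by (simp add: l \<Lambda>_def sum_distrib_left mult.assoc)
  qed
  have single: "\<Lambda> (Poly_Mapping.single g c) = c * pder t g" for g c
    using eq[of "{g}" "Poly_Mapping.single g c"] by (simp add: keys_single)
  have minus: "\<Lambda> (r - s) = \<Lambda> r - \<Lambda> s" for r s using add[of "r - s" s] by simp
  have "module.span (\<lambda>c. Poly_Mapping.map ((*) c)) (kaehler_relations \<iota>) \<subseteq> {s. \<Lambda> s = 0}"
  proof (rule module.span_minimal[OF module_free])
    have "\<Lambda> (Poly_Mapping.single (g + h) 1 - Poly_Mapping.single g 1 - Poly_Mapping.single h 1) = 0"
      "\<Lambda> (Poly_Mapping.single (g * h) 1 - Poly_Mapping.single h g - Poly_Mapping.single g h) = 0"
      "\<Lambda> (Poly_Mapping.single (\<iota> a) 1) = 0" for g h a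
      unfolding minus single by (simp_all add: pder_add[OF t] pder_mult[OF t] pder_const[OF t])
    then show "kaehler_relations \<iota> \<subseteq> {s. \<Lambda> s = 0}"
      unfolding kaehler_relations_def by blast
    show "module.subspace (\<lambda>c. Poly_Mapping.map ((*) c)) {s. \<Lambda> s = 0}"
      unfolding module.subspace_def[OF module_free] by (auto simp: add scale) (simp add: \<Lambda>_def)
  qed
  then have "\<Lambda> (Poly_Mapping.single t 1) = 0" using mem by blast
  then show False using single[of t 1] pder_self[OF t] by simp
qed

lemma form_exists: "\<exists>g. \<omega> = smul g (d t)"
proof -
  obtain s where "\<omega> = ev_form s" using ev_form_kernel(1) by (metis surjD)
  also have "\<dots> = (\<Sum>g\<in>Poly_Mapping.keys s. smul (Poly_Mapping.lookup s g * pder t g) (d t))"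
    unfolding ev_form_def using d_pder by (metis smul_assoc)
  also have "\<dots> = smul (\<Sum>g\<in>Poly_Mapping.keys s. Poly_Mapping.lookup s g * pder t g) (d t)"
    by (simp add: W.scale_sum_left)
  finally show ?thesis by blast
qed

lemma form_eq_iff: "smul f (d t) = smul g (d t) \<longleftrightarrow> f = g"
  using W.scale_cancel_right d_parameter_nonzero by blast

lemma form_eq_0_iff: "smul f (d t) = 0 \<longleftrightarrow> f = 0"
  using W.scale_eq_0_iff d_parameter_nonzero by blast

section \<open>Cartier operator, order and residue in the coordinate \<open>t\<close>\<close>

lemma smul_d: "smul f (d x) = smul (f * pder t x) (d t)"
  using d_pder[of x] smul_assoc by metis

text \<open>Existence in the definite description comes from \<open>t\<close> itself, which is
  separating; uniqueness comes from \<open>Cop_change\<close>.\<close>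

lemma cartier_form: "cartier p \<iota> smul d (smul g (d t)) = smul (Cop t g) (d t)"
  unfolding cartier_def
proof (rule the_equality)
  show "\<exists>x f. separating_element \<iota> x \<and> smul g (d t) = smul (\<Sum>i<p. f i ^ p * x ^ i) (d x) \<and>
      smul (Cop t g) (d t) = smul (f (p - 1)) (d x)"
    using separating_if_p_indep[OF t] pcoef[OF t, of g]
    by (intro exI[of _ t] exI[of _ "pcoef t g"]) (simp add: Cop_def)
next
  fix \<eta> assume "\<exists>x f. separating_element \<iota> x \<and> smul g (d t) = smul (\<Sum>i<p. f i ^ p * x ^ i) (d x) \<and>
      \<eta> = smul (f (p - 1)) (d x)"
  then obtain x f where x: "smul g (d t) = smul (\<Sum>i<p. f i ^ p * x ^ i) (d x)" "\<eta> = smul (f (p - 1)) (d x)" by blast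
  then have "g = (\<Sum>i<p. f i ^ p * x ^ i) * pder t x" by (simp only: smul_d[of _ x] form_eq_iff)
  then have "Cop t g = f (p - 1) * pder t x" using Cop_change[OF t] by simp
  then show "\<eta> = smul (Cop t g) (d t)" using x(2) by (simp only: smul_d[of _ x])
qed

lemma form_order_eq:
  assumes v: "place v" and g: "g \<noteq> 0"
  shows "form_order smul d v (smul g (d t)) = v g - kappa t v"
proof -
  obtain \<tau> where \<tau>: "v \<tau> = 1" "\<tau> \<noteq> 0" using local_parameter[OF v] .
  have nz: "pder t \<sigma> \<noteq> 0" if "v \<sigma> = 1" for \<sigma>
    using p_indep_local_parameter[OF v that] pder_p_indep_iff[OF t] by blast
  show ?thesis unfolding form_order_def
  proof (rule the_equality)
    have "smul g (d t) = smul (g / pder t \<tau>) (d \<tau>)" using nz[OF \<tau>(1)] by (simp add: smul_d[of _ \<tau>])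
    then show "\<exists>s f. v s = 1 \<and> f \<noteq> 0 \<and> smul g (d t) = smul f (d s) \<and> v g - kappa t v = v f"
      using \<tau> g nz[OF \<tau>(1)] kappa[OF t v \<tau>(1)]
      by (intro exI[of _ \<tau>] exI[of _ "g / pder t \<tau>"]) (simp add: val_divide[OF v])
    fix n assume "\<exists>s f. v s = 1 \<and> f \<noteq> 0 \<and> smul g (d t) = smul f (d s) \<and> n = v f"
    then obtain s f where s: "v s = 1" "f \<noteq> 0" "smul g (d t) = smul f (d s)" "n = v f" by blast
    then have "g = f * pder t s" by (simp only: smul_d[of _ s] form_eq_iff)
    then show "n = v g - kappa t v" using s nz[OF s(1)] kappa[OF t v s(1)] by (simp add: val_mult[OF v])
  qed
qed

lemma form_space_iff:
  "smul g (d t) \<in> form_space \<iota> smul d A \<longleftrightarrow> (\<forall>v. place v \<longrightarrow> vge v (Poly_Mapping.lookup A v + kappa t v) g)"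
  by (cases "g = 0") (auto simp: form_space_def form_eq_0_iff form_order_eq vge_def d_parameter_nonzero algebra_simps)

text \<open>The definition of the residue admits expansions of any length. If \<open>f\<close> has
  at most a simple pole, the extra coefficients vanish from the top down: after multiplication by
  the highest power of \<open>\<tau>\<close>, everything but the top coefficient has positive
  value.\<close>

lemma principal_part_residue:
  assumes v: "place v" and \<tau>: "v \<tau> = 1" and f: "vge v (- 1) f"
    and N: "vge v 0 (f - (\<Sum>i\<le>N. \<iota> (c i) / \<tau> ^ Suc i))"
  shows "vge v 1 (f * \<tau> - \<iota> (c 0))"
  using N
proof (induction N)
  case 0
  have \<tau>0: "\<tau> \<noteq> 0" using \<tau> by (intro val_nonzero[OF v]) simp
  have "vge v (0 + 1) ((f - \<iota> (c 0) / \<tau>) * \<tau>)" using 0 \<tau> by (intro vge_mult[OF v]) (auto simp: vge_def)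
  then show ?case using \<tau>0 by (simp add: left_diff_distrib)
next
  case (Suc N)
  have \<tau>0: "\<tau> \<noteq> 0" using \<tau> by (intro val_nonzero[OF v]) simp
  define T where "T = \<tau> ^ Suc (Suc N)"
  have vT: "vge v (int N + 2) T" unfolding T_def using \<tau> by (simp add: vge_def val_power[OF v] del: power_Suc)
  have "vge v (int N + 2 + 0) (T * (f - (\<Sum>i\<le>Suc N. \<iota> (c i) / \<tau> ^ Suc i)))"
    using Suc.prems vT by (intro vge_mult[OF v])
  then have 1: "vge v 1 (T * (f - (\<Sum>i\<le>Suc N. \<iota> (c i) / \<tau> ^ Suc i)))" by (rule vge_mono) simp
  have 2: "vge v 1 (T * f)" using vge_mult[OF v vT f] by (rule vge_mono) simp
  have 3: "vge v 1 (T * (\<Sum>i\<le>N. \<iota> (c i) / \<tau> ^ Suc i))"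
    unfolding sum_distrib_left
  proof (rule vge_sum[OF v])
    fix i assume i: "i \<in> {..N}"
    have "T = \<tau> ^ (Suc N - i) * \<tau> ^ Suc i" using i by (simp add: T_def flip: power_add)
    then have "T * (\<iota> (c i) / \<tau> ^ Suc i) = \<iota> (c i) * \<tau> ^ (Suc N - i)" using \<tau>0 by simp
    moreover have "vge v 1 (\<tau> ^ (Suc N - i))" using i \<tau> by (intro vge_power_pos[OF v]) (auto simp: vge_def)
    ultimately show "vge v 1 (T * (\<iota> (c i) / \<tau> ^ Suc i))" using vge_mult0[OF v vge_const[OF v]] by simp
  qed
  have "vge v 1 (T * f - T * (\<Sum>i\<le>N. \<iota> (c i) / \<tau> ^ Suc i) - T * (f - (\<Sum>i\<le>Suc N. \<iota> (c i) / \<tau> ^ Suc i)))"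
    by (rule vge_diff[OF v vge_diff[OF v 2 3] 1])
  also have "T * f - T * (\<Sum>i\<le>N. \<iota> (c i) / \<tau> ^ Suc i) - T * (f - (\<Sum>i\<le>Suc N. \<iota> (c i) / \<tau> ^ Suc i))
      = T * (\<iota> (c (Suc N)) / \<tau> ^ Suc (Suc N))"
    unfolding sum.atMost_Suc by (simp only: algebra_simps)
  also have "\<dots> = \<iota> (c (Suc N))" using \<tau>0 by (simp add: T_def)
  finally have "c (Suc N) = 0" using vge_const_iff[OF v] by blast
  then show ?case using Suc by simp
qed

text \<open>Independence of the local parameter, for at most simple poles: the residue is the class
  of \<open>g * \<tau> / pder t \<tau>\<close>, and passing to \<open>s = u * \<tau>\<close> changes
  it by an element of the maximal ideal, because
  \<open>pder t s = u * pder t \<tau> + \<tau> * pder t u\<close>.\<close>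

lemma form_residue_eq:
  assumes v: "place v" and \<tau>: "v \<tau> = 1" and g: "vge v (kappa t v - 1) g"
    and a: "vge v 1 (g * \<tau> / pder t \<tau> - \<iota> a)"
  shows "form_residue \<iota> smul d v (smul g (d t)) = a"
proof -
  have nz: "pder t \<sigma> \<noteq> 0" "\<sigma> \<noteq> 0" "v (pder t \<sigma>) = kappa t v" if "v \<sigma> = 1" for \<sigma>
    using p_indep_local_parameter[OF v that] pder_p_indep_iff[OF t] val_nonzero[OF v, of \<sigma>] that kappa[OF t v that]
    by auto
  show ?thesis unfolding form_residue_def
  proof (rule the_equality)
    have "smul g (d t) = smul (g / pder t \<tau>) (d \<tau>)" using nz[OF \<tau>] by (simp add: smul_d[of _ \<tau>])
    moreover have "vge v (1 - v \<tau>) ((g * \<tau> / pder t \<tau> - \<iota> a) / \<tau>)" by (rule vge_divide[OF v a nz(2)[OF \<tau>]])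
    then have "g / pder t \<tau> - (\<Sum>i\<le>0. \<iota> a / \<tau> ^ Suc i) \<in> valuation_ring v"
      using \<tau> nz[OF \<tau>] by (simp add: valuation_ring_vge diff_divide_distrib)
    ultimately show "\<exists>s f N c. v s = 1 \<and> smul g (d t) = smul f (d s) \<and>
        f - (\<Sum>i\<le>N. \<iota> (c i) / s ^ Suc i) \<in> valuation_ring v \<and> a = c 0"
      using \<tau> by (intro exI[of _ \<tau>] exI[of _ "g / pder t \<tau>"] exI[of _ 0] exI[of _ "\<lambda>_. a"]) simp
  next
    fix b assume "\<exists>s f N c. v s = 1 \<and> smul g (d t) = smul f (d s) \<and>
        f - (\<Sum>i\<le>N. \<iota> (c i) / s ^ Suc i) \<in> valuation_ring v \<and> b = c 0"
    then obtain s f N c where s: "v s = 1" "smul g (d t) = smul f (d s)"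
      "vge v 0 (f - (\<Sum>i\<le>N. \<iota> (c i) / s ^ Suc i))" "b = c 0" unfolding valuation_ring_vge by blast
    have gf: "g = f * pder t s" using s(2) by (simp only: smul_d[of _ s] form_eq_iff)
    then have f: "f = g / pder t s" using nz[OF s(1)] by simp
    have "vge v (- 1) f" unfolding f using vge_divide[OF v g nz(1)[OF s(1)]] nz[OF s(1)] by simp
    then have b: "vge v 1 (g * s / pder t s - \<iota> b)"
      using principal_part_residue[OF v s(1) _ s(3)] s(4) by (simp add: f)
    define u where "u = s / \<tau>"
    have su: "s = u * \<tau>" using nz[OF \<tau>] by (simp add: u_def)
    have "vge v 0 u" using nz(2) s(1) \<tau> by (simp add: u_def vge_def val_divide[OF v])
    then have Du: "vge v (kappa t v) (pder t u)" by (rule vge_pder[OF t v])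
    have Ds: "pder t s = u * pder t \<tau> + \<tau> * pder t u" unfolding su by (rule pder_mult[OF t])
    have "g * s / pder t s - g * \<tau> / pder t \<tau> = - (g * \<tau> * \<tau> * pder t u / (pder t \<tau> * pder t s))"
    proof -
      have "g * s / pder t s - g * \<tau> / pder t \<tau> = g * \<tau> * (u * pder t \<tau> - pder t s) / (pder t \<tau> * pder t s)"
        using nz[OF \<tau>] nz[OF s(1)] by (simp add: su field_simps)
      also have "u * pder t \<tau> - pder t s = - (\<tau> * pder t u)" by (simp add: Ds)
      finally show ?thesis by simp
    qed
    \<comment> \<open>With \<open>kappa\<close> for \<open>kappa t v\<close>, the orders add up to
      \<open>(kappa - 1) + 1 + 1 + kappa - 2 * kappa = 1\<close>.\<close>
    moreover have "vge v 1 (g * \<tau> * \<tau> * pder t u / (pder t \<tau> * pder t s))"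
    proof -
      have v\<tau>: "vge v 1 \<tau>" using \<tau> by (simp add: vge_def)
      have "vge v (kappa t v - 1 + 1 + 1 + kappa t v) (g * \<tau> * \<tau> * pder t u)"
        by (intro vge_mult[OF v] g v\<tau> Du)
      from vge_divide[OF v this, of "pder t \<tau> * pder t s"] show ?thesis
        using nz[OF \<tau>] nz[OF s(1)] by (simp add: val_mult[OF v])
    qed
    ultimately have "vge v 1 (g * s / pder t s - g * \<tau> / pder t \<tau>)" using vge_minus[OF v] by simp
    from vge_diff[OF v vge_diff[OF v b this] a] have "vge v 1 (\<iota> (a - b))" by simp
    then have "a - b = 0" by (simp only: vge_const_iff[OF v])
    then show "b = a" by simp
  qed
qed

end

section \<open>Finiteness of ramification\<close>

lemma zero_pow [simp]: "(0 :: 'f) ^ p ^ n = 0"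
  using p_pos(1) by simp

text \<open>Nonzero elements have values divisible by \<open>p ^ N\<close>, so below that bound only
  units are visible; adjoining one function \<open>y\<close> then tests for ramification.\<close>

definition pow_ring :: "'f place \<Rightarrow> nat \<Rightarrow> 'f set" where
  "pow_ring v N = {a ^ p ^ N | a. vge v 0 a}"

lemma subring_pow_ring: "place v \<Longrightarrow> subring_of (pow_ring v N)"
  unfolding subring_of_def
proof (intro conjI ballI)
  assume v: "place v"
  have I: "a ^ p ^ N \<in> pow_ring v N" if "vge v 0 a" for a using that by (auto simp: pow_ring_def)
  show "0 \<in> pow_ring v N" "1 \<in> pow_ring v N" using I[of 0] I[of 1] vge_1[OF v] by simp_all
  fix x y assume "x \<in> pow_ring v N" "y \<in> pow_ring v N"
  then obtain a b where "x = a ^ p ^ N" "y = b ^ p ^ N" "vge v 0 a" "vge v 0 b" unfolding pow_ring_def by blast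
  then show "x - y \<in> pow_ring v N" "x * y \<in> pow_ring v N"
    using I[OF vge_diff[OF v, of 0 a b]] I[OF vge_mult0[OF v, of a 0 b]] by (simp_all add: diff_pow power_mult_distrib)
qed

text \<open>In the sum of the \<open>a i ^ Q * y ^ i\<close>, terms with nonunit \<open>a i\<close>
  have value at least \<open>Q = p ^ N\<close>. So the first index \<open>i\<close> with a unit
  \<open>a i\<close> decides the value of \<open>f\<close>, which is \<open>i * v y\<close>.\<close>

lemma val_adjoin_pow_ring:
  assumes v: "place v" and y: "0 < v y" and f: "f \<in> adjoin (pow_ring v N) y" "f \<noteq> 0" "v f < int (p ^ N)"
  shows "v y dvd v f"
proof -
  define Q where "Q = p ^ N"
  obtain r where r: "f = poly r y" "\<forall>i. coeff r i \<in> pow_ring v N" using f(1) unfolding adjoin_def by blast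
  then have "\<forall>i. \<exists>a. coeff r i = a ^ Q \<and> vge v 0 a" unfolding pow_ring_def Q_def by blast
  then obtain a where a: "\<And>i. coeff r i = a i ^ Q" "\<And>i. vge v 0 (a i)" by metis
  define n where "n = degree r"
  have fs: "f = (\<Sum>i\<le>n. a i ^ Q * y ^ i)" unfolding r(1) poly_altdef a(1) n_def ..
  have y0: "y \<noteq> 0" using y by (intro val_nonzero[OF v]) simp
  have vy: "v (y ^ i) = int i * v y" for i by (rule val_power[OF v])
  have vyi: "vge v (int i * v y) (a i ^ Q * y ^ i)" for i
    by (rule vge_mult0[OF v vge_power[OF v a(2)]]) (simp add: vge_def vy)
  define U where "U = {i. i \<le> n \<and> a i \<noteq> 0 \<and> v (a i) = 0}"
  have nonunit: "vge v (int Q) (a i ^ Q * y ^ i)" if "i \<le> n" "i \<notin> U" for i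
  proof (cases "a i = 0")
    case False
    then have "1 \<le> v (a i)" using that a(2)[of i] by (auto simp: U_def vge_def)
    then have "int Q * 1 \<le> int Q * v (a i)" by (intro mult_left_mono) auto
    then have "vge v (int Q) (a i ^ Q)" by (simp add: vge_def val_power[OF v])
    then show ?thesis using vge_mult0[OF v, of "y ^ i" "int Q" "a i ^ Q"] y
      by (simp add: vge_def[of v 0] vy mult.commute)
  qed (simp add: Q_def)
  have big: False if "\<And>i. i \<le> n \<Longrightarrow> vge v (int Q) (a i ^ Q * y ^ i)"
  proof -
    have "vge v (int Q) f" unfolding fs using that by (intro vge_sum[OF v]) auto
    then show False using f(2,3) by (simp add: vge_def Q_def)
  qed
  have "U \<noteq> {}" using big nonunit by auto
  define i where "i = Min U"
  have finU: "finite U" by (simp add: U_def)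
  have i: "i \<in> U" "\<And>k. k \<in> U \<Longrightarrow> i \<le> k" using finU \<open>U \<noteq> {}\<close> by (simp_all add: i_def)
  have iy: "int i * v y < int Q"
  proof (rule ccontr)
    assume no: "\<not> ?thesis"
    show False
    proof (rule big)
      fix k assume k: "k \<le> n"
      show "vge v (int Q) (a k ^ Q * y ^ k)"
      proof (cases "k \<in> U")
        case True
        then have "int i * v y \<le> int k * v y" using i(2) y by (intro mult_right_mono) auto
        then show ?thesis using vyi[of k] no by (auto intro: vge_mono)
      qed (use nonunit k in blast)
    qed
  qed
  define lead where "lead = a i ^ Q * y ^ i"
  have lead: "lead \<noteq> 0" "v lead = int i * v y"
    using i(1) y0 by (auto simp: lead_def U_def val_mult[OF v] val_power[OF v])
  have "vge v (v lead + 1) (\<Sum>k\<in>{..n} - {i}. a k ^ Q * y ^ k)"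
  proof (rule vge_sum[OF v])
    fix k assume k: "k \<in> {..n} - {i}"
    show "vge v (v lead + 1) (a k ^ Q * y ^ k)"
    proof (cases "k \<in> U")
      case True
      then have "i < k" using i(2) k by (metis DiffD2 insertI1 le_neq_implies_less)
      then have "int (Suc i) * v y \<le> int k * v y" using y by (intro mult_right_mono) auto
      then show ?thesis using vyi[of k] y unfolding lead(2) by (auto intro: vge_mono simp: algebra_simps)
    next
      case False
      then show ?thesis using nonunit[of k] k iy unfolding lead(2) by (auto intro: vge_mono)
    qed
  qed
  moreover have "f = lead + (\<Sum>k\<in>{..n} - {i}. a k ^ Q * y ^ k)"
    unfolding fs lead_def using i(1) by (subst sum.remove[of _ i]) (auto simp: U_def)
  ultimately have "v f = int i * v y" using val_dominant(2)[OF v lead(1)] lead(2) by simp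
  then show ?thesis by simp
qed

text \<open>\<open>F\<close> is generated by \<open>t\<close> over \<open>F ^ p\<close>, so the
  \<open>p\<close>-th powers of a spanning set span again. The resulting equations for the
  \<open>b\<close> in terms of the \<open>l ^ p\<close> can be iterated.\<close>

lemma p_power_in_frac_span:
  assumes t: "p_indep t" and B: "finite B" "\<And>f. in_frac_span (peval t) B (\<lambda>b. b) f"
  shows "in_frac_span (peval t) B (\<lambda>b. b ^ p) f"
proof -
  note e = domain_embedding_peval[OF p_indep_nonconst[OF t]]
  have *: "in_frac_span (peval t) B (\<lambda>b. b ^ p) (a ^ p)" for a
  proof -
    obtain g c where gc: "g \<noteq> 0" "peval t g * a = (\<Sum>b\<in>B. peval t (c b) * b)"
      using B(2)[of a] unfolding in_frac_span_def by metis
    have "peval t (g ^ p) * a ^ p = (peval t g * a) ^ p" by (simp add: power_mult_distrib)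
    also have "\<dots> = (\<Sum>b\<in>B. peval t (c b ^ p) * b ^ p)" unfolding gc(2) sum_p by (simp add: power_mult_distrib)
    finally show ?thesis by (rule in_frac_spanI[rotated]) (use gc in simp)
  qed
  have eq: "f = (\<Sum>i<p. peval t (monom 1 i) * pcoef t f i ^ p)"
    using pcoef[OF t, of f] by (simp add: mult.commute)
  show ?thesis by (subst eq) (intro in_frac_span_sum[OF e] in_frac_span_scale[OF e] *)
qed

text \<open>The function \<open>y = t ^ p ^ R - t\<close> has derivative \<open>- 1\<close> and
  turns out to be a local parameter. Iterating the equations puts all of \<open>B\<close>, and then
  \<open>w * \<tau>\<close> for some polynomial \<open>w\<close> in \<open>t\<close>, into the ring
  generated by \<open>t\<close>, hence by \<open>y\<close>, over \<open>p ^ N\<close>-th powers.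
  There small values are multiples of \<open>v y\<close>; both \<open>v w\<close> and
  \<open>v w + 1\<close> are such values, so \<open>v y = 1\<close>.\<close>

lemma kappa_eq_0:
  assumes t: "p_indep t" and B: "finite B" "\<And>f. in_frac_span (peval t) B (\<lambda>b. b) f"
    and G: "\<And>b. b \<in> B \<Longrightarrow> G b \<noteq> 0" "\<And>b. b \<in> B \<Longrightarrow> peval t (G b) * b = (\<Sum>l\<in>B. peval t (C b l) * l ^ p)"
    and v: "place v" "vge v 0 t" "\<And>b. b \<in> B \<Longrightarrow> vge v 0 b" "\<And>b. b \<in> B \<Longrightarrow> v (peval t (G b)) \<le> 0"
  shows "kappa t v = 0"
proof -
  note tr = p_indep_nonconst[OF t]
  note S = subring_pow_ring[OF v(1)]
  define E where "E = (\<lambda>N y. adjoin (pow_ring v N) y)"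
  have E: "subring_of (E N y)" for N y unfolding E_def by (rule subring_adjoin[OF S])
  note ED = subring_ofD[OF E]
  have powE: "a ^ p ^ N \<in> E N y" if "vge v 0 a" for a N y
    unfolding E_def using that by (intro subset_adjoin[OF S]) (auto simp: pow_ring_def)
  have yE: "y \<in> E N y" for N y unfolding E_def by (rule mem_adjoin[OF S])
  have constE: "\<iota> a \<in> E N y" for a N y
  proof -
    obtain b where "b ^ p ^ N = a" using const_p_power by blast
    then have "\<iota> a = \<iota> b ^ p ^ N" by (simp flip: emb_power)
    then show ?thesis using powE[OF vge_const[OF v(1)], of b N y] by simp
  qed
  have pevalE: "peval t r \<in> E N t" for r N
    unfolding peval_eq_sum[OF order_refl] by (intro ED(8) ED(4) ED(7) constE yE)
  have BE: "\<forall>b\<in>B. b \<in> E N t" for N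
  proof (induction N)
    case 0
    show ?case using powE[of _ 0 t] v(3) by simp
  next
    case (Suc N)
    have pE: "l ^ p \<in> E (Suc N) t" if lB: "l \<in> B" for l
    proof -
      obtain r where r: "l = poly r t" "\<forall>i. coeff r i \<in> pow_ring v N"
        using bspec[OF Suc lB] unfolding E_def adjoin_def by auto
      have "coeff r i ^ p \<in> E (Suc N) t" for i
      proof -
        have "coeff r i \<in> pow_ring v N" using r(2) by simp
        then obtain a where "coeff r i = a ^ p ^ N" "vge v 0 a" unfolding pow_ring_def by auto
        then show ?thesis using powE[of a "Suc N" t] by (simp add: power_mult[symmetric] mult.commute)
      qed
      then have "(\<Sum>i\<le>degree r. coeff r i ^ p * (t ^ i) ^ p) \<in> E (Suc N) t"
        by (intro ED(8) ED(4)[OF _ ED(7)[OF ED(7)[OF yE]]])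
      moreover have "l ^ p = (\<Sum>i\<le>degree r. coeff r i ^ p * (t ^ i) ^ p)"
        unfolding r(1) poly_altdef sum_p by (simp add: power_mult_distrib)
      ultimately show ?thesis by simp
    qed
    show ?case
    proof
      fix b assume b: "b \<in> B"
      define w where "w = peval t (G b)"
      define Q where "Q = p ^ Suc N"
      have w: "w \<noteq> 0" "v w = 0"
        using G(1)[OF b] peval_eq_0_iff[OF tr] vge_peval[OF v(1,2), of "G b"] v(4)[OF b] by (auto simp: w_def vge_def)
      \<comment> \<open>\<open>w\<close> is a unit at \<open>v\<close>, so this writes its inverse
        as a product of two elements of the ring.\<close>
      have "inverse w = inverse w ^ Q * w ^ (Q - 1)"
      proof -
        have "0 < Q" using p_pos by (simp add: Q_def)
        then have "w ^ Q = w * w ^ (Q - 1)" by (simp add: power_eq_if)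
        then show ?thesis using w(1) by (simp add: power_inverse field_simps)
      qed
      moreover have "inverse w ^ Q \<in> E (Suc N) t"
        unfolding Q_def using w by (intro powE) (simp add: vge_def val_inverse[OF v(1)])
      moreover have "w ^ (Q - 1) \<in> E (Suc N) t" unfolding w_def by (intro ED(7) pevalE)
      ultimately have "inverse w \<in> E (Suc N) t" using ED(4) by metis
      moreover have "w * b \<in> E (Suc N) t"
        unfolding w_def G(2)[OF b] by (intro ED(8) ED(4) pevalE pE)
      ultimately have "inverse w * (w * b) \<in> E (Suc N) t" by (rule ED(4))
      moreover have "inverse w * (w * b) = b" using w(1) by (simp flip: mult.assoc)
      ultimately show "b \<in> E (Suc N) t" by metis
    qed
  qed
  obtain \<tau> where \<tau>: "v \<tau> = 1" "\<tau> \<noteq> 0" using local_parameter[OF v(1)] .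
  obtain g a where g: "g \<noteq> 0" "peval t g * \<tau> = (\<Sum>b\<in>B. peval t (a b) * b)"
    using B(2)[of \<tau>] unfolding in_frac_span_def by metis
  define w where "w = peval t g"
  have w: "w \<noteq> 0" "0 \<le> v w"
    using g(1) peval_eq_0_iff[OF tr] vge_peval[OF v(1,2), of g] by (auto simp: w_def vge_def)
  have w\<tau>: "w * \<tau> \<in> E N t" for N unfolding w_def g(2) using BE by (intro ED(8) ED(4) pevalE) blast
  \<comment> \<open>Chosen so that \<open>v w + 1 < N < p ^ N\<close>.\<close>
  define N where "N = Suc (Suc (nat (v w)))"
  \<comment> \<open>The factorial makes \<open>y\<close> vanish at \<open>v\<close>; the factor
    \<open>N\<close> makes \<open>t ^ p ^ R\<close> a \<open>p ^ N\<close>-th power.\<close>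
  define R where "R = fact (CARD('k) ^ place_degree \<iota> v) * N"
  define y where "y = t ^ p ^ R - t"
  have NR: "N \<le> R" unfolding R_def by (simp add: Suc_le_eq)
  have "0 < R" using NR by (simp add: N_def)
  then have y0: "y \<noteq> 0" unfolding y_def by (rule frobenius_poly_nonzero[OF tr])
  have "vge v 1 y" unfolding y_def R_def by (rule frobenius_residue[OF v(1) order_refl v(2)])
  then have vy: "0 < v y" using y0 by (simp add: vge_def)
  have "t ^ p ^ R = (t ^ p ^ (R - N)) ^ p ^ N" using NR by (simp flip: power_mult power_add)
  then have "t ^ p ^ R \<in> E N y" using powE[OF vge_power[OF v(1,2)]] by metis
  then have "t ^ p ^ R - y \<in> E N y" using yE by (rule ED(3))
  then have "t \<in> E N y" by (simp add: y_def)
  then have sub: "E N t \<subseteq> E N y"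
    unfolding E_def using subset_adjoin[OF S] by (intro adjoin_subset[OF subring_adjoin[OF S]]) auto
  have "N < p ^ N" using p_pos(2) by (intro power_gt_expt) simp
  then have "int N < int (p ^ N)" by (simp only: of_nat_less_iff)
  moreover have "v w + 1 < int N" using w(2) by (simp add: N_def)
  ultimately have lt: "v w + 1 < int (p ^ N)" by linarith
  have vw\<tau>: "v (w * \<tau>) = v w + 1" using w \<tau> by (simp add: val_mult[OF v(1)])
  have "v y dvd v w"
    using pevalE[of g N] sub w lt by (intro val_adjoin_pow_ring[OF v(1) vy, of w N]) (auto simp: w_def E_def)
  moreover have "v y dvd v (w * \<tau>)"
    using w\<tau>[of N] sub w \<tau> lt vw\<tau> by (intro val_adjoin_pow_ring[OF v(1) vy, of _ N]) (auto simp: E_def)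
  ultimately have "v y dvd 1" unfolding vw\<tau> by (simp add: dvd_add_right_iff)
  then have vy1: "v y = 1" using vy by simp
  have "pder t (t ^ p ^ R) = 0"
  proof -
    obtain R' where "R = Suc R'" using \<open>0 < R\<close> by (cases R) auto
    then show ?thesis by (simp add: pder_self_power[OF t])
  qed
  then have "pder t y = - 1"
    using pder_add[OF t, of "t ^ p ^ R" "- t"] pder_minus[OF t, of t] pder_self[OF t] by (simp add: y_def)
  then show ?thesis using kappa[OF t v(1) vy1] val_minus[OF v(1), of 1] val_1[OF v(1)] by simp
qed

lemma finite_kappa:
  assumes t: "p_indep t"
  shows "finite {v. place v \<and> kappa t v \<noteq> 0}"
proof -
  note tr = p_indep_nonconst[OF t]
  obtain B where B: "finite B" "\<And>f. in_frac_span (peval t) B (\<lambda>b. b) f" using function_field_basis[OF tr] by metis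
  have "\<forall>b. \<exists>g c. g \<noteq> 0 \<and> peval t g * b = (\<Sum>l\<in>B. peval t (c l) * l ^ p)"
    using p_power_in_frac_span[OF t B] unfolding in_frac_span_def by simp
  then obtain G C where G: "\<And>b. G b \<noteq> 0" "\<And>b. peval t (G b) * b = (\<Sum>l\<in>B. peval t (C b l) * l ^ p)" by metis
  let ?bad = "{v. place v \<and> v t < 0} \<union> (\<Union>b\<in>B. {v. place v \<and> v b < 0}) \<union>
      (\<Union>b\<in>B. {v. place v \<and> 0 < v (peval t (G b))})"
  have "{v. place v \<and> kappa t v \<noteq> 0} \<subseteq> ?bad"
  proof
    fix v assume v: "v \<in> {v. place v \<and> kappa t v \<noteq> 0}"
    show "v \<in> ?bad"
    proof (rule ccontr)
      assume no: "v \<notin> ?bad"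
      have pv: "place v" using v by simp
      have "kappa t v = 0"
      proof (rule kappa_eq_0[OF t B])
        show "place v" by (rule pv)
        show "vge v 0 t" using no pv by (simp add: vge_def)
        show "vge v 0 b" if "b \<in> B" for b using no pv that by (force simp: vge_def)
        show "v (peval t (G b)) \<le> 0" if "b \<in> B" for b using no pv that by force
      qed (use G in simp_all)
      then show False using v by simp
    qed
  qed
  moreover have "finite ?bad" using B(1) finite_poles finite_zeros by simp
  ultimately show ?thesis by (rule finite_subset)
qed

section \<open>Semilinear independence\<close>

text \<open>The shortest relation, normalized to have a coefficient \<open>1\<close>, agrees with its image
  under \<open>\<phi>\<close>.\<close>

lemma semilinear_relation:
  fixes \<phi> :: "'f \<Rightarrow> 'f" and g :: "'i \<Rightarrow> 'f"
  assumes add: "\<And>f f'. \<phi> (f + f') = \<phi> f + \<phi> f'" and scale: "\<And>b f. \<phi> (\<iota> b ^ p ^ e * f) = \<iota> b * \<phi> f"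
    and fixed: "\<And>i. i \<in> I \<Longrightarrow> \<phi> (g i) = g i" and I: "finite I"
    and rel: "(\<Sum>i\<in>I. \<iota> (b i) * g i) = 0" "\<exists>i\<in>I. b i \<noteq> 0"
  shows "\<exists>c. (\<Sum>i\<in>I. \<iota> (c i) * g i) = 0 \<and> (\<exists>i\<in>I. c i \<noteq> 0) \<and> (\<forall>i\<in>I. c i ^ p ^ e = c i)"
proof -
  have \<phi>0: "\<phi> 0 = 0" using add[of 0 0] by (simp only: add_0_right add_cancel_right_right)
  have \<phi>_sum: "\<phi> (\<Sum>i\<in>I. f i) = (\<Sum>i\<in>I. \<phi> (f i))" for f :: "'i \<Rightarrow> 'f"
    by (induction I rule: infinite_finite_induct) (auto simp: \<phi>0 add)
  let ?P = "\<lambda>b. (\<Sum>i\<in>I. \<iota> (b i) * g i) = 0 \<and> (\<exists>i\<in>I. b i \<noteq> 0)"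
  obtain c where c: "?P c" and min: "\<And>b. ?P b \<Longrightarrow> card {i \<in> I. c i \<noteq> 0} \<le> card {i \<in> I. b i \<noteq> 0}"
    using ex_has_least_nat[of ?P b "\<lambda>b. card {i \<in> I. b i \<noteq> 0}"] rel by blast
  obtain k where k: "k \<in> I" "c k \<noteq> 0" using c by blast
  define a where "a = (\<lambda>i. c i / c k)"
  have a_rel: "(\<Sum>i\<in>I. \<iota> (a i) * g i) = 0"
  proof -
    have "(\<Sum>i\<in>I. \<iota> (a i) * g i) = \<iota> (inverse (c k)) * (\<Sum>i\<in>I. \<iota> (c i) * g i)"
      by (simp add: a_def divide_inverse sum_distrib_left mult_ac)
    then show ?thesis using c by simp
  qed
  have ak: "a k = 1" using k by (simp add: a_def)
  have "\<forall>i. \<exists>b. b ^ p ^ e = a i" using const_p_power by blast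
  then obtain a' where a': "\<And>i. a' i ^ p ^ e = a i" by metis
  have "a' k = 1"
  proof -
    have "\<iota> (a' k) ^ p ^ e = 1 ^ p ^ e" using a'[of k] ak by (simp flip: emb_power)
    then have "\<iota> (a' k) = 1" unfolding p_power_inject .
    then show ?thesis using emb_eq_iff[of "a' k" 1] by simp
  qed
  \<comment> \<open>\<open>\<phi>\<close> replaces the coefficients by their \<open>p ^ e\<close>-th
    roots and fixes the \<open>g i\<close>.\<close>
  have "(\<Sum>i\<in>I. \<iota> (a' i) * g i) = \<phi> (\<Sum>i\<in>I. \<iota> (a i) * g i)"
    unfolding \<phi>_sum by (intro sum.cong) (simp_all add: a'[symmetric] scale fixed)
  then have a'_rel: "(\<Sum>i\<in>I. \<iota> (a' i) * g i) = 0" using a_rel \<phi>0 by simp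
  have eq: "a i = a' i" if i: "i \<in> I" for i
  proof (rule ccontr)
    assume ne: "a i \<noteq> a' i"
    have "(\<Sum>i\<in>I. \<iota> (a i - a' i) * g i) = 0"
      using a_rel a'_rel by (simp add: left_diff_distrib sum_subtractf)
    then have "card {i \<in> I. c i \<noteq> 0} \<le> card {i \<in> I. a i - a' i \<noteq> 0}" using ne i by (intro min) auto
    \<comment> \<open>The difference of the two relations loses the index \<open>k\<close> and gains
      none.\<close>
    moreover have "{i \<in> I. a i - a' i \<noteq> 0} \<subset> {i \<in> I. c i \<noteq> 0}"
    proof
      have "a i - a' i = 0" if "c i = 0" for i
      proof -
        have "a i = 0" using that by (simp add: a_def)
        moreover have "a' i = 0" using a'[of i] \<open>a i = 0\<close> by simp
        ultimately show ?thesis by simp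
      qed
      then show "{i \<in> I. a i - a' i \<noteq> 0} \<subseteq> {i \<in> I. c i \<noteq> 0}" by blast
      have "k \<notin> {i \<in> I. a i - a' i \<noteq> 0}" "k \<in> {i \<in> I. c i \<noteq> 0}" using k ak \<open>a' k = 1\<close> by auto
      then show "{i \<in> I. a i - a' i \<noteq> 0} \<noteq> {i \<in> I. c i \<noteq> 0}" by blast
    qed
    then have "card {i \<in> I. a i - a' i \<noteq> 0} < card {i \<in> I. c i \<noteq> 0}"
      by (rule psubset_card_mono[rotated]) (use I in simp)
    ultimately show False by simp
  qed
  have "a i ^ p ^ e = a i" if "i \<in> I" for i using a'[of i] eq[OF that] by simp
  then show ?thesis using a_rel k(1) ak by (intro exI[of _ a] conjI bexI[of _ k] ballI) simp_all
qed

text \<open>The elements \<open>of_nat n\<close> with \<open>n < p\<close> are \<open>p\<close>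
  distinct roots of \<open>X ^ p - X\<close>, which leaves room for no others.\<close>

lemma prime_field_elements:
  fixes b :: 'k
  assumes "b ^ p = b"
  obtains n where "n < p" "b = of_nat n"
proof -
  have nz: "of_nat n \<noteq> (0 :: 'k)" if "0 < n" "n < p" for n
    using of_nat_neq_0[OF that] emb_of_nat[of n] by force
  have "inj_on (\<lambda>n. of_nat n :: 'k) {..<p}"
  proof (rule inj_onI)
    have *: "m = n" if "m \<le> n" "n < p" "of_nat m = (of_nat n :: 'k)" for m n
    proof (rule ccontr)
      assume "m \<noteq> n"
      then have "of_nat (n - m) \<noteq> (0 :: 'k)" using that by (intro nz) auto
      then show False using that by (simp add: of_nat_diff)
    qed
    fix m n assume "m \<in> {..<p}" "n \<in> {..<p}" "of_nat m = (of_nat n :: 'k)"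
    then show "m = n" using *[of m n] *[of n m] by (cases "m \<le> n") auto
  qed
  then have "card ((\<lambda>n. of_nat n :: 'k) ` {..<p}) = p" by (simp add: card_image)
  moreover have "(of_nat n :: 'k) ^ p = of_nat n" for n
  proof -
    have "\<iota> ((of_nat n :: 'k) ^ p) = \<iota> (of_nat n)" using of_nat_p_power[of n] by simp
    then show ?thesis unfolding emb_eq_iff .
  qed
  ultimately have "b \<in> (\<lambda>n. of_nat n :: 'k) ` {..<p}"
    using p_pos assms by (intro card_fixed_powers[of p]) auto
  then show thesis using that by blast
qed

lemma dlog_prod:
  assumes t: "p_indep t" and f: "finite I" "\<And>i. i \<in> I \<Longrightarrow> f i \<noteq> 0"
  shows "pder t (\<Prod>i\<in>I. f i ^ n i) / (\<Prod>i\<in>I. f i ^ n i) = (\<Sum>i\<in>I. of_nat (n i) * (pder t (f i) / f i))"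
  using f
proof (induction I rule: finite_induct)
  case (insert i I)
  let ?g = "\<Prod>i\<in>I. f i ^ n i"
  have nz: "f i \<noteq> 0" "?g \<noteq> 0" using insert by auto
  have "pder t (f i ^ n i) / f i ^ n i = of_nat (n i) * (pder t (f i) / f i)"
  proof (cases "n i")
    case (Suc k)
    have "pder t (f i ^ Suc k) = of_nat (Suc k) * f i ^ k * pder t (f i)"
      by (simp only: pder_power[OF t] diff_Suc_1)
    then show ?thesis unfolding Suc using nz(1) by (simp del: of_nat_Suc)
  qed (simp add: pder_1[OF t])
  moreover have "pder t (f i ^ n i * ?g) / (f i ^ n i * ?g) = pder t (f i ^ n i) / f i ^ n i + pder t ?g / ?g"
    using nz by (simp add: pder_mult[OF t] add_divide_distrib)
  ultimately show ?case using insert by simp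
qed (simp add: pder_1[OF t])

text \<open>By \<open>semilinear_relation\<close> for \<open>Cop t\<close>, a relation over
  \<open>K\<close> gives one over the prime field, whose coefficients lift to exponents
  \<open>n i < p\<close>. Then the product of the \<open>f i ^ n i\<close> has derivative
  \<open>0\<close> and is a \<open>p\<close>-th power, so all \<open>n i\<close> vanish.\<close>

lemma dlog_independent:
  fixes f :: "nat \<Rightarrow> 'f"
  assumes t: "p_indep t" and f: "\<And>i. i < r \<Longrightarrow> f i \<noteq> 0"
    and ind: "\<And>n g i. (\<And>i. n i < p) \<Longrightarrow> (\<Prod>i<r. f i ^ n i) = g ^ p \<Longrightarrow> i < r \<Longrightarrow> n i = 0"
    and rel: "(\<Sum>i<r. \<iota> (b i) * (pder t (f i) / f i)) = 0" and i: "i < r"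
  shows "b i = 0"
proof (rule ccontr)
  assume "b i \<noteq> 0"
  define g where "g = (\<lambda>i. pder t (f i) / f i)"
  have "\<exists>c. (\<Sum>i\<in>{..<r}. \<iota> (c i) * g i) = 0 \<and> (\<exists>i\<in>{..<r}. c i \<noteq> 0) \<and> (\<forall>i\<in>{..<r}. c i ^ p ^ 1 = c i)"
  proof (rule semilinear_relation[of "Cop t"])
    show "Cop t (\<iota> b ^ p ^ 1 * f) = \<iota> b * Cop t f" for b f using Cop_scale[OF t] by simp
    show "Cop t (g i) = g i" for i unfolding g_def by (rule Cop_dlog[OF t])
    show "(\<Sum>i<r. \<iota> (b i) * g i) = 0" using rel by (simp only: g_def)
  qed (use Cop_add[OF t] i \<open>b i \<noteq> 0\<close> in auto)
  then obtain c where c: "(\<Sum>i<r. \<iota> (c i) * g i) = 0" "\<exists>i<r. c i \<noteq> 0" "\<And>i. i < r \<Longrightarrow> c i ^ p = c i" by auto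
  have "\<exists>n. n < p \<and> (i < r \<longrightarrow> c i = of_nat n)" for i
    using prime_field_elements[OF c(3), of i] p_pos(1) by metis
  then obtain n where n: "\<And>i. n i < p" "\<And>i. i < r \<Longrightarrow> c i = of_nat (n i)" by metis
  define h where "h = (\<Prod>i<r. f i ^ n i)"
  have h: "h \<noteq> 0" using f by (simp add: h_def)
  have "(\<Sum>i<r. of_nat (n i) * g i) = (\<Sum>i<r. \<iota> (c i) * g i)" using n(2) by (intro sum.cong) auto
  then have "pder t h / h = 0" using dlog_prod[OF t, of "{..<r}" f n] f c(1) by (simp add: h_def g_def)
  then have "pder t h = 0" using h by simp
  then obtain a where "h = a ^ p" using pder_eq_0_imp_p_power[OF t] by blast
  then have "n i = 0" if "i < r" for i using ind[of n a i] n(1) that unfolding h_def by simp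
  then show False using c(2) n(2) by auto
qed

section \<open>Counting forms and fixed forms\<close>

lemma card_le_card_vge_places:
  assumes "finite T" "\<And>v. v \<in> T \<Longrightarrow> place v" and X: "finite X" "\<And>f g. f \<in> X \<Longrightarrow> g \<in> X \<Longrightarrow> f - g \<in> X"
    and a: "\<And>v f. v \<in> T \<Longrightarrow> f \<in> X \<Longrightarrow> vge v (a v) f"
  shows "card X \<le> card {f \<in> X. \<forall>v\<in>T. vge v (a v + int (n v)) f} * CARD('k) ^ (\<Sum>v\<in>T. n v * pdeg v)"
  using assms(1,2) a
proof (induction T rule: finite_induct)
  case (insert v T)
  define Y where "Y = {f \<in> X. \<forall>v\<in>T. vge v (a v + int (n v)) f}"
  have eq: "{f \<in> Y. vge v (a v + int (n v)) f} = {f \<in> X. \<forall>v\<in>insert v T. vge v (a v + int (n v)) f}"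
    by (auto simp: Y_def)
  have pv: "place v" using insert by blast
  have "f - g \<in> Y" if "f \<in> Y" "g \<in> Y" for f g
    using that X(2) insert.prems(1) vge_diff unfolding Y_def by blast
  then have "card Y \<le> card {f \<in> Y. vge v (a v + int (n v)) f} * CARD('k) ^ (n v * pdeg v)"
    using X(1) insert.prems(2) by (intro conjunct2[OF card_le_card_vge[OF pv]]) (auto simp: Y_def)
  moreover have "card X \<le> card Y * CARD('k) ^ (\<Sum>v\<in>T. n v * pdeg v)"
    unfolding Y_def using insert by (intro insert.IH) auto
  ultimately have "card X \<le> card {f \<in> Y. vge v (a v + int (n v)) f} * CARD('k) ^ (n v * pdeg v) *
      CARD('k) ^ (\<Sum>v\<in>T. n v * pdeg v)"
    by (meson le_trans mult_le_mono1)
  then show ?case unfolding eq using insert by (simp add: power_add mult.assoc)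
qed simp

lemma finite_form_space:
  assumes kd: "kaehler_differentials \<iota> smul d" and t: "p_indep t"
  shows "finite (form_space \<iota> smul d A)"
proof -
  \<comment> \<open>In the coordinate \<open>t\<close>, \<open>\<Omega>(A)\<close> becomes the
    Riemann-Roch space of \<open>- A - kappa t\<close>, and \<open>finite_kappa\<close> leaves
    finitely many positive coefficients.\<close>
  define A' where "A' = (\<lambda>v. - (Poly_Mapping.lookup A v + kappa t v))"
  have "{v. place v \<and> 0 < A' v} \<subseteq> Poly_Mapping.keys A \<union> {v. place v \<and> kappa t v \<noteq> 0}"
    by (auto simp: A'_def in_keys_iff)
  then have fin: "finite (Lsp A')" using finite_kappa[OF t] by (intro finite_Lsp) (meson finite_UnI finite_keys finite_subset)
  have "form_space \<iota> smul d A \<subseteq> (\<lambda>g. smul g (d t)) ` Lsp A'"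
  proof
    fix \<omega> assume \<omega>: "\<omega> \<in> form_space \<iota> smul d A"
    obtain g where g: "\<omega> = smul g (d t)" using form_exists[OF kd t] by blast
    then have "g \<in> Lsp A'"
      using \<omega> form_space_iff[OF kd t, of g A] by (simp only: Lsp_def A'_def minus_minus mem_Collect_eq)
    then show "\<omega> \<in> (\<lambda>g. smul g (d t)) ` Lsp A'" using g by blast
  qed
  then show ?thesis using fin finite_surj by blast
qed

lemma Cop_iter_add: "p_indep t \<Longrightarrow> (Cop t ^^ m) (f + g) = (Cop t ^^ m) f + (Cop t ^^ m) g"
  by (induction m) (simp_all add: Cop_add)

lemma Cop_iter_scale: "p_indep t \<Longrightarrow> (Cop t ^^ m) (a ^ p ^ m * f) = a * (Cop t ^^ m) f"
proof (induction m arbitrary: a f)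
  case (Suc m)
  have eq: "a ^ p ^ Suc m * f = (a ^ p) ^ p ^ m * f" by (simp add: power_mult)
  have "(Cop t ^^ m) (a ^ p ^ Suc m * f) = a ^ p * (Cop t ^^ m) f"
    unfolding eq by (rule Suc.IH[OF Suc.prems])
  then show ?case using Cop_scale[OF Suc.prems] by simp
qed simp

lemma Cop_iter_fixed: "Cop t f = f \<Longrightarrow> (Cop t ^^ m) f = f"
  by (induction m) simp_all

lemma cartier_iter_form:
  assumes "kaehler_differentials \<iota> smul d" "p_indep t"
  shows "(cartier p \<iota> smul d ^^ m) (smul g (d t)) = smul ((Cop t ^^ m) g) (d t)"
  by (induction m) (simp_all add: cartier_form[OF assms])

text \<open>\<open>K\<close> is the set of coordinates of the forms. A basis of its span over the
  field with \<open>q\<close> elements remains independent over all constants: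
  \<open>semilinear_relation\<close> for the \<open>m\<close>-th iterate would give a relation with
  coefficients fixed by the \<open>q\<close>-th power, hence in \<open>range j\<close>.\<close>

lemma card_fixed_forms_le:
  fixes j :: "'e::field \<Rightarrow> 'k"
  assumes kd: "kaehler_differentials \<iota> smul d" and t: "p_indep t"
    and q: "CARD('e) = p ^ m" "1 \<le> m" and j: "field_embedding j"
    and K: "\<And>f g. f \<in> K \<Longrightarrow> g \<in> K \<Longrightarrow> f - g \<in> K" "\<And>f. f \<in> K \<Longrightarrow> (Cop t ^^ m) f = f"
    and A: "\<And>f. f \<in> K \<Longrightarrow> smul f (d t) \<in> form_space \<iota> smul d A"
  shows "card K \<le> CARD('e) ^ h1 \<iota> smul d A"
proof -
  have fine: "finite (UNIV :: 'e set)" using q p_pos by (intro card_ge_0_finite) simp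
  note jD = field_embedding_simps[OF j]
  have injj: "inj j" by (simp add: inj_def jD)
  have range_j: "b \<in> range j" if "b ^ p ^ m = b" for b
  proof (rule card_fixed_powers[of "p ^ m"])
    show "1 < p ^ m" using p_pos q(2) by (intro one_less_power) auto
    show "card (range j) = p ^ m" using card_image[OF injj] q(1) by simp
    fix a assume "a \<in> range j"
    then obtain c where "a = j c" by blast
    then show "a ^ p ^ m = a" using power_card_field[OF fine, of c] q(1) jD(9)[of c "p ^ m"] by simp
  qed (use fine that in auto)
  define sc where "sc = (\<lambda>(a :: 'e) f. \<iota> (j a) * f)"
  have vs: "vector_space sc"
    by unfold_locales (simp_all add: sc_def jD distrib_left distrib_right)
  interpret V: vector_space sc by (rule vs)
  have vk: "vector_space (\<lambda>a. smul (\<iota> a))"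
    by (rule vector_space_restrict_scalars[OF embedding smul_vs[OF kd t]])
  interpret W: vector_space "\<lambda>a. smul (\<iota> a)" by (rule vk)
  interpret S: vector_space smul by (rule smul_vs[OF kd t])
  have finA: "finite (form_space \<iota> smul d A)" by (rule finite_form_space[OF kd t])
  let ?\<delta> = "\<lambda>f. smul f (d t)"
  have inj\<delta>: "inj ?\<delta>" using form_eq_iff[OF kd t] by (auto simp: inj_def)
  have finK: "finite K"
    using A finA finite_imageD[of ?\<delta> K] inj\<delta> by (meson finite_subset image_subsetI inj_on_subset subset_UNIV)
  obtain B where B: "B \<subseteq> K" "V.independent B" "K \<subseteq> V.span B" "card B = V.dim K"
    using V.basis_exists by blast
  have finB: "finite B" using B(1) finK finite_subset by blast
  have indB: "\<forall>f\<in>B. b f = 0" if rel: "(\<Sum>f\<in>B. \<iota> (b f) * f) = 0" for b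
  proof (rule ccontr)
    assume "\<not> ?thesis"
    then have "\<exists>c. (\<Sum>f\<in>B. \<iota> (c f) * f) = 0 \<and> (\<exists>f\<in>B. c f \<noteq> 0) \<and> (\<forall>f\<in>B. c f ^ p ^ m = c f)"
      using rel finB Cop_iter_add[OF t] Cop_iter_scale[OF t] K(2) B(1)
      by (intro semilinear_relation[of "Cop t ^^ m"]) auto
    then obtain c where c: "(\<Sum>f\<in>B. \<iota> (c f) * f) = 0" "\<exists>f\<in>B. c f \<noteq> 0" "\<forall>f\<in>B. c f ^ p ^ m = c f" by blast
    then have "\<forall>f\<in>B. \<exists>a. c f = j a" using range_j by blast
    then obtain a where a: "\<And>f. f \<in> B \<Longrightarrow> c f = j (a f)" by metis
    have "(\<Sum>f\<in>B. sc (a f) f) = 0" using c(1) a by (simp add: sc_def)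
    then have "\<forall>f\<in>B. a f = 0" using V.independentD[OF B(2) finB order_refl, of a] by blast
    then show False using c(2) a jD(1) by auto
  qed
  have indW: "W.independent (?\<delta> ` B)"
  proof (rule W.independent_if_scalars_zero)
    show "finite (?\<delta> ` B)" using finB by simp
    fix u x assume u: "(\<Sum>x\<in>?\<delta> ` B. smul (\<iota> (u x)) x) = 0" and x: "x \<in> ?\<delta> ` B"
    have "(\<Sum>x\<in>?\<delta> ` B. smul (\<iota> (u x)) x) = (\<Sum>f\<in>B. smul (\<iota> (u (?\<delta> f)) * f) (d t))"
      by (subst sum.reindex[OF inj_on_subset[OF inj\<delta> subset_UNIV]]) (simp add: smul_assoc[OF kd t])
    also have "\<dots> = smul (\<Sum>f\<in>B. \<iota> (u (?\<delta> f)) * f) (d t)" by (simp add: S.scale_sum_left)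
    finally have "(\<Sum>f\<in>B. \<iota> (u (?\<delta> f)) * f) = 0" using u form_eq_0_iff[OF kd t] by simp
    then have "\<forall>f\<in>B. u (?\<delta> f) = 0" by (rule indB)
    then show "u x = 0" using x by blast
  qed
  have "?\<delta> ` B \<subseteq> form_space \<iota> smul d A" using A B(1) by blast
  then have "card (?\<delta> ` B) \<le> h1 \<iota> smul d A"
    unfolding h1_def by (rule dim_mono_independent[OF vk finA _ indW])
  moreover have "card (?\<delta> ` B) = card B" by (rule card_image[OF inj_on_subset[OF inj\<delta> subset_UNIV]])
  ultimately have "V.dim K \<le> h1 \<iota> smul d A" using B(4) by simp
  then have "CARD('e) ^ V.dim K \<le> CARD('e) ^ h1 \<iota> smul d A"
    using fine by (intro power_increasing) (simp_all add: Suc_le_eq card_gt_0_iff)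
  then show ?thesis using card_le_power_dim[OF vs fine finK] by linarith
qed

end

theorem theorem6p3:
  fixes p m q l :: nat
    and j :: "'e::field \<Rightarrow> 'k::field"
    and \<iota> :: "'k \<Rightarrow> 'f::field"
    and smul :: "'f \<Rightarrow> 'w::ab_group_add \<Rightarrow> 'w"
    and d :: "'f \<Rightarrow> 'w"
    and P :: "'n::finite \<Rightarrow> 'f place"
    and G Gp Gm :: "'f divisor"
  assumes "prime p" "m \<ge> 1" "q = p ^ m" "l \<ge> 1"
    and "CARD('e) = q" "CARD('k) = q ^ l" "field_embedding j"
    and "curve_function_field \<iota>" "kaehler_differentials \<iota> smul d"
    and "inj P" "\<And>i. rational_place \<iota> (P i)"
    and "is_divisor \<iota> G" "\<And>i. P i \<notin> Poly_Mapping.keys G"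
    and "positive_divisor \<iota> Gp" "positive_divisor \<iota> Gm" "G = Gp - Gm"
    and "reduced_divisor Gm"
    and "Poly_Mapping.keys Gp \<inter> Poly_Mapping.keys Gm = {}"
    and "Poly_Mapping.keys Gp \<inter> Poly_Mapping.keys (point_divisor P) = {}"
    and "Poly_Mapping.keys Gm \<inter> Poly_Mapping.keys (point_divisor P) = {}"
  shows "int (vector_space.dim (\<lambda>(a::'e) w. j a *s w) (cartier_code p m \<iota> smul d P G))
           \<ge> int CARD('n) - 1 + int (card (Poly_Mapping.keys Gm))
             - int l * divisor_degree \<iota> Gp - int (h1 \<iota> smul d G)"
proof -
  have q1: "1 < q" unfolding assms(3) using assms(2) prime_gt_1_nat[OF assms(1)] by (intro one_less_power) auto
  have fine: "finite (UNIV :: 'e set)" and fink: "finite (UNIV :: 'k set)"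
    using assms(5,6) q1 by (auto intro!: card_ge_0_finite)
  \<comment> \<open>The characteristic is read off from the number \<open>p ^ (m * l)\<close> of
    constants.\<close>
  have "of_nat p ^ (m * l) = (0 :: 'k)"
    using of_nat_card_field[OF fink] assms(3,6) by (simp flip: power_mult of_nat_power)
  then have "of_nat p = (0 :: 'k)" by simp
  then interpret function_field p \<iota>
    by unfold_locales (use assms(1,8) fink in auto)
  note kd = assms(9)
  have PP: "place (P i)" "place_degree \<iota> (P i) = 1" for i
    using assms(11)[of i] unfolding rational_place_def by auto
  \<comment> \<open>The index type is nonempty, so \<open>undefined\<close> picks one of the points.
    A local parameter there becomes the global coordinate; the same point is the base place of the
    units below.\<close>
  obtain t where t1: "P undefined t = 1" using local_parameter[OF PP(1)] .
  have t: "p_indep t" by (rule p_indep_local_parameter[OF PP(1) t1])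
  have lookup_P: "Poly_Mapping.lookup (point_divisor P) v = (if v \<in> range P then 1 else 0)" for v
  proof -
    have "Poly_Mapping.lookup (point_divisor P) v = (\<Sum>i\<in>UNIV. if P i = v then 1 else 0)"
      unfolding point_divisor_def by (simp add: lookup_sum lookup_single when_def eq_commute[of v])
    also have "\<dots> = int (card {i. P i = v})" by (simp add: sum.If_cases)
    also have "card {i. P i = v} = (if v \<in> range P then 1 else 0)"
    proof (cases "v \<in> range P")
      case True
      then obtain i where "v = P i" by blast
      then have "{i. P i = v} = {i}" using assms(10) by (auto simp: inj_def)
      then show ?thesis using True by simp
    next
      case False
      then have "{i. P i = v} = {}" by auto
      then show ?thesis using False by simp
    qed
    finally show ?thesis by simp
  qed
  have keys_P: "Poly_Mapping.keys (point_divisor P) = range P"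
    by (auto simp: in_keys_iff lookup_P split: if_splits)
  note disj = assms(18-20)[unfolded keys_P]
  have Gp: "\<And>v. v \<in> Poly_Mapping.keys Gp \<Longrightarrow> place v" "\<And>v. 0 \<le> Poly_Mapping.lookup Gp v"
    and Gm: "\<And>v. v \<in> Poly_Mapping.keys Gm \<Longrightarrow> place v"
      "\<And>v. Poly_Mapping.lookup Gm v = (if v \<in> Poly_Mapping.keys Gm then 1 else 0)"
    using assms(14,15,17) by (auto simp: positive_divisor_def is_divisor_def reduced_divisor_def in_keys_iff)
  have lookup_G: "Poly_Mapping.lookup G v = Poly_Mapping.lookup Gp v - Poly_Mapping.lookup Gm v" for v
    by (simp add: assms(16) lookup_minus)
  define S where "S = range P \<union> Poly_Mapping.keys Gm"
  have S: "finite S" "\<And>v. v \<in> S \<Longrightarrow> place v" "P undefined \<in> S" using PP Gm by (auto simp: S_def)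
  have cardS: "card S = CARD('n) + card (Poly_Mapping.keys Gm)"
    unfolding S_def using disj assms(10) by (subst card_Un_disjoint) (auto simp: card_image)
  obtain vs where vs: "set vs = S - {P undefined}" "distinct vs"
    using finite_distinct_list[of "S - {P undefined}"] S(1) by auto
  define r where "r = length vs"
  have r: "int r = int CARD('n) - 1 + int (card (Poly_Mapping.keys Gm))"
  proof -
    have "r = card (S - {P undefined})" using vs distinct_card by (fastforce simp: r_def)
    then have "CARD('n) + card (Poly_Mapping.keys Gm) = Suc r"
      using card_Suc_Diff1[OF S(1,3)] cardS by simp
    then show ?thesis by linarith
  qed
  have setS: "set (P undefined # vs) = S" using vs(1) S(3) by auto
  obtain f where f: "\<And>i. i < r \<Longrightarrow> f i \<noteq> 0"
    "\<And>i w. i < r \<Longrightarrow> place w \<Longrightarrow> w \<notin> S \<Longrightarrow> w (f i) = 0"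
    "\<And>n g i. (\<And>i. n i < p) \<Longrightarrow> (\<Prod>i<r. f i ^ n i) = g ^ p \<Longrightarrow> i < r \<Longrightarrow> n i = 0"
  proof (rule independent_units[of "P undefined" vs])
    show "distinct (P undefined # vs)" using vs by auto
    show "place v" if "v \<in> set (P undefined # vs)" for v using S(2)[of v] that unfolding setS .
  qed (unfold setS r_def[symmetric], blast)
  define g where "g = (\<lambda>i. pder t (f i) / f i)"
  define \<Phi> where "\<Phi> = (\<lambda>a :: nat \<Rightarrow> 'e. \<Sum>i<r. \<iota> (j (a i)) * g i)"
  \<comment> \<open>Extensional functions make the coordinates unique, so that \<open>W\<close> has
    exactly \<open>q ^ r\<close> elements.\<close>
  define W where "W = \<Phi> ` ({..<r} \<rightarrow>\<^sub>E UNIV)"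
  note jD = field_embedding_simps[OF assms(7)]
  have \<Phi>_diff: "\<Phi> a - \<Phi> b = \<Phi> (\<lambda>i. a i - b i)" for a b
    by (simp add: \<Phi>_def jD left_diff_distrib sum_subtractf)
  have WI: "\<Phi> a \<in> W" for a
  proof -
    have "\<Phi> a = \<Phi> (restrict a {..<r})" by (simp add: \<Phi>_def)
    then show ?thesis unfolding W_def by auto
  qed
  have inj\<Phi>: "inj_on \<Phi> ({..<r} \<rightarrow>\<^sub>E UNIV)"
  proof (rule inj_onI)
    fix a b assume ab: "a \<in> {..<r} \<rightarrow>\<^sub>E UNIV" "b \<in> {..<r} \<rightarrow>\<^sub>E UNIV" "\<Phi> a = \<Phi> b"
    then have rel: "(\<Sum>i<r. \<iota> (j (a i - b i)) * (pder t (f i) / f i)) = 0"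
      using \<Phi>_diff[of a b] by (simp only: \<Phi>_def g_def) simp
    have "j (a i - b i) = 0" if i: "i < r" for i
    proof (rule dlog_independent[OF t, where r = r and f = f and b = "\<lambda>i. j (a i - b i)"])
      show "f i \<noteq> 0" if "i < r" for i by (rule f(1)[OF that])
      show "n i = 0" if "\<And>i. n i < p" "(\<Prod>i<r. f i ^ n i) = g ^ p" "i < r" for n g i
        using f(3)[of n g i] that by blast
      show "(\<Sum>i<r. \<iota> (j (a i - b i)) * (pder t (f i) / f i)) = 0" by (rule rel)
    qed (rule i)
    then have "a i = b i" if "i < r" for i using that by (simp add: jD)
    then show "a = b" using ab by (intro PiE_ext) auto
  qed
  have finW: "finite W" unfolding W_def using fine by (intro finite_imageI finite_PiE) auto
  have cardW: "card W = q ^ r"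
    unfolding W_def using assms(5) by (simp add: card_image[OF inj\<Phi>] card_PiE)
  have W_diff: "x - y \<in> W" if xy: "x \<in> W" "y \<in> W" for x y
  proof -
    obtain a b where "x = \<Phi> a" "y = \<Phi> b" using xy unfolding W_def by blast
    then show ?thesis using \<Phi>_diff WI by simp
  qed
  have W_fixed: "(Cop t ^^ m) x = x" if x: "x \<in> W" for x
  proof -
    obtain a where a: "x = \<Phi> a" using x unfolding W_def by blast
    have sum: "(Cop t ^^ m) (\<Sum>i\<in>I. u i) = (\<Sum>i\<in>I. (Cop t ^^ m) (u i))" if "finite I" for I :: "nat set" and u
      using that Cop_iter_scale[OF t, of m 0 0]
      by (induction I rule: finite_induct) (auto simp: Cop_iter_add[OF t])
    have "(Cop t ^^ m) (\<iota> (j (a i)) * g i) = \<iota> (j (a i)) * g i" for i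
    proof -
      have "j (a i) ^ p ^ m = j (a i)"
        using power_card_field[OF fine, of "a i"] assms(3,5) jD(9)[of "a i" "p ^ m"] by simp
      then have "\<iota> (j (a i)) = \<iota> (j (a i)) ^ p ^ m" by (simp flip: emb_power)
      then have "(Cop t ^^ m) (\<iota> (j (a i)) * g i) = \<iota> (j (a i)) * (Cop t ^^ m) (g i)"
        using Cop_iter_scale[OF t, of m "\<iota> (j (a i))" "g i"] by simp
      then show ?thesis using Cop_iter_fixed[OF Cop_dlog[OF t]] by (simp add: g_def)
    qed
    then show ?thesis unfolding a \<Phi>_def by (simp add: sum)
  qed
  have W_vge: "vge v (kappa t v - 1) x" "v \<notin> S \<Longrightarrow> vge v (kappa t v) x" if x: "x \<in> W" and v: "place v" for x v
  proof -
    obtain a where a: "x = \<Phi> a" using x unfolding W_def by blast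
    show "vge v (kappa t v - 1) x" unfolding a \<Phi>_def g_def
      by (intro vge_sum[OF v] vge_mult0[OF v vge_const[OF v]] vge_dlog[OF t v])
    assume "v \<notin> S"
    then show "vge v (kappa t v) x" unfolding a \<Phi>_def g_def
      by (intro vge_sum[OF v] vge_mult0[OF v vge_const[OF v]] vge_dlog_unit[OF t v] f(2)[OF _ v]) auto
  qed
  define n where "n = (\<lambda>v. nat (Poly_Mapping.lookup Gp v))"
  define e where "e = (\<Sum>v\<in>Poly_Mapping.keys Gp. n v * pdeg v)"
  have e: "int e = divisor_degree \<iota> Gp"
    unfolding e_def divisor_degree_def of_nat_sum using Gp(2) by (simp add: n_def)
  define W1 where "W1 = {x \<in> W. \<forall>v\<in>Poly_Mapping.keys Gp. vge v (kappa t v + int (n v)) x}"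
  \<comment> \<open>The support of \<open>Gp\<close> avoids \<open>S\<close>, so the forms of
    \<open>W\<close> are regular there, and raising the order at \<open>v\<close> by
    \<open>n v\<close> costs at most a factor \<open>CARD('k) ^ (n v * pdeg v)\<close>.\<close>
  have "card W \<le> card W1 * CARD('k) ^ e"
    unfolding W1_def e_def
  proof (rule card_le_card_vge_places[OF finite_keys Gp(1) finW W_diff])
    fix v x assume v: "v \<in> Poly_Mapping.keys Gp" and x: "x \<in> W"
    have "v \<notin> S" using v disj by (auto simp: S_def)
    then show "vge v (kappa t v) x" by (rule W_vge(2)[OF x Gp(1)[OF v]])
  qed
  then have card1: "q ^ r \<le> card W1 * q ^ (l * e)" using cardW assms(6) by (simp add: power_mult)
  have W1_W: "x \<in> W" if "x \<in> W1" for x using that by (simp add: W1_def)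
  have W1_diff: "x - y \<in> W1" if "x \<in> W1" "y \<in> W1" for x y
    using that W_diff vge_diff Gp(1) unfolding W1_def by blast
  have W1_G: "vge v (Poly_Mapping.lookup (G - point_divisor P) v + kappa t v) x" if x: "x \<in> W1" and v: "place v" for x v
  proof -
    have look: "Poly_Mapping.lookup (G - point_divisor P) v =
        Poly_Mapping.lookup Gp v - (if v \<in> Poly_Mapping.keys Gm then 1 else 0) - (if v \<in> range P then 1 else 0)"
      by (simp add: lookup_minus lookup_G lookup_P Gm(2))
    show ?thesis
    proof (cases "v \<in> Poly_Mapping.keys Gp")
      case True
      then have "vge v (kappa t v + Poly_Mapping.lookup Gp v) x" using x Gp(2)[of v] by (auto simp: W1_def n_def)
      then show ?thesis unfolding look by (rule vge_mono) (use Gp(2)[of v] in auto)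
    next
      case False
      then have 0: "Poly_Mapping.lookup Gp v = 0" by (simp add: in_keys_iff)
      show ?thesis
      proof (cases "v \<in> S")
        case True
        \<comment> \<open>A place of \<open>S\<close> lies in exactly one of the two supports, and
          both divisors are reduced; so \<open>G - D\<close> allows a pole of order exactly
          one.\<close>
        then have "(if v \<in> Poly_Mapping.keys Gm then 1 else 0) + (if v \<in> range P then 1 else 0) = (1 :: int)"
          using disj(3) by (auto simp: S_def)
        then have "Poly_Mapping.lookup (G - point_divisor P) v + kappa t v = kappa t v - 1" unfolding look 0 by linarith
        then show ?thesis using W_vge(1)[OF W1_W[OF x] v] by simp
      next
        case False
        then have "Poly_Mapping.lookup (G - point_divisor P) v + kappa t v = kappa t v" unfolding look 0 by (simp add: S_def)
        then show ?thesis using W_vge(2)[OF W1_W[OF x] v False] by simp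
      qed
    qed
  qed
  have "\<exists>\<tau>. P i \<tau> = 1" for i using local_parameter[OF PP(1)] by metis
  then obtain \<tau> where \<tau>: "\<And>i. P i (\<tau> i) = 1" by metis
  have nz: "pder t (\<tau> i) \<noteq> 0" for i
    using p_indep_local_parameter[OF PP(1) \<tau>] pder_p_indep_iff[OF t] by blast
  have k\<tau>: "P i (pder t (\<tau> i)) = kappa t (P i)" for i by (rule kappa[OF t PP(1) \<tau>])
  define \<rho> where "\<rho> = (\<lambda>x. \<chi> i. form_residue \<iota> smul d (P i) (smul x (d t)))"
  have res: "\<rho> x $ i = a" if "x \<in> W" "vge (P i) 1 (x * \<tau> i / pder t (\<tau> i) - \<iota> a)" for x i a
    using form_residue_eq[OF kd t PP(1) \<tau> W_vge(1)[OF that(1) PP(1)] that(2)] by (simp add: \<rho>_def)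
  \<comment> \<open>Since \<open>P i\<close> is rational, the class of
    \<open>x * \<tau> i / pder t (\<tau> i)\<close> is a constant, which is then the
    residue.\<close>
  have res_ex: "vge (P i) 1 (x * \<tau> i / pder t (\<tau> i) - \<iota> (\<rho> x $ i))" if x: "x \<in> W" for x i
  proof -
    have "vge (P i) 1 (\<tau> i)" using \<tau> by (simp add: vge_def)
    from vge_divide[OF PP(1) vge_mult[OF PP(1) W_vge(1)[OF x PP(1)] this] nz[of i]]
    have "vge (P i) 0 (x * \<tau> i / pder t (\<tau> i))" by (simp add: k\<tau>)
    then obtain a where a: "vge (P i) 1 (x * \<tau> i / pder t (\<tau> i) - \<iota> a)"
      using rational_residue[OF PP] by metis
    then show ?thesis using res[OF x a] by simp
  qed
  have \<rho>_diff: "\<rho> (x - y) = \<rho> x - \<rho> y" if x: "x \<in> W1" and y: "y \<in> W1" for x y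
  proof (rule vec_eq_iff[THEN iffD2], rule allI)
    fix i
    have "vge (P i) 1 ((x * \<tau> i / pder t (\<tau> i) - \<iota> (\<rho> x $ i)) - (y * \<tau> i / pder t (\<tau> i) - \<iota> (\<rho> y $ i)))"
      using W1_W x y by (intro vge_diff[OF PP(1)] res_ex)
    then have "vge (P i) 1 ((x - y) * \<tau> i / pder t (\<tau> i) - \<iota> (\<rho> x $ i - \<rho> y $ i))"
      by (simp add: left_diff_distrib diff_divide_distrib algebra_simps)
    then show "\<rho> (x - y) $ i = (\<rho> x - \<rho> y) $ i" using res W1_W[OF W1_diff[OF x y]] by simp
  qed
  define C where "C = cartier_code p m \<iota> smul d P G"
  have \<rho>C: "\<rho> ` W1 \<subseteq> C"
  proof (rule image_subsetI)
    fix x assume x: "x \<in> W1"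
    have "smul x (d t) \<in> form_space \<iota> smul d (G - point_divisor P)"
      using form_space_iff[OF kd t] W1_G[OF x] by blast
    moreover have "(cartier p \<iota> smul d ^^ m) (smul x (d t)) = smul x (d t)"
      using cartier_iter_form[OF kd t] W_fixed[OF W1_W[OF x]] by simp
    ultimately have "smul x (d t) \<in> cartier_fixed_forms p m \<iota> smul d (G - point_divisor P)"
      by (simp add: cartier_fixed_forms_def)
    then show "\<rho> x \<in> C" unfolding C_def cartier_code_def \<rho>_def by blast
  qed
  have finC: "finite C"
  proof -
    have "C \<subseteq> vec_lambda ` (UNIV \<rightarrow>\<^sub>E UNIV)"
    proof
      fix x :: "'k ^ 'n"
      show "x \<in> vec_lambda ` (UNIV \<rightarrow>\<^sub>E UNIV)" by (rule image_eqI[of _ _ "vec_nth x"]) auto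
    qed
    moreover have "finite (UNIV \<rightarrow>\<^sub>E (UNIV :: 'k set) :: ('n \<Rightarrow> 'k) set)"
      using fink by (intro finite_PiE) auto
    ultimately show ?thesis using finite_subset by blast
  qed
  define K where "K = {x \<in> W1. \<rho> x = 0}"
  have "card W1 \<le> card K * card C"
    unfolding K_def using finW W1_W by (intro conjunct2[OF card_le_card_kernel_mult[OF W1_diff \<rho>_diff _ \<rho>C finC]])
      (auto intro: finite_subset[of _ W])
  moreover have "card K \<le> CARD('e) ^ h1 \<iota> smul d G"
  proof (rule card_fixed_forms_le[OF kd t _ assms(2) assms(7)])
    show "CARD('e) = p ^ m" using assms(3,5) by simp
    show "x - y \<in> K" if "x \<in> K" "y \<in> K" for x y
      using that W1_diff \<rho>_diff by (simp add: K_def)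
    show "(Cop t ^^ m) x = x" if "x \<in> K" for x using that W_fixed W1_W by (simp add: K_def)
    fix x assume "x \<in> K"
    then have x: "x \<in> W1" "\<rho> x = 0" by (simp_all add: K_def)
    show "smul x (d t) \<in> form_space \<iota> smul d G"
      unfolding form_space_iff[OF kd t]
    proof (intro allI impI)
      fix v assume v: "place v"
      show "vge v (Poly_Mapping.lookup G v + kappa t v) x"
      proof (cases "v \<in> range P")
        case False
        then show ?thesis using W1_G[OF x(1) v] by (simp add: lookup_minus lookup_P)
      next
        case True
        then obtain i where i: "v = P i" by blast
        \<comment> \<open>Residue \<open>0\<close> puts this quotient into the maximal ideal;
          undoing the two factors leaves order at least \<open>kappa t v\<close>, which means that
          the form is regular at \<open>P i\<close>, where \<open>G\<close> has coefficient
          \<open>0\<close>.\<close>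
        have "vge v 1 (x * \<tau> i / pder t (\<tau> i))" using res_ex[OF W1_W[OF x(1)], of i] x(2) by (simp add: i)
        then have "vge v (1 + kappa t v) (x * \<tau> i / pder t (\<tau> i) * pder t (\<tau> i))"
          using k\<tau>[of i] by (intro vge_mult[OF v]) (auto simp: vge_def i)
        then have "vge v (1 + kappa t v - 1) (x * \<tau> i / \<tau> i)"
          using nz[of i] vge_divide[OF v, of "1 + kappa t v" "x * \<tau> i" "\<tau> i"] \<tau>[of i] val_nonzero[OF v, of "\<tau> i"]
          by (simp add: i)
        moreover have "\<tau> i \<noteq> 0" using \<tau>[of i] by (intro val_nonzero[OF PP(1)[of i]]) simp
        ultimately have "vge v (kappa t v) x" by simp
        moreover have "Poly_Mapping.lookup G v = 0" using assms(13)[of i] i by (simp add: in_keys_iff)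
        ultimately show ?thesis by simp
      qed
    qed
  qed
  moreover have "card C \<le> CARD('e) ^ vector_space.dim (\<lambda>(a::'e) w. j a *s w) C"
    by (rule card_le_power_dim[OF vector_space_code[OF assms(7)] fine finC])
  ultimately have "card W1 \<le> q ^ h1 \<iota> smul d G * q ^ vector_space.dim (\<lambda>(a::'e) w. j a *s w) C"
    unfolding assms(5) by (meson le_trans mult_le_mono)
  \<comment> \<open>The three contributions are the fixed forms in \<open>\<Omega>(G)\<close>, the
    code, and the conditions along \<open>Gp\<close>.\<close>
  then have "q ^ r \<le> q ^ (h1 \<iota> smul d G + vector_space.dim (\<lambda>(a::'e) w. j a *s w) C + l * e)"
    using card1 unfolding power_add by (meson le_trans mult_le_mono1)
  then have "r \<le> h1 \<iota> smul d G + vector_space.dim (\<lambda>(a::'e) w. j a *s w) C + l * e"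
    by (rule power_le_imp_le_exp[OF q1])
  then have "int r \<le> int (h1 \<iota> smul d G) + int (vector_space.dim (\<lambda>(a::'e) w. j a *s w) C) + int l * int e"
    by (simp flip: of_nat_mult of_nat_add)
  then show ?thesis using r unfolding C_def e[symmetric] by linarith
qed

end
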